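(* Let $X$ be a complex Banach space, $\Omega\subseteq\mathbb{C}$ a domain, and let $\lambda\mapsto K(\lambda)$ be an analytic map on $\Omega$ with values in $\mathcal{N}(X)$. Then the function $d$ defined by $$d(\lambda):=\det(\mathbb{1}-K(\lambda)),\qquad \lambda\in\Omega,$$ where $\det$ is the nuclear determinant, is holomorphic in $\Omega$.
   Context: Nuclear operators: for a complex Banach space $X$ with dual $X^*$, a compact operator $K\in\mathcal{B}(X)$ is nuclear, $K\in\mathcal{N}(X)$, if there are sequences $(f_n)\subseteq X$, $(\phi_n)\subseteq X^*$ with $Kf=\sum_{n=1}^\infty\langle\phi_n,f\rangle f_n$ for all $f\in X$ and $\sum_{n=1}^\infty\|\phi_n\|_{X^*}\|f_n\|_X<\infty$. The nuclear norm $\|K\|_{\mathcal{N}}$ is the infimum of $\sum_n\|\phi_n\|_{X^*}\|f_n\|_X$ over all such representations. Nuclear (regularized) determinant: for $K\in\mathcal{N}(X)$, $$\det(\mathbb{1}-K):=\prod_{n}\bigl(1-\lambda_n(K)\bigr)\exp\bigl(\lambda_n(K)\bigr),$$ where $\lambda_n(K)$ are the nonzero eigenvalues of $K$, repeated according to algebraic multiplicity. (It is known that $\sum_n|\lambda_n(K)|^2\le\|K\|_{\mathcal{N}}^2$.) Analytic $\mathcal{N}(X)$-valued map on a domain $\Omega$: for every $\lambda_0\in\Omega$ there are $R_{\lambda_0}>0$ and nuclear operators $K_{n,\lambda_0}\in\mathcal{N}(X)$, $n\ge 0$, such that for all $\lambda\in\Omega$ with $|\lambda-\lambda_0|<R_{\lambda_0}$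 one has $K(\lambda)=\sum_{n=0}^\infty(\lambda-\lambda_0)^nK_{n,\lambda_0}$ and $\sum_{n=0}^\infty|\lambda-\lambda_0|^n\|K_{n,\lambda_0}\|_{\mathcal{N}}<\infty$. *)

theory Defs
  imports "HOL-Analysis.Analysis"
begin

section \<open>Complex Banach spaces\<close>

text \<open>A complex normed space is a real normed space with a compatible scalar multiplication by
  complex numbers, so that the library's topology, bounded linear maps and their operator norm
  (which does not depend on the scalar field) remain available.\<close>

class complex_normed_vector = real_normed_vector +
  fixes scaleC :: "complex \<Rightarrow> 'a \<Rightarrow> 'a" (infixr \<open>*\<^sub>C\<close> 75)
  assumes scaleC_add_right: "c *\<^sub>C (x + y) = c *\<^sub>C x + c *\<^sub>C y"
    and scaleC_add_left: "(c + d) *\<^sub>C x = c *\<^sub>C x + d *\<^sub>C x"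
    and scaleC_scaleC: "c *\<^sub>C d *\<^sub>C x = (c * d) *\<^sub>C x"
    and scaleR_eq_scaleC: "r *\<^sub>R x = complex_of_real r *\<^sub>C x"
    and norm_scaleC: "norm (c *\<^sub>C x) = cmod c * norm x"

class complex_banach = complex_normed_vector + complete_space

subclass (in complex_banach) banach ..

lemma scaleC_one: "1 *\<^sub>C x = (x :: 'a::complex_normed_vector)"
  using scaleR_eq_scaleC[of 1 x] by simp

global_interpretation complex_vector:
  vector_space "scaleC :: complex \<Rightarrow> 'a \<Rightarrow> 'a::complex_normed_vector"
  by unfold_locales (simp_all add: scaleC_add_right scaleC_add_left scaleC_scaleC scaleC_one)

instantiation complex :: complex_banach
begin

definition scaleC_complex :: "complex \<Rightarrow> complex \<Rightarrow> complex" where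
  "scaleC_complex c z = c * z"

instance
  by standard (simp_all add: scaleC_complex_def algebra_simps norm_mult scaleR_conv_of_real)

end

lemma bounded_linear_scaleC: "bounded_linear (\<lambda>x :: 'a::complex_normed_vector. c *\<^sub>C x)"
  by (rule bounded_linear_intro[where K = "cmod c"])
     (simp_all add: scaleC_add_right scaleR_eq_scaleC scaleC_scaleC norm_scaleC mult.commute)

lemma bounded_linear_scaleC_blinfun:
  fixes T :: "'a::real_normed_vector \<Rightarrow>\<^sub>L 'b::complex_normed_vector"
  shows "bounded_linear (\<lambda>x. c *\<^sub>C blinfun_apply T x)"
  by (rule bounded_linear_compose[OF bounded_linear_scaleC blinfun.bounded_linear_right])

text \<open>Real-linear bounded maps into a complex space form a complex normed space under pointwise
  scalar multiplication.\<close>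

instantiation blinfun :: (real_normed_vector, complex_normed_vector) complex_normed_vector
begin

definition scaleC_blinfun :: "complex \<Rightarrow> 'a \<Rightarrow>\<^sub>L 'b \<Rightarrow> 'a \<Rightarrow>\<^sub>L 'b" where
  "scaleC_blinfun c T = Blinfun (\<lambda>x. c *\<^sub>C blinfun_apply T x)"

lemma blinfun_apply_scaleC: "blinfun_apply (c *\<^sub>C T) x = c *\<^sub>C blinfun_apply T x"
  unfolding scaleC_blinfun_def
  by (simp add: bounded_linear_Blinfun_apply[OF bounded_linear_scaleC_blinfun])

instance
proof
  fix c d :: complex and r :: real and S T :: "'a \<Rightarrow>\<^sub>L 'b"
  show "c *\<^sub>C (S + T) = c *\<^sub>C S + c *\<^sub>C T"
    by (rule blinfun_eqI) (simp add: blinfun_apply_scaleC blinfun.add_left scaleC_add_right)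
  show "(c + d) *\<^sub>C T = c *\<^sub>C T + d *\<^sub>C T"
    by (rule blinfun_eqI) (simp add: blinfun_apply_scaleC blinfun.add_left scaleC_add_left)
  show "c *\<^sub>C d *\<^sub>C T = (c * d) *\<^sub>C T"
    by (rule blinfun_eqI) (simp add: blinfun_apply_scaleC scaleC_scaleC)
  show "r *\<^sub>R T = complex_of_real r *\<^sub>C T"
    by (rule blinfun_eqI) (simp add: blinfun_apply_scaleC blinfun.scaleR_left scaleR_eq_scaleC)
  have "blinfun_apply (c *\<^sub>C T) = (\<lambda>x. c *\<^sub>C blinfun_apply T x)"
    by (rule ext) (rule blinfun_apply_scaleC)
  then have "norm (c *\<^sub>C T) = onorm (\<lambda>x. c *\<^sub>C blinfun_apply T x)"
    by (simp add: norm_blinfun.rep_eq)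
  also have "\<dots> = onorm (\<lambda>x. cmod c *\<^sub>R blinfun_apply T x)"
    by (simp add: onorm_def norm_scaleC)
  also have "\<dots> = cmod c * norm T"
    by (simp add: onorm_scaleR[OF blinfun.bounded_linear_right] norm_blinfun.rep_eq)
  finally show "norm (c *\<^sub>C T) = cmod c * norm T" .
qed

end


section \<open>Nuclear operators\<close>

definition complex_linear ::
  "('a::complex_normed_vector \<Rightarrow>\<^sub>L 'b::complex_normed_vector) \<Rightarrow> bool" where
  "complex_linear T \<longleftrightarrow> (\<forall>c x. blinfun_apply T (c *\<^sub>C x) = c *\<^sub>C blinfun_apply T x)"

definition compact_operator :: "('a::complex_banach \<Rightarrow>\<^sub>L 'a) \<Rightarrow> bool" where
  "compact_operator K \<longleftrightarrow>
     complex_linear K \<and> compact (closure (blinfun_apply K ` cball 0 1))"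

definition nuclear_representation ::
  "('a::complex_banach \<Rightarrow>\<^sub>L 'a) \<Rightarrow> (nat \<Rightarrow> 'a \<Rightarrow>\<^sub>L complex) \<Rightarrow> (nat \<Rightarrow> 'a) \<Rightarrow> bool" where
  "nuclear_representation K \<phi> f \<longleftrightarrow>
     (\<forall>n. complex_linear (\<phi> n)) \<and>
     (\<forall>x. (\<lambda>n. blinfun_apply (\<phi> n) x *\<^sub>C f n) sums blinfun_apply K x) \<and>
     summable (\<lambda>n. norm (\<phi> n) * norm (f n))"

definition nuclear_operator :: "('a::complex_banach \<Rightarrow>\<^sub>L 'a) \<Rightarrow> bool" where
  "nuclear_operator K \<longleftrightarrow> compact_operator K \<and> (\<exists>\<phi> f. nuclear_representation K \<phi> f)"

definition nuclear_norm :: "('a::complex_banach \<Rightarrow>\<^sub>L 'a) \<Rightarrow> real" where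
  "nuclear_norm K =
     Inf {(\<Sum>n. norm (\<phi> n) * norm (f n)) | \<phi> f. nuclear_representation K \<phi> f}"


section \<open>The nuclear determinant\<close>

definition is_eigenvalue :: "('a::complex_banach \<Rightarrow>\<^sub>L 'a) \<Rightarrow> complex \<Rightarrow> bool" where
  "is_eigenvalue K \<mu> \<longleftrightarrow> (\<exists>x. x \<noteq> 0 \<and> blinfun_apply K x = \<mu> *\<^sub>C x)"

definition generalized_eigenspace :: "('a::complex_banach \<Rightarrow>\<^sub>L 'a) \<Rightarrow> complex \<Rightarrow> 'a set" where
  "generalized_eigenspace K \<mu> =
     (\<Union>k. {x. ((\<lambda>y. blinfun_apply K y - \<mu> *\<^sub>C y) ^^ k) x = 0})"

definition algebraic_multiplicity :: "('a::complex_banach \<Rightarrow>\<^sub>L 'a) \<Rightarrow> complex \<Rightarrow> nat" where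
  "algebraic_multiplicity K \<mu> = complex_vector.dim (generalized_eigenspace K \<mu>)"

text \<open>There may be only finitely many nonzero eigenvalues, so the sequence may take the value 0
  at any number of places; these contribute the factor 1 to the determinant.\<close>

definition enumerates_eigenvalues ::
  "('a::complex_banach \<Rightarrow>\<^sub>L 'a) \<Rightarrow> (nat \<Rightarrow> complex) \<Rightarrow> bool" where
  "enumerates_eigenvalues K l \<longleftrightarrow>
     range l - {0} = {\<mu>. \<mu> \<noteq> 0 \<and> is_eigenvalue K \<mu>} \<and>
     (\<forall>\<mu>. \<mu> \<noteq> 0 \<and> is_eigenvalue K \<mu> \<longrightarrow>
        finite {n. l n = \<mu>} \<and> card {n. l n = \<mu>} = algebraic_multiplicity K \<mu>)"

text \<open>\<open>nuclear_det K\<close> is the regularized determinant of \<open>1 - K\<close>. For nuclear \<open>K\<close> the squares of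
  the eigenvalues are absolutely summable, so the product converges absolutely and does not
  depend on the enumeration.\<close>

definition nuclear_det :: "('a::complex_banach \<Rightarrow>\<^sub>L 'a) \<Rightarrow> complex" where
  "nuclear_det K =
     (let l = (SOME l. enumerates_eigenvalues K l) in \<Prod>n. (1 - l n) * exp (l n))"


section \<open>Analytic maps into the nuclear operators\<close>

text \<open>The power series is required to converge to \<open>K z\<close> in operator norm. Together with the
  summability of the nuclear norms this is equivalent to convergence in nuclear norm.\<close>

definition nuclear_analytic_on ::
  "(complex \<Rightarrow> 'a::complex_banach \<Rightarrow>\<^sub>L 'a) \<Rightarrow> complex set \<Rightarrow> bool" where
  "nuclear_analytic_on K \<Omega> \<longleftrightarrow>
     (\<forall>z\<in>\<Omega>. nuclear_operator (K z)) \<and>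
     (\<forall>z\<^sub>0\<in>\<Omega>. \<exists>R>0. \<exists>C. (\<forall>n. nuclear_operator (C n)) \<and>
        (\<forall>z\<in>\<Omega>. cmod (z - z\<^sub>0) < R \<longrightarrow>
           (\<lambda>n. (z - z\<^sub>0) ^ n *\<^sub>C C n) sums K z \<and>
           summable (\<lambda>n. cmod (z - z\<^sub>0) ^ n * nuclear_norm (C n))))"

end

theory Submission
  imports Defs "HOL-Complex_Analysis.Complex_Analysis" "HOL-Real_Asymp.Real_Asymp"
    "Jordan_Normal_Form.Schur_Decomposition"
begin

text \<open>Near a point \<open>z\<^sub>0\<close> all operators \<open>K z\<close> are of the form \<open>\<Sum>k. \<phi> k \<otimes> f k\<close> with fixed functionals
  \<open>\<phi> k\<close>, vectors \<open>f k\<close> depending polynomially on \<open>z\<close>, and square summable norms. The determinant of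
  \<open>1 - K z\<close> is then the Hilbert-Carleman determinant of the infinite matrix \<open>M j k = \<phi> j (f k)\<close>, the
  limit of \<open>det (1 - M) exp (trace M)\<close> over finite truncations. By Hadamard's inequality these are
  bounded by \<open>exp (\<parallel>M\<parallel>\<^sup>2 / 2)\<close> in the Hilbert-Schmidt norm, so that they converge locally uniformly and
  the limit is holomorphic in \<open>z\<close>.

  To compare with the product over the eigenvalues, split off one eigenvector \<open>v\<close> at a time, replacing
  each \<open>f k\<close> by its component orthogonal to \<open>v\<close> in the semi-inner product \<open>\<Sum>j. cnj (\<phi> j x) * \<phi> j y\<close>.
  This extracts the factor \<open>(1 - \<lambda>) exp \<lambda>\<close> from the determinant, lowers the multiplicity of \<open>\<lambda>\<close> by one
  and \<open>\<parallel>M\<parallel>\<^sup>2\<close> by at least the squared modulus of \<open>\<lambda>\<close>. The determinants remaining after \<open>n\<close> steps, as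
  functions of \<open>w\<close> in \<open>det (1 - w M)\<close>, have no zeros in discs of growing radius and grow uniformly with
  order two and minimal type, hence they tend to \<open>1\<close>.\<close>

section \<open>Determinants of finite truncations\<close>

text \<open>Individual eigenvalues branch as \<open>z\<close> varies, so their product is compared
  with a quantity built from matrix entries. The matrix arises by factoring the operator through
  l^2, sending \<open>x\<close> to the sequence \<open>\<phi> k x\<close> and a sequence c to the
  sum of the c k times \<open>f k\<close>, and composing in the other order. This keeps the nonzero
  spectrum and puts Hilbert space estimates at the disposal of a Banach space problem. The trace of
  this matrix need not be determined by the eigenvalues, so \<open>exp (trace M)\<close> is never
  treated apart from the determinant: all limits are taken for the combination, which is controlled
  by the Hilbert-Schmidt norm alone. Two features make the residual determinants tend to 1. A
  zero-free function of order two may still be the exponential of b w + c w^2: a purely quadratic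
  bound on its growth excludes b, and minimal type excludes c. These bounds must hold for all
  deflations at once, which dictates the orthogonal projection: it shrinks the seminorm of every
  \<open>f k\<close>, so a single summable column bound serves throughout, whereas an arbitrary
  projection along \<open>v\<close> could enlarge the columns.\<close>

definition dtm :: "nat \<Rightarrow> (nat \<Rightarrow> nat \<Rightarrow> complex) \<Rightarrow> complex" where
  "dtm N A = Determinant.det (Matrix.mat N N (\<lambda>(i,j). A i j))"

definition idm :: "nat \<Rightarrow> nat \<Rightarrow> complex" where
  "idm i j = (if i = j then 1 else 0)"

lemma dtm_cong:
  assumes "\<And>i j. i < N \<Longrightarrow> j < N \<Longrightarrow> A i j = B i j"
  shows "dtm N A = dtm N B"
proof -
  have "Matrix.mat N N (\<lambda>(i,j). A i j) = Matrix.mat N N (\<lambda>(i,j). B i j)"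
    by (rule eq_matI) (use assms in auto)
  then show ?thesis by (simp add: dtm_def)
qed

lemma dtm_leibniz:
  "dtm N A = (\<Sum>p | p permutes {0..<N}. signof p * (\<Prod>i = 0..<N. A i (p i)))"
proof -
  have "dtm N A = (\<Sum>p \<in> {p. p permutes {0..<N}}.
     signof p * (\<Prod>i = 0..<N. Matrix.mat N N (\<lambda>(i,j). A i j) $$ (i, p i)))"
    unfolding dtm_def by (rule det_def') auto
  also have "\<dots> = (\<Sum>p | p permutes {0..<N}. signof p * (\<Prod>i = 0..<N. A i (p i)))"
    by (rule sum.cong[OF refl]) (auto intro!: arg_cong2[where f = "(*)"] prod.cong
        dest: permutes_in_image)
  finally show ?thesis .
qed

lemma mat_of_mult:
  "Matrix.mat N N (\<lambda>(i,j). A i j) * Matrix.mat N N (\<lambda>(i,j). B i j)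
     = Matrix.mat N N (\<lambda>(i,j). \<Sum>k<N. A i k * (B k j :: complex))"
  by (rule eq_matI) (auto simp: scalar_prod_def atLeast0LessThan)

lemma dtm_mult: "dtm N (\<lambda>i j. \<Sum>k<N. A i k * B k j) = dtm N A * dtm N B"
  unfolding dtm_def mat_of_mult[symmetric] by (rule det_mult) auto

lemma dtm_idm: "dtm N idm = 1"
proof -
  have "Matrix.mat N N (\<lambda>(i,j). idm i j) = 1\<^sub>m N"
    by (rule eq_matI) (auto simp: idm_def)
  then show ?thesis by (simp add: dtm_def)
qed

lemma dtm_holomorphic:
  assumes "\<And>i j. i < N \<Longrightarrow> j < N \<Longrightarrow> (\<lambda>z. A z i j) holomorphic_on S"
  shows "(\<lambda>z. dtm N (A z)) holomorphic_on S"
  unfolding dtm_leibniz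
proof (intro holomorphic_intros)
  fix p i
  assume "p \<in> {p. p permutes {0..<N}}" "i \<in> {0..<N}"
  then show "(\<lambda>z. A z i (p i)) holomorphic_on S"
    by (intro assms) (auto dest: permutes_in_image)
qed

lemma dtm_cnj: "dtm N (\<lambda>i j. cnj (A i j)) = cnj (dtm N A)"
proof -
  have "cnj (signof p) = signof p" for p :: "nat \<Rightarrow> nat"
    by (cases p rule: sign_cases) auto
  then show ?thesis unfolding dtm_leibniz by simp
qed

lemma dtm_transpose: "dtm N (\<lambda>i j. A j i) = dtm N A"
proof -
  have "Matrix.mat N N (\<lambda>(i,j). A j i) = transpose_mat (Matrix.mat N N (\<lambda>(i,j). A i j))"
    by (rule eq_matI) auto
  then show ?thesis unfolding dtm_def by (simp add: det_transpose[of _ N])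
qed

lemma dtm_Suc:
  assumes col: "\<And>i. i \<le> N \<Longrightarrow> A i N = idm i N"
  shows "dtm (Suc N) A = dtm N A"
proof -
  let ?A = "Matrix.mat (Suc N) (Suc N) (\<lambda>(i,j). A i j)"
  have "dtm (Suc N) A = (\<Sum>i<Suc N. ?A $$ (i,N) * cofactor ?A i N)"
    unfolding dtm_def by (rule laplace_expansion_column) auto
  also have "\<dots> = (\<Sum>i<Suc N. if i = N then cofactor ?A N N else 0)"
    by (rule sum.cong) (use col in \<open>auto simp: idm_def\<close>)
  also have "\<dots> = cofactor ?A N N" by simp
  also have "\<dots> = Determinant.det (mat_delete ?A N N)"
    by (simp add: cofactor_def power_add[symmetric])
  also have "mat_delete ?A N N = Matrix.mat N N (\<lambda>(i,j). A i j)"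
    by (rule eq_matI) (auto simp: mat_delete_def)
  finally show ?thesis by (simp add: dtm_def)
qed

text \<open>Expansion along the last column only looks at entries on and above the diagonal, so
  nothing is required below it. This is what lets truncations of different sizes be compared inside
  one matrix size.\<close>

lemma dtm_extend:
  assumes "\<And>i j. j \<ge> N \<Longrightarrow> i \<le> j \<Longrightarrow> A i j = idm i j" and "N \<le> L"
  shows "dtm L A = dtm N A"
  using assms(2)
proof (induction L rule: dec_induct)
  case (step n)
  then show ?case using dtm_Suc[of n A] assms(1) by simp
qed simp

lemma dtm_inverse:
  assumes "dtm N A \<noteq> 0"
  obtains B where
    "\<And>i j. i < N \<Longrightarrow> j < N \<Longrightarrow> (\<Sum>k<N. A i k * B k j) = idm i j"
    "\<And>i j. i < N \<Longrightarrow> j < N \<Longrightarrow> (\<Sum>k<N. B i k * A k j) = idm i j"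
proof -
  let ?A = "Matrix.mat N N (\<lambda>(i,j). A i j)"
  let ?C = "adj_mat ?A"
  define B where "B i j = ?C $$ (i,j) / dtm N A" for i j
  have A: "?A \<in> carrier_mat N N" by simp
  note adj = adj_mat[OF A]
  have C: "?C = Matrix.mat N N (\<lambda>(i,j). ?C $$ (i,j))"
    using adj(1) by (intro eq_matI) auto
  show ?thesis
  proof (rule that)
    fix i j assume ij: "i < N" "j < N"
    have "(\<Sum>k<N. A i k * ?C $$ (k,j)) = (?A * ?C) $$ (i,j)"
      by (subst C, subst mat_of_mult) (use ij in simp)
    also have "\<dots> = dtm N A * idm i j"
      using ij unfolding adj(2) by (simp add: dtm_def idm_def)
    finally show "(\<Sum>k<N. A i k * B k j) = idm i j"
      using assms by (simp add: B_def sum_divide_distrib[symmetric])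
    have "(\<Sum>k<N. ?C $$ (i,k) * A k j) = (?C * ?A) $$ (i,j)"
      by (subst (2) C, subst mat_of_mult) (use ij in simp)
    also have "\<dots> = dtm N A * idm i j"
      using ij unfolding adj(3) by (simp add: dtm_def idm_def)
    finally show "(\<Sum>k<N. B i k * A k j) = idm i j"
      using assms by (simp add: B_def sum_divide_distrib[symmetric])
  qed
qed

lemma dtm_eq_0_imp_null_vector:
  assumes "dtm N A = 0"
  obtains x where "\<exists>i<N. x i \<noteq> 0" "\<And>i. i < N \<Longrightarrow> (\<Sum>k<N. A i k * x k) = 0"
proof -
  let ?A = "Matrix.mat N N (\<lambda>(i,j). A i j)"
  have "?A \<in> carrier_mat N N" by simp
  from det_0_iff_vec_prod_zero[OF this] assms obtain v
    where v: "v \<in> carrier_vec N" "v \<noteq> 0\<^sub>v N" "?A *\<^sub>v v = 0\<^sub>v N"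
    by (auto simp: dtm_def)
  show ?thesis
  proof (rule that[of "vec_index v"])
    show "\<exists>i<N. vec_index v i \<noteq> 0"
    proof (rule ccontr)
      assume "\<not> (\<exists>i<N. vec_index v i \<noteq> 0)"
      then have "v = 0\<^sub>v N" using v(1) by (intro eq_vecI) auto
      then show False using v(2) by simp
    qed
    fix i assume i: "i < N"
    have "vec_index (?A *\<^sub>v v) i = (\<Sum>k<N. A i k * vec_index v k)"
      using i v(1) by (simp add: scalar_prod_def atLeast0LessThan)
    then show "(\<Sum>k<N. A i k * vec_index v k) = 0" using v(3) i by simp
  qed
qed

text \<open>Eliminate in the bordered matrix with blocks \<open>1\<close>, \<open>b\<close>, \<open>a\<close>, \<open>1\<close> once by rows and once by columns.\<close>

lemma dtm_rank_one: "dtm N (\<lambda>i j. idm i j - a i * b j) = 1 - (\<Sum>k<N. b k * a k)"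
proof -
  let ?a = "Matrix.mat N 1 (\<lambda>(i,j). a i)"
  let ?b = "Matrix.mat 1 N (\<lambda>(i,j). b j)"
  let ?I = "1\<^sub>m N" and ?J = "1\<^sub>m 1 :: complex mat"
  let ?X = "four_block_mat ?J ?b ?a ?I"
  let ?Y = "four_block_mat ?J (0\<^sub>m 1 N) (- ?a) ?I"
  let ?s = "\<Sum>k<N. b k * a k"
  have Y: "Determinant.det ?Y = 1"
    by (subst det_four_block_mat_upper_right_zero[of _ 1 _ N]) auto
  have [simp]: "?J \<in> carrier_mat 1 1" "?I \<in> carrier_mat N N" "?a \<in> carrier_mat N 1"
    "?b \<in> carrier_mat 1 N" "- ?a \<in> carrier_mat N 1" "0\<^sub>m 1 N \<in> carrier_mat 1 N"
    by auto
  have X4: "?X \<in> carrier_mat (1 + N) (1 + N)" "?Y \<in> carrier_mat (1 + N) (1 + N)"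
    by (rule four_block_carrier_mat; simp)+
  have YX: "?Y * ?X = four_block_mat ?J ?b (0\<^sub>m N 1) (Matrix.mat N N (\<lambda>(i,j). idm i j - a i * b j))"
    by (subst mult_four_block_mat[of _ 1 1 _ N _ N _ _ 1 _ N])
       (auto intro!: arg_cong3[where f = "four_block_mat ?J"] eq_matI simp: scalar_prod_def idm_def)
  have XY: "?X * ?Y = four_block_mat (Matrix.mat 1 1 (\<lambda>_. 1 - ?s)) ?b (0\<^sub>m N 1) ?I"
    by (subst mult_four_block_mat[of _ 1 1 _ N _ N _ _ 1 _ N])
       (auto intro!: eq_matI simp: scalar_prod_def atLeast0LessThan sum_negf four_block_mat_def)
  have "Determinant.det (?Y * ?X) = Determinant.det (?X * ?Y)"
    by (simp only: det_mult[OF X4(1) X4(2)] det_mult[OF X4(2) X4(1)] mult.commute)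
  moreover have "Determinant.det (?Y * ?X) = dtm N (\<lambda>i j. idm i j - a i * b j)"
    unfolding YX dtm_def by (subst det_four_block_mat_lower_left_zero[of _ 1 _ N]) auto
  moreover have "Determinant.det (?X * ?Y) = 1 - ?s"
    unfolding XY by (subst det_four_block_mat_lower_left_zero[of _ 1 _ N]) (auto simp: det_single)
  ultimately show ?thesis by simp
qed

section \<open>Determinant and trace through eigenvalues\<close>

lemma mat_trace_commute:
  assumes "X \<in> carrier_mat n n" "Y \<in> carrier_mat n n"
  shows "(\<Sum>i<n. (X * Y) $$ (i,i)) = (\<Sum>i<n. (Y * X) $$ (i,i) :: complex)"
proof -
  have "(\<Sum>i<n. (X * Y) $$ (i,i)) = (\<Sum>i<n. \<Sum>k<n. X $$ (i,k) * Y $$ (k,i))"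
    using assms by (intro sum.cong) (auto simp: scalar_prod_def atLeast0LessThan)
  also have "\<dots> = (\<Sum>k<n. \<Sum>i<n. X $$ (i,k) * Y $$ (k,i))" by (rule sum.swap)
  also have "\<dots> = (\<Sum>i<n. (Y * X) $$ (i,i))"
    using assms by (intro sum.cong) (auto simp: scalar_prod_def atLeast0LessThan mult.commute)
  finally show ?thesis .
qed

text \<open>Schur triangularization puts the roots of the characteristic polynomial on the diagonal
  of a similar matrix, and both determinant and trace are similarity invariants.\<close>

lemma mat_eigenvalue_list:
  fixes A :: "complex mat"
  assumes A: "A \<in> carrier_mat n n"
  obtains es where "Determinant.det A = prod_list es" "(\<Sum>i<n. A $$ (i,i)) = sum_list es"
    "length es = n" "\<And>e. e \<in> set es \<Longrightarrow> eigenvalue A e"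
proof -
  obtain es where es: "char_poly A = (\<Prod>a\<leftarrow>es. [:- a, 1:])" "length es = n"
    using char_poly_factorized[OF A] by blast
  obtain B P Q where BPQ: "schur_decomposition A es = (B,P,Q)" by (cases "schur_decomposition A es")
  from schur_decomposition[OF A es(1) BPQ]
  have sim: "similar_mat_wit A B P Q" and ut: "upper_triangular B" and dg: "diag_mat B = es" by auto
  note w = similar_mat_witD2[OF A sim]
  have "Determinant.det A = Determinant.det B"
    using sim by (intro det_similar) (auto simp: similar_mat_def)
  also have "\<dots> = prod_list es"
    using det_upper_triangular[OF ut w(5)] dg by simp
  finally have 1: "Determinant.det A = prod_list es" .
  have "(\<Sum>i<n. A $$ (i,i)) = (\<Sum>i<n. (P * B * Q) $$ (i,i))" using w(3) by simp
  also have "\<dots> = (\<Sum>i<n. (Q * (P * B)) $$ (i,i))"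
    by (rule mat_trace_commute) (use w in auto)
  also have "Q * (P * B) = (Q * P) * B" by (rule assoc_mult_mat[symmetric]) (use w in auto)
  also have "\<dots> = B" using w by simp
  also have "(\<Sum>i<n. B $$ (i,i)) = sum_list (diag_mat B)"
    using w(5) by (simp add: diag_mat_def sum_list_distinct_conv_sum_set atLeast0LessThan)
  finally have 2: "(\<Sum>i<n. A $$ (i,i)) = sum_list es" using dg by simp
  have 3: "eigenvalue A e" if "e \<in> set es" for e
  proof -
    have "poly (char_poly A) e = 0"
      unfolding es(1) using that by (auto simp: poly_prod_list prod_list_zero_iff)
    then show ?thesis using eigenvalue_root_char_poly[OF A] by simp
  qed
  show ?thesis by (rule that[OF 1 2 es(2) 3])
qed

text \<open>Every eigenvalue \<open>e\<close> of the positive semidefinite matrix \<open>A\<^sup>* A\<close> satisfies \<open>e \<le> exp (e - 1)\<close>;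
  multiplying over all eigenvalues bounds its determinant through its trace.\<close>

lemma dtm_norm_bound:
  "(cmod (dtm N A))\<^sup>2 \<le> exp ((\<Sum>i<N. \<Sum>j<N. (cmod (A i j))\<^sup>2) - N)"
proof -
  define G where "G i j = (\<Sum>k<N. cnj (A k i) * A k j)" for i j
  define M where "M = Matrix.mat N N (\<lambda>(i,j). G i j)"
  have M: "M \<in> carrier_mat N N" by (simp add: M_def)
  have "Determinant.det M = dtm N G" by (simp add: M_def dtm_def)
  also have "\<dots> = dtm N (\<lambda>i j. cnj (A j i)) * dtm N A"
    unfolding G_def by (rule dtm_mult)
  also have "\<dots> = cnj (dtm N A) * dtm N A"
    using dtm_transpose[of N "\<lambda>i j. cnj (A i j)"] by (simp add: dtm_cnj)
  finally have det: "Determinant.det M = of_real ((cmod (dtm N A))\<^sup>2)"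
    by (simp add: complex_norm_square mult.commute del: of_real_power)
  have tr: "(\<Sum>i<N. M $$ (i,i)) = of_real (\<Sum>i<N. \<Sum>j<N. (cmod (A i j))\<^sup>2)"
  proof -
    have "(\<Sum>i<N. M $$ (i,i)) = (\<Sum>i<N. \<Sum>k<N. of_real ((cmod (A k i))\<^sup>2))"
      by (intro sum.cong refl)
         (auto simp: M_def G_def complex_norm_square mult.commute simp del: of_real_power intro!: sum.cong)
    also have "\<dots> = of_real (\<Sum>i<N. \<Sum>k<N. (cmod (A k i))\<^sup>2)" by simp
    also have "(\<Sum>i<N. \<Sum>k<N. (cmod (A k i))\<^sup>2) = (\<Sum>i<N. \<Sum>j<N. (cmod (A i j))\<^sup>2)"
      by (rule sum.swap)
    finally show ?thesis .
  qed
  obtain es where es: "Determinant.det M = prod_list es" "(\<Sum>i<N. M $$ (i,i)) = sum_list es"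
    "length es = N" "\<And>e. e \<in> set es \<Longrightarrow> eigenvalue M e"
    using mat_eigenvalue_list[OF M] by blast
  have pos: "e = of_real (cmod e)" if e: "e \<in> set es" for e
  proof -
    obtain v where v: "v \<in> carrier_vec N" "v \<noteq> 0\<^sub>v N" "M *\<^sub>v v = e \<cdot>\<^sub>v v"
      using es(4)[OF e] M by (auto simp: eigenvalue_def eigenvector_def)
    define x where "x i = vec_index v i" for i
    have ev: "(\<Sum>k<N. G i k * x k) = e * x i" if "i < N" for i
    proof -
      have "vec_index (M *\<^sub>v v) i = (\<Sum>k<N. G i k * x k)"
        using that v(1) by (simp add: M_def x_def scalar_prod_def atLeast0LessThan)
      then show ?thesis using v(1) v(3) that by (simp add: x_def)
    qed
    define n2 where "n2 = (\<Sum>i<N. (cmod (x i))\<^sup>2)"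
    define m2 where "m2 = (\<Sum>k<N. (cmod (\<Sum>i<N. A k i * x i))\<^sup>2)"
    have "n2 \<noteq> 0"
    proof
      assume "n2 = 0"
      then have "\<forall>i<N. x i = 0" by (auto simp: n2_def sum_nonneg_eq_0_iff)
      then have "v = 0\<^sub>v N" using v(1) by (intro eq_vecI) (auto simp: x_def)
      then show False using v(2) by simp
    qed
    have n2: "n2 > 0" using \<open>n2 \<noteq> 0\<close> unfolding n2_def by (simp add: sum_nonneg order_less_le)
    \<comment> \<open>Rayleigh quotient: pairing \<open>G x = e x\<close> with \<open>x\<close>
      gives \<open>e\<close> times the squared norm of \<open>x\<close> on one side and the squared
      norm of \<open>A x\<close> on the other.\<close>
    have "e * of_real n2 = (\<Sum>i<N. cnj (x i) * (e * x i))"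
      by (simp add: n2_def sum_distrib_left complex_norm_square mult_ac del: of_real_power)
    also have "\<dots> = (\<Sum>i<N. cnj (x i) * (\<Sum>j<N. G i j * x j))"
      by (intro sum.cong refl) (simp add: ev)
    also have "\<dots> = (\<Sum>i<N. \<Sum>j<N. \<Sum>k<N. cnj (A k i * x i) * (A k j * x j))"
      by (simp add: G_def sum_distrib_left sum_distrib_right mult_ac)
    also have "\<dots> = (\<Sum>i<N. \<Sum>k<N. \<Sum>j<N. cnj (A k i * x i) * (A k j * x j))"
      by (intro sum.cong refl sum.swap)
    also have "\<dots> = (\<Sum>k<N. \<Sum>i<N. \<Sum>j<N. cnj (A k i * x i) * (A k j * x j))"
      by (rule sum.swap)
    also have "\<dots> = of_real m2"
    proof -
      have "complex_of_real ((cmod S)\<^sup>2) = cnj S * S" for S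
        by (metis complex_norm_square mult.commute)
      then show ?thesis
        unfolding m2_def of_real_sum by (simp only: cnj_sum sum_product)
    qed
    finally have "e = of_real (m2 / n2)" using n2 by (simp add: field_simps)
    moreover have "m2 \<ge> 0" by (simp add: m2_def sum_nonneg)
    ultimately show ?thesis using n2 by (simp add: norm_divide)
  qed
  have "prod_list (map cmod es) \<le> exp (sum_list (map cmod es) - length es)" for es :: "complex list"
  proof (induction es)
    case (Cons e es)
    have "cmod e \<le> exp (cmod e - 1)" using exp_ge_add_one_self[of "cmod e - 1"] by simp
    then have "cmod e * prod_list (map cmod es) \<le> exp (cmod e - 1) * exp (sum_list (map cmod es) - length es)"
      using Cons by (intro mult_mono) (auto intro!: prod_list_nonneg)
    then show ?case by (simp add: exp_add[symmetric] algebra_simps)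
  qed simp
  from this[of es] have "prod_list (map cmod es) \<le> exp (sum_list (map cmod es) - N)" using es(3) by simp
  moreover have "prod_list (map cmod es) = cmod (prod_list es)" by (induction es) (auto simp: norm_mult)
  moreover have "of_real (sum_list (map cmod es)) = sum_list es"
  proof -
    have "map (\<lambda>e. of_real (cmod e)) es = es"
      by (rule map_idI) (use pos in metis)
    moreover have "of_real (sum_list (map cmod es)) = sum_list (map (\<lambda>e. complex_of_real (cmod e)) es)" for es
      by (induction es) auto
    ultimately show ?thesis by metis
  qed
  then have "sum_list (map cmod es) = (\<Sum>i<N. \<Sum>j<N. (cmod (A i j))\<^sup>2)"
    unfolding es(2)[symmetric] tr of_real_eq_iff .
  moreover have "cmod (prod_list es) = (cmod (dtm N A))\<^sup>2"
    unfolding es(1)[symmetric] det norm_of_real by simp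
  ultimately show ?thesis by simp
qed

section \<open>Regularized determinants of finite matrices\<close>

definition d2 :: "nat \<Rightarrow> (nat \<Rightarrow> nat \<Rightarrow> complex) \<Rightarrow> complex" where
  "d2 N A = dtm N (\<lambda>i j. idm i j - A i j) * exp (\<Sum>k<N. A k k)"

definition fro :: "nat \<Rightarrow> (nat \<Rightarrow> nat \<Rightarrow> complex) \<Rightarrow> real" where
  "fro N A = L2_set (\<lambda>(i,j). cmod (A i j)) ({..<N} \<times> {..<N})"

definition vnorm :: "nat \<Rightarrow> (nat \<Rightarrow> complex) \<Rightarrow> real" where
  "vnorm N x = L2_set (\<lambda>i. cmod (x i)) {..<N}"

definition mvec :: "nat \<Rightarrow> (nat \<Rightarrow> nat \<Rightarrow> complex) \<Rightarrow> (nat \<Rightarrow> complex) \<Rightarrow> nat \<Rightarrow> complex" where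
  "mvec N A x i = (\<Sum>k<N. A i k * x k)"

section \<open>Frobenius and Euclidean norms\<close>

lemma fro_nonneg: "fro N A \<ge> 0"
  by (simp add: fro_def)

lemma vnorm_nonneg: "vnorm N x \<ge> 0"
  by (simp add: vnorm_def)

lemma fro_sq: "(fro N A)\<^sup>2 = (\<Sum>i<N. \<Sum>j<N. (cmod (A i j))\<^sup>2)"
  by (simp add: fro_def L2_set_def sum_nonneg sum.cartesian_product case_prod_unfold)

lemma vnorm_sq: "(vnorm N x)\<^sup>2 = (\<Sum>i<N. (cmod (x i))\<^sup>2)"
  by (simp add: vnorm_def L2_set_def sum_nonneg)

lemma fro_triangle: "fro N (\<lambda>i j. A i j + B i j) \<le> fro N A + fro N B"
proof -
  have "fro N (\<lambda>i j. A i j + B i j)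
      \<le> L2_set (\<lambda>p. (case p of (i,j) \<Rightarrow> cmod (A i j)) + (case p of (i,j) \<Rightarrow> cmod (B i j))) ({..<N} \<times> {..<N})"
    unfolding fro_def by (rule L2_set_mono) (auto intro: norm_triangle_ineq)
  also have "\<dots> \<le> fro N A + fro N B"
    unfolding fro_def by (rule L2_set_triangle_ineq)
  finally show ?thesis .
qed

lemma fro_scale: "fro N (\<lambda>i j. c * A i j) = cmod c * fro N A"
proof -
  have "fro N (\<lambda>i j. c * A i j) = L2_set (\<lambda>p. cmod c * (case p of (i,j) \<Rightarrow> cmod (A i j))) ({..<N} \<times> {..<N})"
    unfolding fro_def by (rule L2_set_cong) (auto simp: norm_mult)
  then show ?thesis by (simp add: L2_set_right_distrib fro_def)
qed

lemma fro_le: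
  assumes "\<And>i j. i < N \<Longrightarrow> j < N \<Longrightarrow> cmod (A i j) \<le> cmod (B i j)"
  shows "fro N A \<le> fro N B"
  unfolding fro_def by (rule L2_set_mono) (use assms in auto)

lemma fro_rank_one: "fro N (\<lambda>i j. a i * b j) = vnorm N a * vnorm N b"
proof -
  have "(fro N (\<lambda>i j. a i * b j))\<^sup>2 = (vnorm N a * vnorm N b)\<^sup>2"
    by (simp add: fro_sq power_mult_distrib vnorm_sq norm_mult sum_product)
  then show ?thesis
    by (simp add: fro_nonneg vnorm_nonneg power2_eq_iff_nonneg)
qed

lemma vnorm_triangle: "vnorm N (\<lambda>i. x i + y i) \<le> vnorm N x + vnorm N y"
proof -
  have "vnorm N (\<lambda>i. x i + y i) \<le> L2_set (\<lambda>i. cmod (x i) + cmod (y i)) {..<N}"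
    unfolding vnorm_def by (rule L2_set_mono) (auto intro: norm_triangle_ineq)
  also have "\<dots> \<le> vnorm N x + vnorm N y"
    unfolding vnorm_def by (rule L2_set_triangle_ineq)
  finally show ?thesis .
qed

lemma vnorm_scale: "vnorm N (\<lambda>i. c * x i) = cmod c * vnorm N x"
  unfolding vnorm_def by (simp add: norm_mult L2_set_right_distrib)

lemma vnorm_cong:
  assumes "\<And>i. i < N \<Longrightarrow> x i = y i"
  shows "vnorm N x = vnorm N y"
  unfolding vnorm_def by (rule L2_set_cong) (use assms in auto)

lemma vnorm_cauchy_schwarz: "cmod (\<Sum>i<N. x i * y i) \<le> vnorm N x * vnorm N y"
proof -
  have "cmod (\<Sum>i<N. x i * y i) \<le> (\<Sum>i<N. \<bar>cmod (x i)\<bar> * \<bar>cmod (y i)\<bar>)"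
    by (rule order_trans[OF norm_sum]) (simp add: norm_mult)
  also have "\<dots> \<le> vnorm N x * vnorm N y"
    unfolding vnorm_def by (rule L2_set_mult_ineq)
  finally show ?thesis .
qed

lemma trace_mult_le_fro: "cmod (\<Sum>i<N. \<Sum>j<N. A i j * B j i) \<le> fro N A * fro N B"
proof -
  have "cmod (\<Sum>i<N. \<Sum>j<N. A i j * B j i) = cmod (\<Sum>(i,j)\<in>{..<N} \<times> {..<N}. A i j * B j i)"
    by (simp add: sum.cartesian_product)
  also have "\<dots> \<le> (\<Sum>p\<in>{..<N} \<times> {..<N}. \<bar>case p of (i,j) \<Rightarrow> cmod (A i j)\<bar> * \<bar>case p of (i,j) \<Rightarrow> cmod (B j i)\<bar>)"
    by (rule order_trans[OF norm_sum]) (auto simp: norm_mult case_prod_unfold)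
  also have "\<dots> \<le> fro N A * L2_set (\<lambda>(i,j). cmod (B j i)) ({..<N} \<times> {..<N})"
    unfolding fro_def by (rule L2_set_mult_ineq)
  also have "L2_set (\<lambda>(i,j). cmod (B j i)) ({..<N} \<times> {..<N}) = fro N B"
    unfolding fro_def L2_set_def
    by (rule arg_cong[where f = sqrt],
        rule sum.reindex_bij_witness[where i = "\<lambda>(i,j). (j,i)" and j = "\<lambda>(i,j). (j,i)"]) auto
  finally show ?thesis .
qed

section \<open>Upper bounds, continuity and lower bounds for \<open>d2\<close>\<close>

lemma dtm_scale_columns: "dtm N (\<lambda>i j. A i j * t j) = dtm N A * (\<Prod>j<N. t j)"
proof -
  have "signof p * (\<Prod>i = 0..<N. A i (p i) * t (p i))
      = signof p * (\<Prod>i = 0..<N. A i (p i)) * (\<Prod>j<N. t j)"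
    if "p permutes {0..<N}" for p
    using prod.permute[OF that, of t]
    by (simp add: prod.distrib atLeast0LessThan o_def)
  then show ?thesis
    unfolding dtm_leibniz sum_distrib_right by (intro sum.cong) auto
qed

text \<open>The columns below \<open>m\<close> are normalized before the trace bound is applied; this trades their
  quadratic contribution for a linear one, and yields growth of order two and minimal type.\<close>

lemma d2_column_bound:
  assumes C: "\<And>j. j < N \<Longrightarrow> (\<Sum>i<N. (cmod (A i j))\<^sup>2) \<le> C j"
  shows "(cmod (d2 N A))\<^sup>2 \<le> exp (\<Sum>j<N. if j < m then 4 * sqrt (C j) else C j)"
proof -
  \<comment> \<open>For \<open>j < m\<close> the divisor \<open>1 + sqrt (C j)\<close> dominates the
    Euclidean norm of column \<open>j\<close> of \<open>1 - A\<close>, so the normalized column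
    contributes a nonpositive exponent to the trace bound.\<close>
  define r where "r j = (if j < m then 1 + sqrt (C j) else 1)" for j
  define X where "X i j = idm i j - A i j" for i j
  define col where "col j = (\<Sum>i<N. (cmod (X i j))\<^sup>2)" for j
  have C0: "C j \<ge> 0" if "j < N" for j
    using C[OF that] by (meson order_trans sum_nonneg zero_le_power2)
  have r: "r j > 0" if "j < N" for j
    using C0[OF that] by (auto simp: r_def add_pos_nonneg)
  have colle: "col j \<le> 1 - 2 * Re (A j j) + C j" if "j < N" for j
  proof -
    have eq: "(cmod (X i j))\<^sup>2 = (if i = j then 1 - 2 * Re (A j j) else 0) + (cmod (A i j))\<^sup>2" for i
      by (simp only: cmod_power2) (auto simp: X_def idm_def power2_eq_square algebra_simps)
    have "col j = (1 - 2 * Re (A j j)) + (\<Sum>i<N. (cmod (A i j))\<^sup>2)"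
      unfolding col_def eq by (subst sum.distrib) (use that in simp)
    then show ?thesis using C[OF that] by simp
  qed
  have Ajj: "cmod (A j j) \<le> sqrt (C j)" if "j < N" for j
  proof -
    have "(cmod (A j j))\<^sup>2 \<le> (\<Sum>i<N. (cmod (A i j))\<^sup>2)"
      by (rule member_le_sum[where f = "\<lambda>i. (cmod (A i j))\<^sup>2"]) (use that in auto)
    then have "(cmod (A j j))\<^sup>2 \<le> C j" using C[OF that] by simp
    then show ?thesis by (simp add: real_le_rsqrt)
  qed
  have ReA: "\<bar>Re (A j j)\<bar> \<le> sqrt (C j)" if "j < N" for j
    using Ajj[OF that] abs_Re_le_cmod[of "A j j"] by linarith
  have "(cmod (dtm N (\<lambda>i j. X i j * of_real (1 / r j))))\<^sup>2
      \<le> exp ((\<Sum>i<N. \<Sum>j<N. (cmod (X i j * of_real (1 / r j)))\<^sup>2) - N)"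
    by (rule dtm_norm_bound)
  also have "(\<Sum>i<N. \<Sum>j<N. (cmod (X i j * of_real (1 / r j)))\<^sup>2) = (\<Sum>j<N. col j / (r j)\<^sup>2)"
    by (subst sum.swap) (simp add: norm_mult norm_divide power_mult_distrib power_divide
         col_def sum_divide_distrib)
  also have "(\<Sum>j<N. col j / (r j)\<^sup>2) - N = (\<Sum>j<N. col j / (r j)\<^sup>2 - 1)"
    by (simp add: sum_subtractf)
  also have "(cmod (dtm N (\<lambda>i j. X i j * of_real (1 / r j))))\<^sup>2
      = (cmod (dtm N X))\<^sup>2 * (\<Prod>j<N. (1 / r j)\<^sup>2)"
    by (subst dtm_scale_columns)
       (simp add: norm_mult prod_norm[symmetric] norm_divide power_mult_distrib prod_power_distrib power_divide)
  finally have 1: "(cmod (dtm N X))\<^sup>2 * (\<Prod>j<N. (1 / r j)\<^sup>2) \<le> (\<Prod>j<N. exp (col j / (r j)\<^sup>2 - 1))"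
    by (simp add: exp_sum)
  have "(cmod (dtm N X))\<^sup>2
      = (cmod (dtm N X))\<^sup>2 * (\<Prod>j<N. (1 / r j)\<^sup>2) * (\<Prod>j<N. (r j)\<^sup>2)"
  proof -
    have "(\<Prod>j<N. (1 / r j)\<^sup>2) * (\<Prod>j<N. (r j)\<^sup>2) = 1"
      unfolding prod.distrib[symmetric] by (rule prod.neutral) (use r in \<open>force simp: field_simps\<close>)
    then show ?thesis by (simp only: mult.assoc mult_1_right)
  qed
  also have "\<dots> \<le> (\<Prod>j<N. exp (col j / (r j)\<^sup>2 - 1)) * (\<Prod>j<N. (r j)\<^sup>2)"
    by (intro mult_right_mono 1 prod_nonneg) auto
  finally have 2: "(cmod (dtm N X))\<^sup>2 \<le> (\<Prod>j<N. exp (col j / (r j)\<^sup>2 - 1) * (r j)\<^sup>2)"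
    by (simp add: prod.distrib)
  have "(cmod (d2 N A))\<^sup>2 = (cmod (dtm N X))\<^sup>2 * (\<Prod>j<N. exp (2 * Re (A j j)))"
  proof -
    have "(cmod (exp (\<Sum>k<N. A k k)))\<^sup>2 = exp (2 * Re (\<Sum>k<N. A k k))"
      by (simp only: norm_exp_eq_Re exp_double)
    also have "\<dots> = (\<Prod>j<N. exp (2 * Re (A j j)))"
      by (simp add: sum_distrib_left exp_sum)
    finally show ?thesis
      by (simp add: d2_def X_def[abs_def] norm_mult power_mult_distrib)
  qed
  also have "\<dots> \<le> (\<Prod>j<N. exp (col j / (r j)\<^sup>2 - 1) * (r j)\<^sup>2) * (\<Prod>j<N. exp (2 * Re (A j j)))"
    by (intro mult_right_mono 2 prod_nonneg) auto
  also have "\<dots> = (\<Prod>j<N. exp (col j / (r j)\<^sup>2 - 1) * (r j)\<^sup>2 * exp (2 * Re (A j j)))"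
    by (simp add: prod.distrib)
  also have "\<dots> \<le> (\<Prod>j<N. exp (if j < m then 4 * sqrt (C j) else C j))"
  proof (rule prod_mono, intro conjI)
    fix j assume "j \<in> {..<N}"
    then have j: "j < N" by simp
    show "0 \<le> exp (col j / (r j)\<^sup>2 - 1) * (r j)\<^sup>2 * exp (2 * Re (A j j))" by simp
    show "exp (col j / (r j)\<^sup>2 - 1) * (r j)\<^sup>2 * exp (2 * Re (A j j))
        \<le> exp (if j < m then 4 * sqrt (C j) else C j)"
    proof (cases "j < m")
      \<comment> \<open>Without normalization the factor \<open>exp (2 * Re (A j j))\<close> coming
        from the trace cancels the linear term of \<open>col j\<close> exactly; this is the effect
        of the regularization.\<close>
      case False
      then show ?thesis using colle[OF j] by (simp add: r_def exp_add[symmetric])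
    next
      case True
      \<comment> \<open>The constant 4: the normalized exponential is at most 1, undoing the
        normalization costs \<open>exp (2 * s)\<close>, and the trace factor costs another
        \<open>exp (2 * s)\<close>.\<close>
      define s where "s = sqrt (C j)"
      have s: "s \<ge> 0" "C j = s\<^sup>2" using C0[OF j] by (auto simp: s_def)
      have rj: "r j = 1 + s" using True by (simp add: r_def s_def)
      have "col j \<le> (1 + s)\<^sup>2"
        using colle[OF j] ReA[OF j] s by (simp add: power2_eq_square algebra_simps s_def[symmetric])
      then have "col j / (r j)\<^sup>2 \<le> 1"
        using s by (simp add: rj divide_le_eq_1)
      then have a: "exp (col j / (r j)\<^sup>2 - 1) \<le> 1" by simp
      have b: "(r j)\<^sup>2 \<le> (exp s)\<^sup>2"
        using exp_ge_add_one_self[of s] s by (simp add: rj power_mono)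
      have c: "exp (2 * Re (A j j)) \<le> (exp s)\<^sup>2"
        using ReA[OF j] by (simp add: exp_double[symmetric] s_def[symmetric])
      have "exp (col j / (r j)\<^sup>2 - 1) * (r j)\<^sup>2 * exp (2 * Re (A j j)) \<le> 1 * (exp s)\<^sup>2 * (exp s)\<^sup>2"
        by (intro mult_mono a b c) auto
      also have "\<dots> = exp (4 * s)"
        by (simp add: exp_double[symmetric] exp_add[symmetric])
      finally show ?thesis using True by (simp add: s_def)
    qed
  qed
  finally show ?thesis by (simp add: exp_sum)
qed

lemma d2_bound: "cmod (d2 N A) \<le> exp ((fro N A)\<^sup>2 / 2)"
proof -
  have "(cmod (d2 N A))\<^sup>2 \<le> exp (\<Sum>j<N. if j < 0 then 4 * sqrt (\<Sum>i<N. (cmod (A i j))\<^sup>2)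
      else (\<Sum>i<N. (cmod (A i j))\<^sup>2))"
    by (rule d2_column_bound) simp
  also have "\<dots> = exp ((fro N A)\<^sup>2)"
    unfolding fro_sq by (subst sum.swap) simp
  also have "\<dots> = (exp ((fro N A)\<^sup>2 / 2))\<^sup>2"
    by (simp add: exp_double[symmetric])
  finally show ?thesis by (rule power2_le_imp_le) simp
qed

lemma d2_holomorphic:
  assumes "\<And>i j. i < N \<Longrightarrow> j < N \<Longrightarrow> (\<lambda>z. A z i j) holomorphic_on S"
  shows "(\<lambda>z. d2 N (A z)) holomorphic_on S"
  unfolding d2_def using assms
  by (intro holomorphic_intros dtm_holomorphic) auto

text \<open>The Schwarz lemma turns a bound into a Lipschitz estimate: on the complex line through
  \<open>A\<close> and \<open>B\<close>, parametrized so that \<open>B\<close> sits at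
  \<open>\<delta>\<close>, the norm stays below \<open>a + 1\<close> on the whole unit disc, where
  \<open>d2\<close> is holomorphic and bounded. The parametrization divides by
  \<open>\<delta>\<close>, so \<open>\<delta>\<close> must be positive even when the two matrices
  agree.\<close>

lemma d2_perturbation:
  assumes "fro N A \<le> a" "fro N (\<lambda>i j. B i j - A i j) \<le> \<delta>" "0 < \<delta>" "\<delta> < 1"
  shows "cmod (d2 N B - d2 N A) \<le> 3 * exp ((a + 1)\<^sup>2 / 2) * \<delta>"
proof -
  define E where "E = exp ((a + 1)\<^sup>2 / 2)"
  define F where "F t = d2 N (\<lambda>i j. A i j + (t / of_real \<delta>) * (B i j - A i j))" for t
  have E: "E > 0" by (simp add: E_def)
  have F: "cmod (F t) \<le> E" if "cmod t < 1" for t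
  proof -
    have "fro N (\<lambda>i j. A i j + (t / of_real \<delta>) * (B i j - A i j))
        \<le> fro N A + cmod (t / of_real \<delta>) * fro N (\<lambda>i j. B i j - A i j)"
      by (rule order_trans[OF fro_triangle]) (simp only: fro_scale order_refl)
    also have "\<dots> \<le> a + cmod (t / of_real \<delta>) * \<delta>"
      by (intro add_mono mult_left_mono assms) auto
    also have "\<dots> \<le> a + 1" using assms that by (simp add: norm_divide)
    finally have "(fro N (\<lambda>i j. A i j + (t / of_real \<delta>) * (B i j - A i j)))\<^sup>2 \<le> (a + 1)\<^sup>2"
      by (rule power_mono) (rule fro_nonneg)
    then show ?thesis
      unfolding F_def E_def by (intro order_trans[OF d2_bound]) simp
  qed
  \<comment> \<open>The difference is at most \<open>2 * E\<close>; dividing by \<open>3 * E\<close>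
    gives the strict bound that the Schwarz lemma asks for.\<close>
  define h where "h t = (F t - F 0) / of_real (3 * E)" for t
  have h1: "cmod (h t) < 1" if "cmod t < 1" for t
  proof -
    have "cmod (F t - F 0) \<le> E + E"
      by (rule order_trans[OF norm_triangle_ineq4]) (intro add_mono F that; simp)
    then show ?thesis using E by (simp add: h_def norm_divide norm_mult field_simps)
  qed
  have "h holomorphic_on ball 0 1"
    unfolding h_def F_def
    by (intro holomorphic_intros d2_holomorphic) (use E assms in auto)
  moreover have "h 0 = 0" by (simp add: h_def)
  ultimately have "cmod (h (of_real \<delta>)) \<le> cmod (of_real \<delta>)"
    by (rule Schwarz_Lemma(1)) (use h1 assms in auto)
  then have "cmod (F (of_real \<delta>) - F 0) \<le> 3 * E * \<delta>"
    using E assms by (simp add: h_def norm_divide norm_mult field_simps)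
  then show ?thesis using assms by (simp add: F_def E_def)
qed

text \<open>If \<open>1 - A\<close> has the inverse \<open>1 - L\<close>, then multiplicativity of the determinant bounds
  \<open>d2 N A\<close> from below through the norm of \<open>L\<close>.\<close>

lemma d2_lower_bound:
  assumes a: "fro N A \<le> a" and c: "c > 0"
    and low: "\<And>x. c * vnorm N x \<le> vnorm N (\<lambda>i. x i - mvec N A x i)"
  shows "1 \<le> cmod (d2 N A) * exp (a\<^sup>2 / (2 * c\<^sup>2) + a\<^sup>2 / c)"
proof -
  define X where "X i j = idm i j - A i j" for i j
  have Xx: "(\<Sum>k<N. X i k * x k) = x i - mvec N A x i" if "i < N" for i x
  proof -
    have "(\<Sum>k<N. X i k * x k) = (\<Sum>k<N. if k = i then x k else 0) - mvec N A x i"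
      unfolding mvec_def sum_subtractf[symmetric]
      by (intro sum.cong) (auto simp: X_def idm_def algebra_simps)
    then show ?thesis using that by simp
  qed
  have a0: "a \<ge> 0" using a fro_nonneg[of N A] by linarith
  have ne: "dtm N X \<noteq> 0"
  proof
    assume "dtm N X = 0"
    then obtain x where x: "\<exists>i<N. x i \<noteq> 0" "\<And>i. i < N \<Longrightarrow> (\<Sum>k<N. X i k * x k) = 0"
      using dtm_eq_0_imp_null_vector[of N X] by blast
    have "vnorm N (\<lambda>i. x i - mvec N A x i) = vnorm N (\<lambda>i. 0)"
      by (rule vnorm_cong) (use x(2) Xx in auto)
    then have "c * vnorm N x \<le> 0" using low[of x] by (simp add: vnorm_def L2_set_def)
    then have "vnorm N x = 0" using c vnorm_nonneg[of N x] by (simp add: mult_le_0_iff)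
    then have "(vnorm N x)\<^sup>2 = 0" by simp
    then show False using x(1) unfolding vnorm_sq by (auto simp: sum_nonneg_eq_0_iff)
  qed
  obtain B where B: "\<And>i j. i < N \<Longrightarrow> j < N \<Longrightarrow> (\<Sum>k<N. X i k * B k j) = idm i j"
    "\<And>i j. i < N \<Longrightarrow> j < N \<Longrightarrow> (\<Sum>k<N. B i k * X k j) = idm i j"
    using dtm_inverse[OF ne] by blast
  define L where "L i j = idm i j - B i j" for i j
  have LA: "L i j = - (\<Sum>k<N. B i k * A k j)" if "i < N" "j < N" for i j
  proof -
    have "idm i j = (\<Sum>k<N. (if k = j then B i k else 0) - B i k * A k j)"
      unfolding B(2)[OF that, symmetric] by (intro sum.cong) (auto simp: X_def idm_def algebra_simps)
    then show ?thesis using that by (simp add: L_def sum_subtractf)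
  qed
  have L2: "L i j = (\<Sum>k<N. L i k * A k j) - A i j" if "i < N" "j < N" for i j
  proof -
    have "(\<Sum>k<N. L i k * A k j) = (\<Sum>k<N. (if k = i then A k j else 0) - B i k * A k j)"
      by (intro sum.cong) (auto simp: L_def idm_def algebra_simps)
    also have "\<dots> = A i j + L i j" using that by (simp add: sum_subtractf LA)
    finally show ?thesis by simp
  qed
  \<comment> \<open>Since \<open>L\<close> is minus \<open>B * A\<close>, each of its columns
    solves, up to sign, the equation with matrix \<open>1 - A\<close> and the same column of
    \<open>A\<close> as right-hand side; the lower bound \<open>low\<close> is applied column by
    column.\<close>
  have froL: "fro N L \<le> a / c"
  proof -
    have colL: "c\<^sup>2 * (\<Sum>i<N. (cmod (L i j))\<^sup>2) \<le> (\<Sum>i<N. (cmod (A i j))\<^sup>2)" if j: "j < N" for j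
    proof -
      define y where "y i = (\<Sum>k<N. B i k * A k j)" for i
      have "vnorm N (\<lambda>i. y i - mvec N A y i) = vnorm N (\<lambda>i. A i j)"
      proof (rule vnorm_cong)
        fix i assume i: "i < N"
        have "y i - mvec N A y i = (\<Sum>k<N. X i k * y k)" using Xx[OF i] by simp
        also have "\<dots> = (\<Sum>k<N. \<Sum>l<N. X i k * B k l * A l j)"
          by (simp add: y_def sum_distrib_left mult.assoc)
        also have "\<dots> = (\<Sum>l<N. (\<Sum>k<N. X i k * B k l) * A l j)"
          by (subst sum.swap) (simp add: sum_distrib_right)
        also have "\<dots> = (\<Sum>l<N. if l = i then A l j else 0)"
          by (intro sum.cong) (auto simp: B(1)[OF i] idm_def)
        finally show "y i - mvec N A y i = A i j" using i by simp
      qed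
      then have "c * vnorm N y \<le> vnorm N (\<lambda>i. A i j)" using low[of y] by simp
      moreover have "vnorm N y = vnorm N (\<lambda>i. L i j)"
        unfolding vnorm_def by (rule L2_set_cong) (auto simp: LA[OF _ j] y_def)
      ultimately have "(c * vnorm N (\<lambda>i. L i j))\<^sup>2 \<le> (vnorm N (\<lambda>i. A i j))\<^sup>2"
        using c vnorm_nonneg[of N "\<lambda>i. L i j"] by (intro power_mono) auto
      then show ?thesis by (simp add: power_mult_distrib vnorm_sq)
    qed
    have "(c * fro N L)\<^sup>2 = (\<Sum>j<N. c\<^sup>2 * (\<Sum>i<N. (cmod (L i j))\<^sup>2))"
      unfolding power_mult_distrib fro_sq sum_distrib_left by (rule sum.swap)
    also have "\<dots> \<le> (\<Sum>j<N. \<Sum>i<N. (cmod (A i j))\<^sup>2)"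
      by (intro sum_mono colL) auto
    also have "\<dots> = (fro N A)\<^sup>2" unfolding fro_sq by (rule sum.swap)
    finally have "c * fro N L \<le> fro N A"
      by (rule power2_le_imp_le) (rule fro_nonneg)
    then show ?thesis using a c by (simp add: field_simps)
  qed
  have "dtm N X * dtm N B = dtm N idm"
    unfolding dtm_mult[symmetric] by (rule dtm_cong) (rule B(1))
  moreover have "dtm N B = dtm N (\<lambda>i j. idm i j - L i j)"
    by (simp add: L_def)
  ultimately have "d2 N A * d2 N L = exp ((\<Sum>k<N. A k k) + (\<Sum>k<N. L k k))"
    by (simp add: d2_def X_def[abs_def] dtm_idm exp_add)
  \<comment> \<open>From \<open>(1 - L) (1 - A) = 1\<close> one has \<open>A + L = L A\<close>, so
    the two traces combine into the trace of a product, which Frobenius norms control although the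
    single traces escape them.\<close>
  also have "(\<Sum>k<N. A k k) + (\<Sum>k<N. L k k) = (\<Sum>i<N. \<Sum>k<N. L i k * A k i)"
    unfolding sum.distrib[symmetric] by (rule sum.cong) (use L2 in \<open>simp_all add: algebra_simps\<close>)
  finally have eq: "d2 N A * d2 N L = exp (\<Sum>i<N. \<Sum>k<N. L i k * A k i)" .
  let ?t = "\<Sum>i<N. \<Sum>k<N. L i k * A k i"
  have "cmod ?t \<le> fro N L * fro N A" by (rule trace_mult_le_fro)
  also have "\<dots> \<le> a / c * a" using froL a a0 c by (intro mult_mono) (auto simp: fro_nonneg)
  finally have t: "cmod ?t \<le> a\<^sup>2 / c" by (simp add: power2_eq_square)
  have "1 = exp (Re ?t) * exp (- Re ?t)" by (simp add: exp_minus)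
  also have "exp (Re ?t) = cmod (d2 N A) * cmod (d2 N L)"
    unfolding norm_mult[symmetric] eq by simp
  also have "cmod (d2 N A) * cmod (d2 N L) * exp (- Re ?t)
      \<le> cmod (d2 N A) * exp (a\<^sup>2 / (2 * c\<^sup>2)) * exp (a\<^sup>2 / c)"
  proof (intro mult_mono)
    have "(fro N L)\<^sup>2 \<le> (a / c)\<^sup>2" using froL by (intro power_mono) (auto simp: fro_nonneg)
    then show "cmod (d2 N L) \<le> exp (a\<^sup>2 / (2 * c\<^sup>2))"
      by (intro order_trans[OF d2_bound]) (simp add: power_divide)
    show "exp (- Re ?t) \<le> exp (a\<^sup>2 / c)"
      using t abs_Re_le_cmod[of ?t] by simp
  qed auto
  finally show ?thesis by (simp add: exp_add mult.assoc)
qed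

text \<open>A vanishing limit only makes the finite determinants small, not zero, so an exact kernel
  vector of a truncation cannot be expected. The contrapositive of the lower bound supplies an
  approximate one.\<close>

lemma almost_null_vector:
  assumes "fro N A \<le> a" "c > 0" "cmod (d2 N A) * exp (a\<^sup>2 / (2 * c\<^sup>2) + a\<^sup>2 / c) < 1"
  obtains x where "vnorm N x = 1" "vnorm N (\<lambda>i. x i - mvec N A x i) < c"
proof -
  have "\<not> (\<forall>x. c * vnorm N x \<le> vnorm N (\<lambda>i. x i - mvec N A x i))"
    using d2_lower_bound[of N A a c] assms by force
  then obtain y where y: "vnorm N (\<lambda>i. y i - mvec N A y i) < c * vnorm N y"
    using not_le by blast
  then have "vnorm N y > 0"
    using vnorm_nonneg[of N "\<lambda>i. y i - mvec N A y i"] assms(2) by (smt (verit) zero_less_mult_iff)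
  define s where "s = complex_of_real (1 / vnorm N y)"
  have s: "cmod s = 1 / vnorm N y" using \<open>vnorm N y > 0\<close> by (simp add: s_def norm_divide)
  have "(\<lambda>i. s * y i - mvec N A (\<lambda>i. s * y i) i) = (\<lambda>i. s * (y i - mvec N A y i))"
    by (simp add: mvec_def fun_eq_iff algebra_simps sum_distrib_left)
  then have "vnorm N (\<lambda>i. s * y i - mvec N A (\<lambda>i. s * y i) i) = cmod s * vnorm N (\<lambda>i. y i - mvec N A y i)"
    by (simp add: vnorm_scale)
  also have "\<dots> < c" using y \<open>vnorm N y > 0\<close> by (simp add: s field_simps)
  finally have "vnorm N (\<lambda>i. s * y i - mvec N A (\<lambda>i. s * y i) i) < c" .
  moreover have "vnorm N (\<lambda>i. s * y i) = 1" using \<open>vnorm N y > 0\<close> by (simp add: vnorm_scale s)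
  ultimately show ?thesis using that by blast
qed

section \<open>Regularized determinants of infinite matrices\<close>

definition square_summable :: "(nat \<Rightarrow> real) \<Rightarrow> bool" where
  "square_summable \<alpha> \<longleftrightarrow> (\<forall>i. 0 \<le> \<alpha> i) \<and> summable (\<lambda>i. (\<alpha> i)\<^sup>2)"

text \<open>Domination by a product of two fixed sequences makes truncation errors depend on these
  sequences alone. Limits are then uniform over any family of matrices sharing
  \<open>\<alpha>\<close> and \<open>\<beta>\<close>, in particular over a holomorphic
  parameter.\<close>

definition dominated :: "(nat \<Rightarrow> real) \<Rightarrow> (nat \<Rightarrow> real) \<Rightarrow> (nat \<Rightarrow> nat \<Rightarrow> complex) \<Rightarrow> bool" where
  "dominated \<alpha> \<beta> A \<longleftrightarrow> (\<forall>i j. cmod (A i j) \<le> \<alpha> i * \<beta> j)"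

definition D2 :: "(nat \<Rightarrow> nat \<Rightarrow> complex) \<Rightarrow> complex" where
  "D2 A = lim (\<lambda>N. d2 N A)"

definition dom_const :: "(nat \<Rightarrow> real) \<Rightarrow> (nat \<Rightarrow> real) \<Rightarrow> real" where
  "dom_const \<alpha> \<beta> = sqrt ((\<Sum>i. (\<alpha> i)\<^sup>2) * (\<Sum>j. (\<beta> j)\<^sup>2))"

text \<open>The square root bounds the Hilbert-Schmidt distance between a dominated matrix and its
  truncation of size \<open>N\<close>. The summand \<open>1 / Suc N\<close> keeps the value strictly
  positive, as \<open>d2_perturbation\<close> requires.\<close>

definition dom_gap :: "(nat \<Rightarrow> real) \<Rightarrow> (nat \<Rightarrow> real) \<Rightarrow> nat \<Rightarrow> real" where
  "dom_gap \<alpha> \<beta> N = sqrt ((\<Sum>i. (\<alpha> i)\<^sup>2) * (\<Sum>j. (\<beta> j)\<^sup>2) - (\<Sum>i<N. (\<alpha> i)\<^sup>2) * (\<Sum>j<N. (\<beta> j)\<^sup>2))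
     + 1 / Suc N"

definition trunc :: "nat \<Rightarrow> (nat \<Rightarrow> nat \<Rightarrow> complex) \<Rightarrow> nat \<Rightarrow> nat \<Rightarrow> complex" where
  "trunc N A i j = (if i < N \<and> j < N then A i j else 0)"

lemma square_summable_scale:
  assumes "square_summable \<alpha>" "c \<ge> 0"
  shows "square_summable (\<lambda>i. c * \<alpha> i)"
  using assms by (auto simp: square_summable_def power_mult_distrib summable_mult)

lemma square_summable_mono:
  assumes "square_summable \<beta>" "\<And>i. 0 \<le> \<alpha> i" "\<And>i. \<alpha> i \<le> \<beta> i"
  shows "square_summable \<alpha>"
proof -
  have "summable (\<lambda>i. (\<alpha> i)\<^sup>2)"
    by (rule summable_comparison_test'[where g = "\<lambda>i. (\<beta> i)\<^sup>2"])
       (use assms in \<open>auto simp: square_summable_def power_mono\<close>)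
  then show ?thesis using assms by (auto simp: square_summable_def)
qed

lemma square_summable_product:
  assumes "square_summable \<alpha>" "square_summable \<beta>"
  shows "summable (\<lambda>i. \<alpha> i * \<beta> i)"
proof (rule summable_comparison_test'[where g = "\<lambda>i. (\<alpha> i)\<^sup>2 + (\<beta> i)\<^sup>2"])
  show "summable (\<lambda>i. (\<alpha> i)\<^sup>2 + (\<beta> i)\<^sup>2)"
    using assms by (intro summable_add) (auto simp: square_summable_def)
  fix i
  have "0 \<le> \<alpha> i * \<beta> i" using assms by (simp add: square_summable_def)
  then show "norm (\<alpha> i * \<beta> i) \<le> (\<alpha> i)\<^sup>2 + (\<beta> i)\<^sup>2"
    using sum_squares_bound[of "\<alpha> i" "\<beta> i"] by simp
qed

lemma square_summable_partial:
  "square_summable \<alpha> \<Longrightarrow> (\<Sum>i<N. (\<alpha> i)\<^sup>2) \<le> (\<Sum>i. (\<alpha> i)\<^sup>2)"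
  unfolding square_summable_def by (intro sum_le_suminf) auto

lemma dominated_scale:
  assumes "dominated \<alpha> \<beta> A" "cmod w \<le> R"
  shows "dominated (\<lambda>i. R * \<alpha> i) \<beta> (\<lambda>i j. w * A i j)"
  unfolding dominated_def
proof (intro allI)
  fix i j
  have "R \<ge> 0" using assms(2) norm_ge_zero order_trans by blast
  then have "cmod w * cmod (A i j) \<le> R * (\<alpha> i * \<beta> j)"
    using assms by (intro mult_mono) (auto simp: dominated_def)
  then show "cmod (w * A i j) \<le> R * \<alpha> i * \<beta> j" by (simp add: norm_mult)
qed

lemma d2_trunc:
  assumes "N \<le> L"
  shows "d2 L (trunc N A) = d2 N A"
proof -
  have "dtm L (\<lambda>i j. idm i j - trunc N A i j) = dtm N (\<lambda>i j. idm i j - trunc N A i j)"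
    by (rule dtm_extend) (use assms in \<open>auto simp: trunc_def\<close>)
  also have "\<dots> = dtm N (\<lambda>i j. idm i j - A i j)"
    by (rule dtm_cong) (auto simp: trunc_def)
  finally have "dtm L (\<lambda>i j. idm i j - trunc N A i j) = dtm N (\<lambda>i j. idm i j - A i j)" .
  moreover have "(\<Sum>k<L. trunc N A k k) = (\<Sum>k<N. A k k)"
    using assms by (intro sum.mono_neutral_cong_right) (auto simp: trunc_def)
  ultimately show ?thesis by (simp add: d2_def)
qed

context
  fixes \<alpha> \<beta> :: "nat \<Rightarrow> real"
  assumes \<alpha>: "square_summable \<alpha>" and \<beta>: "square_summable \<beta>"
begin

lemma dominated_fro_sq:
  assumes "dominated \<alpha> \<beta> A"
  shows "(fro N A)\<^sup>2 \<le> (\<Sum>i<N. (\<alpha> i)\<^sup>2) * (\<Sum>j<N. (\<beta> j)\<^sup>2)"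
proof -
  have "(cmod (A i j))\<^sup>2 \<le> (\<alpha> i)\<^sup>2 * (\<beta> j)\<^sup>2" for i j
    using assms by (auto simp: dominated_def power_mult_distrib[symmetric] intro!: power_mono)
  then show ?thesis
    unfolding fro_sq sum_product by (intro sum_mono)
qed

lemma dominated_fro:
  assumes "dominated \<alpha> \<beta> A"
  shows "fro N A \<le> dom_const \<alpha> \<beta>"
  unfolding dom_const_def
  by (rule real_le_rsqrt, rule order_trans[OF dominated_fro_sq[OF assms]],
      intro mult_mono square_summable_partial \<alpha> \<beta> sum_nonneg suminf_nonneg)
     (use \<alpha> in \<open>auto simp: square_summable_def\<close>)

lemma dom_gap_pos: "dom_gap \<alpha> \<beta> N > 0"
proof -
  have "(\<Sum>i<N. (\<alpha> i)\<^sup>2) * (\<Sum>j<N. (\<beta> j)\<^sup>2) \<le> (\<Sum>i. (\<alpha> i)\<^sup>2) * (\<Sum>j. (\<beta> j)\<^sup>2)"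
    by (intro mult_mono square_summable_partial \<alpha> \<beta> sum_nonneg suminf_nonneg)
       (use \<alpha> in \<open>auto simp: square_summable_def\<close>)
  then show ?thesis unfolding dom_gap_def by (simp add: add_nonneg_pos)
qed

lemma dom_gap_tendsto: "dom_gap \<alpha> \<beta> \<longlonglongrightarrow> 0"
proof -
  have "(\<lambda>N. \<Sum>i<N. (\<alpha> i)\<^sup>2) \<longlonglongrightarrow> (\<Sum>i. (\<alpha> i)\<^sup>2)" "(\<lambda>N. \<Sum>i<N. (\<beta> i)\<^sup>2) \<longlonglongrightarrow> (\<Sum>i. (\<beta> i)\<^sup>2)"
    using \<alpha> \<beta> by (auto simp: square_summable_def intro: summable_LIMSEQ)
  then have "(\<lambda>N. sqrt ((\<Sum>i. (\<alpha> i)\<^sup>2) * (\<Sum>j. (\<beta> j)\<^sup>2) - (\<Sum>i<N. (\<alpha> i)\<^sup>2) * (\<Sum>j<N. (\<beta> j)\<^sup>2)) + 1 / Suc N)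
      \<longlonglongrightarrow> sqrt ((\<Sum>i. (\<alpha> i)\<^sup>2) * (\<Sum>j. (\<beta> j)\<^sup>2) - (\<Sum>i. (\<alpha> i)\<^sup>2) * (\<Sum>j. (\<beta> j)\<^sup>2)) + 0"
    by (intro tendsto_intros LIMSEQ_Suc lim_1_over_n)
  then show ?thesis by (simp add: dom_gap_def[abs_def])
qed

lemma fro_trunc:
  assumes A: "dominated \<alpha> \<beta> A" and "N \<le> L"
  shows "fro L (\<lambda>i j. A i j - trunc N A i j) \<le> dom_gap \<alpha> \<beta> N"
proof -
  let ?S = "{..<L} \<times> {..<L}" and ?T = "{..<N} \<times> {..<N}"
  let ?f = "\<lambda>(i,j). (\<alpha> i)\<^sup>2 * (\<beta> j)\<^sup>2"
  have TS: "?T \<subseteq> ?S" using \<open>N \<le> L\<close> by auto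
  have "(fro L (\<lambda>i j. A i j - trunc N A i j))\<^sup>2
      = (\<Sum>(i,j)\<in>?S. (cmod (A i j - trunc N A i j))\<^sup>2)"
    by (simp add: fro_sq sum.cartesian_product)
  also have "\<dots> = (\<Sum>(i,j)\<in>?S - ?T. (cmod (A i j))\<^sup>2)"
    by (rule sum.mono_neutral_cong_right) (auto simp: trunc_def split: if_splits)
  also have "\<dots> \<le> (\<Sum>p\<in>?S - ?T. ?f p)"
    using A by (intro sum_mono) (auto simp: dominated_def power_mult_distrib[symmetric] intro!: power_mono)
  also have "\<dots> = (\<Sum>p\<in>?S. ?f p) - (\<Sum>p\<in>?T. ?f p)"
    by (rule sum_diff) (use TS in auto)
  also have "\<dots> = (\<Sum>i<L. (\<alpha> i)\<^sup>2) * (\<Sum>j<L. (\<beta> j)\<^sup>2) - (\<Sum>i<N. (\<alpha> i)\<^sup>2) * (\<Sum>j<N. (\<beta> j)\<^sup>2)"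
    by (simp add: sum_product sum.cartesian_product)
  also have "\<dots> \<le> (\<Sum>i. (\<alpha> i)\<^sup>2) * (\<Sum>j. (\<beta> j)\<^sup>2) - (\<Sum>i<N. (\<alpha> i)\<^sup>2) * (\<Sum>j<N. (\<beta> j)\<^sup>2)"
    by (intro diff_right_mono mult_mono square_summable_partial \<alpha> \<beta> sum_nonneg suminf_nonneg)
       (use \<alpha> in \<open>auto simp: square_summable_def\<close>)
  finally have "fro L (\<lambda>i j. A i j - trunc N A i j)
     \<le> sqrt ((\<Sum>i. (\<alpha> i)\<^sup>2) * (\<Sum>j. (\<beta> j)\<^sup>2) - (\<Sum>i<N. (\<alpha> i)\<^sup>2) * (\<Sum>j<N. (\<beta> j)\<^sup>2))"
    by (rule real_le_rsqrt)
  then show ?thesis unfolding dom_gap_def by (rule order_trans) simp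
qed

lemma d2_cauchy_bound:
  assumes A: "dominated \<alpha> \<beta> A" and "N \<le> L" "dom_gap \<alpha> \<beta> N < 1"
  shows "cmod (d2 L A - d2 N A) \<le> 3 * exp ((dom_const \<alpha> \<beta> + 1)\<^sup>2 / 2) * dom_gap \<alpha> \<beta> N"
proof -
  have "fro L (trunc N A) \<le> fro L A" by (rule fro_le) (auto simp: trunc_def)
  also have "\<dots> \<le> dom_const \<alpha> \<beta>" by (rule dominated_fro[OF A])
  finally show ?thesis
    using d2_perturbation[of L "trunc N A" "dom_const \<alpha> \<beta>" A "dom_gap \<alpha> \<beta> N"]
      fro_trunc[OF A \<open>N \<le> L\<close>] dom_gap_pos assms by (simp add: d2_trunc)
qed

lemma dom_gap_small:
  assumes "e > 0"
  obtains M where "\<And>N. N \<ge> M \<Longrightarrow> dom_gap \<alpha> \<beta> N < 1"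
    "\<And>N. N \<ge> M \<Longrightarrow> 3 * exp ((dom_const \<alpha> \<beta> + 1)\<^sup>2 / 2) * dom_gap \<alpha> \<beta> N < e"
proof -
  have "(\<lambda>N. 3 * exp ((dom_const \<alpha> \<beta> + 1)\<^sup>2 / 2) * dom_gap \<alpha> \<beta> N) \<longlonglongrightarrow> 0"
    using dom_gap_tendsto by (rule tendsto_mult_right_zero)
  then have "\<forall>\<^sub>F N in sequentially. 3 * exp ((dom_const \<alpha> \<beta> + 1)\<^sup>2 / 2) * dom_gap \<alpha> \<beta> N < e"
    using assms by (rule order_tendstoD)
  moreover have "\<forall>\<^sub>F N in sequentially. dom_gap \<alpha> \<beta> N < 1"
    using dom_gap_tendsto by (rule order_tendstoD) simp
  ultimately have "\<forall>\<^sub>F N in sequentially. dom_gap \<alpha> \<beta> N < 1 \<and>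
      3 * exp ((dom_const \<alpha> \<beta> + 1)\<^sup>2 / 2) * dom_gap \<alpha> \<beta> N < e"
    by eventually_elim simp
  then show ?thesis using that unfolding eventually_sequentially by blast
qed

lemma D2_tendsto:
  assumes A: "dominated \<alpha> \<beta> A"
  shows "(\<lambda>N. d2 N A) \<longlonglongrightarrow> D2 A"
proof -
  have "Cauchy (\<lambda>N. d2 N A)"
  proof (rule CauchyI')
    fix e :: real assume "e > 0"
    then obtain M where M: "\<And>N. N \<ge> M \<Longrightarrow> dom_gap \<alpha> \<beta> N < 1"
      "\<And>N. N \<ge> M \<Longrightarrow> 3 * exp ((dom_const \<alpha> \<beta> + 1)\<^sup>2 / 2) * dom_gap \<alpha> \<beta> N < e"
      using dom_gap_small by blast
    show "\<exists>M. \<forall>m\<ge>M. \<forall>n>m. dist (d2 m A) (d2 n A) < e"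
    proof (intro exI allI impI)
      fix m n assume "M \<le> m" "m < n"
      then show "dist (d2 m A) (d2 n A) < e"
        using d2_cauchy_bound[OF A, of m n] M[of m] by (simp add: dist_norm norm_minus_commute)
    qed
  qed
  then show ?thesis unfolding D2_def by (simp add: Cauchy_convergent_iff convergent_LIMSEQ_iff)
qed

lemma D2_dist:
  assumes A: "dominated \<alpha> \<beta> A" and "dom_gap \<alpha> \<beta> N < 1"
  shows "cmod (D2 A - d2 N A) \<le> 3 * exp ((dom_const \<alpha> \<beta> + 1)\<^sup>2 / 2) * dom_gap \<alpha> \<beta> N"
proof (rule LIMSEQ_le_const2)
  show "(\<lambda>L. cmod (d2 L A - d2 N A)) \<longlonglongrightarrow> cmod (D2 A - d2 N A)"
    by (intro tendsto_intros D2_tendsto[OF A])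
  show "\<exists>M. \<forall>L\<ge>M. cmod (d2 L A - d2 N A) \<le> 3 * exp ((dom_const \<alpha> \<beta> + 1)\<^sup>2 / 2) * dom_gap \<alpha> \<beta> N"
    using d2_cauchy_bound[OF A _ assms(2)] by blast
qed

lemma D2_holomorphic:
  assumes "open S" "\<And>z. z \<in> S \<Longrightarrow> dominated \<alpha> \<beta> (A z)"
    and hol: "\<And>i j. (\<lambda>z. A z i j) holomorphic_on S"
  shows "(\<lambda>z. D2 (A z)) holomorphic_on S"
proof (rule holomorphic_uniform_sequence[OF \<open>open S\<close>])
  show "(\<lambda>z. d2 N (A z)) holomorphic_on S" for N
    by (intro d2_holomorphic hol)
  fix x assume "x \<in> S"
  then obtain d where d: "d > 0" "cball x d \<subseteq> S" using \<open>open S\<close> open_contains_cball by blast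
  have "uniform_limit (cball x d) (\<lambda>N z. d2 N (A z)) (\<lambda>z. D2 (A z)) sequentially"
  proof (rule uniform_limitI)
    fix e :: real assume "e > 0"
    then obtain M where M: "\<And>N. N \<ge> M \<Longrightarrow> dom_gap \<alpha> \<beta> N < 1"
      "\<And>N. N \<ge> M \<Longrightarrow> 3 * exp ((dom_const \<alpha> \<beta> + 1)\<^sup>2 / 2) * dom_gap \<alpha> \<beta> N < e"
      using dom_gap_small by blast
    show "\<forall>\<^sub>F N in sequentially. \<forall>z\<in>cball x d. dist (d2 N (A z)) (D2 (A z)) < e"
      unfolding eventually_sequentially
    proof (intro exI allI impI ballI)
      fix N z assume "M \<le> N" "z \<in> cball x d"
      then show "dist (d2 N (A z)) (D2 (A z)) < e"
        using D2_dist[OF assms(2), of z N] M[of N] d(2)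
        by (auto simp: dist_norm norm_minus_commute)
    qed
  qed
  with d show "\<exists>d. 0 < d \<and> cball x d \<subseteq> S \<and>
      uniform_limit (cball x d) (\<lambda>N z. d2 N (A z)) (\<lambda>z. D2 (A z)) sequentially" by blast
qed

text \<open>Needed because identities between infinite matrices survive truncation only up to an
  error that vanishes in the Frobenius norm. The added \<open>1 / Suc N\<close> again keeps the
  perturbation parameter positive.\<close>

lemma D2_tendsto_perturbed:
  assumes A: "dominated \<alpha> \<beta> A" and B: "(\<lambda>N. fro N (\<lambda>i j. B N i j - A i j)) \<longlonglongrightarrow> 0"
  shows "(\<lambda>N. d2 N (B N)) \<longlonglongrightarrow> D2 A"
proof -
  let ?\<delta> = "\<lambda>N. fro N (\<lambda>i j. B N i j - A i j) + 1 / Suc N"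
  have \<delta>0: "?\<delta> \<longlonglongrightarrow> 0 + 0"
    by (intro tendsto_add B LIMSEQ_Suc lim_1_over_n)
  then have "\<forall>\<^sub>F N in sequentially. ?\<delta> N < 1"
    by (rule order_tendstoD) simp
  then have "\<forall>\<^sub>F N in sequentially. norm (d2 N (B N) - d2 N A) \<le> 3 * exp ((dom_const \<alpha> \<beta> + 1)\<^sup>2 / 2) * ?\<delta> N"
  proof eventually_elim
    case (elim N)
    then show ?case
      by (intro d2_perturbation dominated_fro[OF A]) (auto simp: fro_nonneg add_nonneg_pos)
  qed
  moreover have "(\<lambda>N. 3 * exp ((dom_const \<alpha> \<beta> + 1)\<^sup>2 / 2) * ?\<delta> N) \<longlonglongrightarrow> 0"
    using \<delta>0 by (intro tendsto_mult_right_zero) simp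
  ultimately have "(\<lambda>N. d2 N (B N) - d2 N A) \<longlonglongrightarrow> 0"
    by (rule Lim_null_comparison)
  from tendsto_add[OF this D2_tendsto[OF A]] show ?thesis by simp
qed

end

section \<open>The determinant as an entire function of a scalar\<close>

lemma D2_scaled_holomorphic:
  assumes "square_summable \<alpha>" "square_summable \<beta>" "dominated \<alpha> \<beta> A"
  shows "(\<lambda>w. D2 (\<lambda>i j. w * A i j)) holomorphic_on ball 0 R"
proof (cases "R \<ge> 0")
  case True
  show ?thesis
  proof (rule D2_holomorphic[of "\<lambda>i. R * \<alpha> i" \<beta>])
    show "dominated (\<lambda>i. R * \<alpha> i) \<beta> (\<lambda>i j. w * A i j)" if "w \<in> ball 0 R" for w
      using assms that by (intro dominated_scale) (auto simp: square_summable_def)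
  qed (use True assms in \<open>auto intro: square_summable_scale intro!: holomorphic_intros\<close>)
next
  case False
  then show ?thesis by (simp add: ball_empty holomorphic_on_def del: ball_eq_empty)
qed

text \<open>The free cut \<open>m\<close> is the point: a large \<open>m\<close> makes the
  coefficient of the quadratic term as small as desired, at the price of a larger linear term. The
  matrix enters the bound only through \<open>C\<close>, so one choice of \<open>m\<close> serves a
  whole family with the same column bounds.\<close>

lemma D2_growth:
  assumes \<alpha>: "square_summable \<alpha>" and \<beta>: "square_summable \<beta>" and A: "dominated \<alpha> \<beta> A"
    and C: "\<And>N j. (\<Sum>i<N. (cmod (A i j))\<^sup>2) \<le> C j" "summable C"
  shows "cmod (D2 (\<lambda>i j. w * A i j)) \<le> exp (2 * (\<Sum>j<m. sqrt (C j)) * cmod w + (\<Sum>j. C (j + m)) / 2 * (cmod w)\<^sup>2)"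
proof -
  let ?r = "cmod w"
  let ?G = "4 * (\<Sum>j<m. sqrt (C j)) * ?r + (\<Sum>j. C (j + m)) * ?r\<^sup>2"
  have C0: "C j \<ge> 0" for j using C(1)[where N = 0] by simp
  have bound: "(cmod (d2 N (\<lambda>i j. w * A i j)))\<^sup>2 \<le> exp ?G" if "N \<ge> m" for N
  proof -
    have "(cmod (d2 N (\<lambda>i j. w * A i j)))\<^sup>2
        \<le> exp (\<Sum>j<N. if j < m then 4 * sqrt (?r\<^sup>2 * C j) else ?r\<^sup>2 * C j)"
      by (rule d2_column_bound)
         (simp add: norm_mult power_mult_distrib sum_distrib_left[symmetric] mult_left_mono C)
    also have "(\<Sum>j<N. if j < m then 4 * sqrt (?r\<^sup>2 * C j) else ?r\<^sup>2 * C j)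
        = (\<Sum>j<m. 4 * sqrt (?r\<^sup>2 * C j)) + (\<Sum>j=m..<N. ?r\<^sup>2 * C j)"
    proof -
      have "{..<N} = {..<m} \<union> {m..<N}" using that by auto
      moreover have "{..<m} \<inter> {m..<N} = {}" by auto
      ultimately show ?thesis by (simp add: sum.union_disjoint)
    qed
    also have "(\<Sum>j<m. 4 * sqrt (?r\<^sup>2 * C j)) = 4 * (\<Sum>j<m. sqrt (C j)) * ?r"
      by (simp add: real_sqrt_mult sum_distrib_left sum_distrib_right mult_ac)
    also have "(\<Sum>j=m..<N. ?r\<^sup>2 * C j) = ?r\<^sup>2 * (\<Sum>j<N - m. C (j + m))"
    proof -
      have "(\<Sum>j=m..<N. C j) = (\<Sum>j=0+m..<(N-m)+m. C j)" using that by simp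
      also have "\<dots> = (\<Sum>j<N - m. C (j + m))"
        by (subst sum.shift_bounds_nat_ivl) (simp add: atLeast0LessThan)
      finally show ?thesis by (simp only: sum_distrib_left[symmetric])
    qed
    also have "\<dots> \<le> ?r\<^sup>2 * (\<Sum>j. C (j + m))"
      by (intro mult_left_mono sum_le_suminf) (use C C0 in \<open>auto simp: summable_iff_shift\<close>)
    finally show ?thesis by (simp add: mult.commute)
  qed
  have dom: "dominated (\<lambda>i. ?r * \<alpha> i) \<beta> (\<lambda>i j. w * A i j)"
    using \<alpha> \<beta> A by (intro dominated_scale) (auto simp: square_summable_def)
  have "(\<lambda>N. (cmod (d2 N (\<lambda>i j. w * A i j)))\<^sup>2) \<longlonglongrightarrow> (cmod (D2 (\<lambda>i j. w * A i j)))\<^sup>2"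
    by (intro tendsto_intros D2_tendsto[OF square_summable_scale[OF \<alpha>] \<beta> dom]) simp
  then have "(cmod (D2 (\<lambda>i j. w * A i j)))\<^sup>2 \<le> exp ?G"
    by (rule LIMSEQ_le_const2) (use bound in blast)
  also have "exp ?G = (exp (2 * (\<Sum>j<m. sqrt (C j)) * ?r + (\<Sum>j. C (j + m)) / 2 * ?r\<^sup>2))\<^sup>2"
    by (simp add: exp_double[symmetric] algebra_simps)
  finally show ?thesis by (rule power2_le_imp_le) simp
qed

text \<open>For a logarithm \<open>g\<close> of \<open>f\<close>, the map \<open>g / (2 H - g)\<close> sends the disc of radius \<open>R\<close> into the unit
  disc. Since \<open>Re g\<close> is bounded by a multiple of the squared modulus, \<open>g\<close> has a double zero at the
  origin, so that the Schwarz lemma applies twice.\<close>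

lemma zero_free_near_1:
  assumes hol: "f holomorphic_on ball 0 R" and R: "R > 1"
    and nz: "\<And>w. cmod w < R \<Longrightarrow> f w \<noteq> 0" and f0: "f 0 = 1"
    and H: "\<And>w. cmod w < R \<Longrightarrow> cmod (f w) < exp H"
    and s: "\<And>w. cmod w < R \<Longrightarrow> cmod (f w) \<le> exp (s * (cmod w)\<^sup>2)"
  obtains c where "f 1 = exp c" "cmod c \<le> 2 * H / (R\<^sup>2 - 1)"
proof -
  obtain g0 where g0: "g0 holomorphic_on ball 0 R" "\<And>w. w \<in> ball 0 R \<Longrightarrow> exp (g0 w) = f w"
    using holomorphic_logarithm_exists[of "ball 0 R" f 0] hol nz R by (auto simp: dist_norm)
  define g where "g w = g0 w - g0 0" for w
  have eg: "exp (g w) = f w" if "cmod w < R" for w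
    using g0(2)[of w] g0(2)[of 0] f0 that R by (simp add: g_def exp_diff)
  have holg: "g holomorphic_on ball 0 R"
    unfolding g_def by (intro holomorphic_intros g0)
  have gg: "g 0 = 0" by (simp add: g_def)
  have ReH: "Re (g w) < H" if "cmod w < R" for w
    using H[OF that] by (simp add: eg[OF that, symmetric])
  have Res: "Re (g w) \<le> s * (cmod w)\<^sup>2" if "cmod w < R" for w
    using s[OF that] by (simp add: eg[OF that, symmetric])
  have H0: "H > 0" using ReH[of 0] R gg by simp
  \<comment> \<open>A nonzero derivative \<open>p\<close> would make the real part of
    \<open>g\<close> grow linearly in the direction \<open>u\<close> with \<open>p * u\<close>
    positive, against the quadratic bound.\<close>
  have d0: "deriv g 0 = 0"
  proof (rule ccontr)
    define p where "p = deriv g 0"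
    assume "deriv g 0 \<noteq> 0"
    then have p: "cmod p > 0" by (simp add: p_def)
    define u where "u = cnj p / of_real (cmod p)"
    have u: "cmod u = 1" "p * u = of_real (cmod p)"
      using p by (auto simp: u_def norm_divide complex_norm_square[symmetric] power2_eq_square)
    have "(g has_field_derivative p) (at 0)"
      unfolding p_def by (rule holomorphic_derivI[OF holg]) (use R in auto)
    then have lim: "((\<lambda>h. g h / h) \<longlongrightarrow> p) (at 0)"
      using gg by (simp add: has_field_derivative_iff)
    define h where "h n = of_real (1 / Suc n) * u" for n
    have "(\<lambda>n. complex_of_real (1 / Suc n)) \<longlonglongrightarrow> of_real 0"
      by (intro tendsto_of_real LIMSEQ_Suc lim_1_over_n)
    then have "h \<longlonglongrightarrow> of_real 0 * u" unfolding h_def by (intro tendsto_mult tendsto_const)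
    moreover have "h n \<noteq> 0" for n using u by (auto simp: h_def simp del: of_nat_Suc)
    ultimately have "(\<lambda>n. g (h n) / h n) \<longlonglongrightarrow> p"
      by (intro filterlim_compose[OF lim]) (auto simp: filterlim_at)
    then have "(\<lambda>n. Re (g (h n) / h n * u)) \<longlonglongrightarrow> Re (p * u)" by (intro tendsto_intros)
    moreover have "(\<lambda>n. s * (1 / Suc n)) \<longlonglongrightarrow> s * 0" by (intro tendsto_intros LIMSEQ_Suc lim_1_over_n)
    moreover have "Re (g (h n) / h n * u) \<le> s * (1 / Suc n)" for n
    proof -
      have "cmod (h n) = 1 / Suc n" using u by (simp add: h_def norm_mult norm_divide del: of_nat_Suc)
      moreover have "1 / Suc n \<le> (1 :: real)" by simp
      ultimately have "Re (g (h n)) \<le> s * (1 / Suc n)\<^sup>2" 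
        using Res[of "h n"] R le_less_trans[of "1 / Suc n" 1 R] by simp
      moreover have "g (h n) / h n * u = of_real (Suc n) * g (h n)"
        using u by (auto simp: h_def field_simps simp del: of_nat_Suc)
      ultimately show ?thesis by (simp add: power2_eq_square field_simps del: of_nat_Suc)
    qed
    ultimately have "Re (p * u) \<le> s * 0" by (intro LIMSEQ_le[of _ _ "\<lambda>n. s * (1 / Suc n)"]) auto
    then show False using p u by simp
  qed
  define h where "h w = g (of_real R * w) / (2 * of_real H - g (of_real R * w))" for w
  have den: "2 * of_real H - g w \<noteq> 0" if "cmod w < R" for w
  proof
    assume "2 * of_real H - g w = 0"
    then have "Re (2 * of_real H - g w) = 0" by simp
    then show False using ReH[OF that] H0 by simp
  qed
  have Rw: "cmod (of_real R * w) < R" if "cmod w < 1" for w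
    using that R by (simp add: norm_mult)
  have holgR: "(\<lambda>w. g (of_real R * w)) holomorphic_on ball 0 1"
  proof -
    have "(g \<circ> (\<lambda>w. of_real R * w)) holomorphic_on ball 0 1"
      by (rule holomorphic_on_compose_gen[OF _ holg]) (use Rw in \<open>auto intro!: holomorphic_intros\<close>)
    then show ?thesis by (simp add: o_def)
  qed
  have holh: "h holomorphic_on ball 0 1"
    unfolding h_def by (intro holomorphic_intros holgR) (use den Rw in auto)
  have h0: "h 0 = 0" by (simp add: h_def gg)
  have hlt: "cmod (h w) < 1" if "cmod w < 1" for w
  proof -
    define z where "z = g (of_real R * w)"
    have "Re z < H" using ReH[OF Rw[OF that]] by (simp add: z_def)
    then have "H * Re z < H * H" using H0 by simp
    then have "(cmod z)\<^sup>2 < (cmod (2 * of_real H - z))\<^sup>2"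
      by (simp only: cmod_power2) (simp add: power2_eq_square algebra_simps)
    then have "cmod z < cmod (2 * of_real H - z)" by (rule power2_less_imp_less) simp
    then show ?thesis
      by (simp add: h_def z_def[symmetric] norm_divide divide_less_eq_1)
  qed
  have dh: "deriv h 0 = 0"
  proof -
    have "(g has_field_derivative 0) (at (of_real R * 0))"
      using holomorphic_derivI[OF holg, of 0] d0 R by simp
    then have "((\<lambda>w. g (of_real R * w)) has_field_derivative 0 * of_real R) (at 0)"
      by (rule DERIV_chain2) (auto intro!: derivative_eq_intros)
    then have "(h has_field_derivative 0) (at 0)"
      unfolding h_def using H0 by (auto intro!: derivative_eq_intros simp: gg)
    then show ?thesis by (rule DERIV_imp_deriv)
  qed
  obtain k where k: "k holomorphic_on ball 0 1" "\<And>w. cmod w < 1 \<Longrightarrow> h w = w * k w" "k 0 = 0"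
    using Schwarz3[OF holh h0] dh by metis
  \<comment> \<open>The Schwarz lemma for \<open>h\<close> gives only a weak inequality for
    \<open>k\<close>. Equality at a point other than 0 would force \<open>h\<close> to be a
    rotation, whose derivative at 0 does not vanish.\<close>
  have k1: "cmod (k w) < 1" if "cmod w < 1" for w
  proof (cases "w = 0")
    case False
    note sch = Schwarz_Lemma[OF holh h0 hlt that]
    have "cmod (h w) \<noteq> cmod w"
    proof
      assume "cmod (h w) = cmod w"
      then have "\<exists>z. cmod z < 1 \<and> z \<noteq> 0 \<and> cmod (h z) = cmod z" using that False by metis
      from sch(3)[OF _ disjI1[OF this]]
      obtain a where a: "\<And>z. cmod z < 1 \<Longrightarrow> h z = a * z" "cmod a = 1" by metis
      have "((\<lambda>z. a * z) has_field_derivative a) (at 0)"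
        by (auto intro!: derivative_eq_intros)
      then have "(h has_field_derivative a) (at 0)"
        by (rule has_field_derivative_transform_within_open[of _ _ _ "ball 0 1"]) (use a in auto)
      then have "deriv h 0 = a" by (rule DERIV_imp_deriv)
      then show False using dh a(2) by auto
    qed
    with sch(1) have "cmod w * cmod (k w) < cmod w" using k(2)[OF that] by (simp add: norm_mult)
    then show ?thesis using False by simp
  qed (simp add: k)
  have hw: "cmod (h w) \<le> (cmod w)\<^sup>2" if "cmod w < 1" for w
    using Schwarz_Lemma(1)[OF k(1) k(3) k1 that] k(2)[OF that]
    by (simp add: norm_mult power2_eq_square mult_left_mono)
  define c where "c = g 1"
  \<comment> \<open>The value of \<open>g\<close> at 1 is that of the rescaled function at
    \<open>1 / R\<close>. The quadratic bound there can be solved for the modulus of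
    \<open>c\<close>, which produces the denominator \<open>R^2 - 1\<close>.\<close>
  have "cmod (h (1 / of_real R)) \<le> (1 / R)\<^sup>2"
    using hw[of "1 / of_real R"] R by (simp add: norm_divide)
  then have "cmod c / cmod (2 * of_real H - c) \<le> (1 / R)\<^sup>2"
    using R by (simp add: h_def c_def norm_divide)
  moreover have "cmod (2 * of_real H - c) > 0" using den[of 1] R by (simp add: c_def)
  ultimately have "cmod c \<le> (1 / R)\<^sup>2 * cmod (2 * of_real H - c)"
    by (simp only: pos_divide_le_eq)
  then have "cmod c * R\<^sup>2 \<le> (1 / R)\<^sup>2 * cmod (2 * of_real H - c) * R\<^sup>2"
    by (rule mult_right_mono) simp
  also have "\<dots> = cmod (2 * of_real H - c)"
    using R by (simp add: power_divide)
  also have "\<dots> \<le> 2 * H + cmod c"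
    by (rule order_trans[OF norm_triangle_ineq4]) (use H0 in simp)
  finally have "cmod c * (R\<^sup>2 - 1) \<le> 2 * H" by (simp add: algebra_simps)
  moreover have "R\<^sup>2 - 1 > 0" using R by simp
  ultimately have "cmod c \<le> 2 * H / (R\<^sup>2 - 1)" by (simp add: pos_le_divide_eq)
  moreover have "f 1 = exp c" using eg[of 1] R by (simp add: c_def)
  ultimately show ?thesis using that by blast
qed

lemma D2_zero: "D2 (\<lambda>i j. 0) = 1"
  by (simp add: D2_def d2_def dtm_idm)

lemma D2_tendsto_1:
  fixes A :: "nat \<Rightarrow> nat \<Rightarrow> nat \<Rightarrow> complex"
  assumes \<alpha>: "square_summable \<alpha>" and \<beta>: "\<And>n. square_summable (\<beta> n)"
    and A: "\<And>n. dominated \<alpha> (\<beta> n) (A n)"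
    and C: "\<And>n N j. (\<Sum>i<N. (cmod (A n i j))\<^sup>2) \<le> C j" "summable C"
    and nz: "\<And>R. \<forall>\<^sub>F n in sequentially. \<forall>w. cmod w < R \<longrightarrow> D2 (\<lambda>i j. w * A n i j) \<noteq> 0"
  shows "(\<lambda>n. D2 (A n)) \<longlonglongrightarrow> 1"
proof -
  define f where "f n w = D2 (\<lambda>i j. w * A n i j)" for n w
  have C0: "C j \<ge> 0" for j using C(1)[where N = 0] by simp
  have small: "\<forall>\<^sub>F n in sequentially. \<exists>c. f n 1 = exp c \<and> cmod c < e" if "e > 0" for e
  proof -
    have "\<exists>M. \<forall>m\<ge>M. norm (\<Sum>i. C (i + m)) < e"
      using suminf_exist_split[OF \<open>e > 0\<close> C(2)] .
    then obtain m where m: "(\<Sum>i. C (i + m)) < e" by (force simp: abs_less_iff)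
    define a where "a = 2 * (\<Sum>j<m. sqrt (C j))"
    define t where "t = (\<Sum>i. C (i + m)) / 2"
    have at: "a \<ge> 0" "t \<ge> 0" using C0 C(2)
      by (auto simp: a_def t_def summable_iff_shift intro!: sum_nonneg suminf_nonneg)
    \<comment> \<open>Here \<open>2 * t\<close> is the tail of \<open>C\<close>, made smaller than
      \<open>e\<close> by the choice of \<open>m\<close>. Thus the linear growth \<open>a\<close> is
      harmless for large \<open>R\<close>, and only the type matters in the limit.\<close>
    have "((\<lambda>R. 2 * (a * R + t * R\<^sup>2 + 1) / (R\<^sup>2 - 1)) \<longlongrightarrow> 2 * t) at_top"
      by real_asymp
    then have "\<forall>\<^sub>F R in at_top. 2 * (a * R + t * R\<^sup>2 + 1) / (R\<^sup>2 - 1) < e"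
      by (rule order_tendstoD) (use m in \<open>simp add: t_def\<close>)
    then have "\<forall>\<^sub>F R in at_top. R > 1 \<and> 2 * (a * R + t * R\<^sup>2 + 1) / (R\<^sup>2 - 1) < e"
      using eventually_gt_at_top[of "1::real"] by eventually_elim simp
    then obtain R where R: "R > 1" "2 * (a * R + t * R\<^sup>2 + 1) / (R\<^sup>2 - 1) < e"
      using eventually_happens'[OF trivial_limit_at_top_linorder] by blast
    show ?thesis
      using nz[of R]
    proof eventually_elim
      case (elim n)
      \<comment> \<open>The summand 1 in the exponent only serves to make the bound strict.\<close>
      have b: "cmod (f n w) < exp (a * R + t * R\<^sup>2 + 1)" if w: "cmod w < R" for w
      proof -
        have "cmod (f n w) \<le> exp (a * cmod w + t * (cmod w)\<^sup>2)"
          unfolding f_def a_def t_def by (rule D2_growth[OF \<alpha> \<beta> A C])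
        also have "\<dots> \<le> exp (a * R + t * R\<^sup>2)"
          using w at by (simp add: add_mono mult_left_mono power_mono)
        also have "\<dots> < exp (a * R + t * R\<^sup>2 + 1)" by simp
        finally show ?thesis .
      qed
      \<comment> \<open>With the cut at 0 the linear term disappears. The resulting coefficient is
        not small, but it is the purely quadratic shape that forces the logarithm to vanish to
        second order.\<close>
      have s: "cmod (f n w) \<le> exp ((\<Sum>j. C j) / 2 * (cmod w)\<^sup>2)" for w
        
      proof -
        have "cmod (D2 (\<lambda>i j. w * A n i j)) \<le> exp (2 * (\<Sum>j<0. sqrt (C j)) * cmod w
            + (\<Sum>j. C (j + 0)) / 2 * (cmod w)\<^sup>2)"
          by (rule D2_growth[OF \<alpha> \<beta> A C])
        then show ?thesis by (simp add: f_def)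
      qed
      have "f n holomorphic_on ball 0 R"
        unfolding f_def by (rule D2_scaled_holomorphic[OF \<alpha> \<beta> A])
      moreover have "f n 0 = 1" by (simp add: f_def D2_zero)
      moreover have "f n w \<noteq> 0" if "cmod w < R" for w using elim that by (simp add: f_def)
      ultimately obtain c where "f n 1 = exp c" "cmod c \<le> 2 * (a * R + t * R\<^sup>2 + 1) / (R\<^sup>2 - 1)"
        using zero_free_near_1[of "f n" R "a * R + t * R\<^sup>2 + 1" "(\<Sum>j. C j) / 2"] R(1) b s by metis
      then show ?case using R(2) by force
    qed
  qed
  have "(\<lambda>n. f n 1) \<longlonglongrightarrow> 1"
  proof (rule tendstoI)
    fix e :: real assume "e > 0"
    have "isCont exp (0::complex)" by simp
    then obtain d where d: "d > 0" "\<And>c. cmod c < d \<Longrightarrow> cmod (exp c - 1) < e"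
      using \<open>e > 0\<close> unfolding continuous_at_eps_delta by (auto simp: dist_norm)
    show "\<forall>\<^sub>F n in sequentially. dist (f n 1) 1 < e"
      using small[OF d(1)] by eventually_elim (auto simp: dist_norm d(2))
  qed
  then show ?thesis by (simp add: f_def)
qed

section \<open>Deflation of an eigenvector\<close>

global_interpretation complex_vector_pair:
  vector_space_pair "scaleC :: complex \<Rightarrow> 'a \<Rightarrow> 'a::complex_normed_vector"
    "scaleC :: complex \<Rightarrow> 'b \<Rightarrow> 'b::complex_normed_vector"
  by unfold_locales

abbreviation clinear :: "('a::complex_normed_vector \<Rightarrow> 'b::complex_normed_vector) \<Rightarrow> bool" where
  "clinear \<equiv> Vector_Spaces.linear scaleC scaleC"

definition eigenval :: "('a::complex_normed_vector \<Rightarrow> 'a) \<Rightarrow> complex \<Rightarrow> bool" where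
  "eigenval T \<mu> \<longleftrightarrow> (\<exists>x. x \<noteq> 0 \<and> T x = \<mu> *\<^sub>C x)"

definition gspace :: "('a::complex_normed_vector \<Rightarrow> 'a) \<Rightarrow> complex \<Rightarrow> 'a set" where
  "gspace T \<mu> = (\<Union>k. {x. ((\<lambda>y. T y - \<mu> *\<^sub>C y) ^^ k) x = 0})"

text \<open>A relation with an explicit finite basis, because \<open>dim\<close> also returns 0 on
  spaces of infinite dimension and could not tell them from the zero space.\<close>

definition has_mult :: "('a::complex_normed_vector \<Rightarrow> 'a) \<Rightarrow> complex \<Rightarrow> nat \<Rightarrow> bool" where
  "has_mult T \<mu> n \<longleftrightarrow> (\<exists>B. finite B \<and> complex_vector.independent B \<and>
     complex_vector.span B = gspace T \<mu> \<and> card B = n)"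

section \<open>Generalized eigenspaces and multiplicities\<close>

lemma clinearI:
  assumes "\<And>x y. T (x + y) = T x + T y" "\<And>c x. T (c *\<^sub>C x) = c *\<^sub>C T x"
  shows "clinear T"
  using assms by unfold_locales auto

lemma clinear_add: "clinear T \<Longrightarrow> T (x + y) = T x + T y"
  and clinear_scale: "clinear T \<Longrightarrow> T (c *\<^sub>C x) = c *\<^sub>C T x"
  and clinear_diff: "clinear T \<Longrightarrow> T (x - y) = T x - T y"
  and clinear_0: "clinear T \<Longrightarrow> T 0 = 0"
  by (simp_all add: complex_vector_pair.linear_add complex_vector_pair.linear_scale
      complex_vector_pair.linear_diff complex_vector_pair.linear_0)

lemma clinear_shift:
  assumes "clinear T"
  shows "clinear (\<lambda>y. T y - \<mu> *\<^sub>C y)"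
  by (rule clinearI)
     (simp_all add: clinear_add[OF assms] clinear_scale[OF assms] scaleC_add_right scaleC_scaleC
       complex_vector.scale_right_diff_distrib mult.commute)

lemma clinear_funpow:
  fixes T :: "'a::complex_normed_vector \<Rightarrow> 'a"
  assumes "clinear T"
  shows "clinear (T ^^ k)"
proof (induction k)
  case (Suc k)
  show ?case by (rule clinearI) (simp_all add: clinear_add[OF Suc] clinear_scale[OF Suc]
      clinear_add[OF assms] clinear_scale[OF assms])
qed (auto intro: clinearI)

lemma funpow_zero_mono:
  fixes T :: "'a::complex_normed_vector \<Rightarrow> 'a"
  assumes "clinear T" "(T ^^ k) x = 0" "k \<le> m"
  shows "(T ^^ m) x = 0"
proof -
  have "(T ^^ m) x = (T ^^ (m - k)) ((T ^^ k) x)"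
    using assms(3) by (metis funpow_add comp_apply le_add_diff_inverse2)
  then show ?thesis using assms(2) clinear_0[OF clinear_funpow[OF assms(1)]] by simp
qed

lemma subspace_gspace:
  assumes T: "clinear T"
  shows "complex_vector.subspace (gspace T \<mu>)"
proof -
  let ?S = "\<lambda>y. T y - \<mu> *\<^sub>C y"
  note lin = clinear_funpow[OF clinear_shift[OF T, of \<mu>]]
  show ?thesis
  proof (rule complex_vector.subspaceI)
    have "(?S ^^ 0) 0 = 0" by simp
    then show "0 \<in> gspace T \<mu>" unfolding gspace_def by blast
  next
    fix x y assume "x \<in> gspace T \<mu>" "y \<in> gspace T \<mu>"
    then obtain k l where k: "(?S ^^ k) x = 0" and l: "(?S ^^ l) y = 0"
      by (auto simp: gspace_def)
    have "(?S ^^ max k l) (x + y) = 0"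
      using funpow_zero_mono[OF clinear_shift[OF T] k, of "max k l"]
        funpow_zero_mono[OF clinear_shift[OF T] l, of "max k l"]
      by (simp add: clinear_add[OF lin])
    then show "x + y \<in> gspace T \<mu>" unfolding gspace_def by blast
  next
    fix c x assume "x \<in> gspace T \<mu>"
    then obtain k where k: "(?S ^^ k) x = 0" by (auto simp: gspace_def)
    then have "(?S ^^ k) (c *\<^sub>C x) = 0" by (simp add: clinear_scale[OF lin])
    then show "c *\<^sub>C x \<in> gspace T \<mu>" unfolding gspace_def by blast
  qed
qed

lemma has_mult_dim:
  assumes "has_mult T \<mu> n"
  shows "complex_vector.dim (gspace T \<mu>) = n"
  using assms complex_vector.dim_span_eq_card_independent unfolding has_mult_def by metis

lemma has_mult_unique: "has_mult T \<mu> m \<Longrightarrow> has_mult T \<mu> n \<Longrightarrow> m = n"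
  using has_mult_dim by metis

lemma eigenval_iff_gspace:
  assumes T: "clinear T"
  shows "eigenval T \<mu> \<longleftrightarrow> gspace T \<mu> \<noteq> {0}"
proof
  assume "eigenval T \<mu>"
  then obtain x where x: "x \<noteq> 0" "T x = \<mu> *\<^sub>C x" by (auto simp: eigenval_def)
  then have "((\<lambda>y. T y - \<mu> *\<^sub>C y) ^^ 1) x = 0" by simp
  then have "x \<in> gspace T \<mu>" unfolding gspace_def by blast
  then show "gspace T \<mu> \<noteq> {0}" using x by auto
next
  let ?S = "\<lambda>y. T y - \<mu> *\<^sub>C y"
  assume "gspace T \<mu> \<noteq> {0}"
  moreover have "0 \<in> gspace T \<mu>" using complex_vector.subspace_0[OF subspace_gspace[OF T]] .
  ultimately obtain x k where x: "x \<noteq> 0" "(?S ^^ k) x = 0" by (auto simp: gspace_def)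
  from x(2) show "eigenval T \<mu>"
  proof (induction k)
    case (Suc k)
    show ?case
    proof (cases "(?S ^^ k) x = 0")
      case False
      moreover have "T ((?S ^^ k) x) = \<mu> *\<^sub>C (?S ^^ k) x" using Suc.prems by simp
      ultimately show ?thesis unfolding eigenval_def by blast
    qed (rule Suc.IH)
  qed (use x in simp)
qed

lemma has_mult_0_iff:
  assumes T: "clinear T" and "has_mult T \<mu> n"
  shows "n = 0 \<longleftrightarrow> \<not> eigenval T \<mu>"
proof -
  obtain B where B: "finite B" "complex_vector.independent B" "complex_vector.span B = gspace T \<mu>" "card B = n"
    using assms(2) by (auto simp: has_mult_def)
  have "gspace T \<mu> = {0} \<longleftrightarrow> B = {}"
  proof
    assume *: "gspace T \<mu> = {0}"
    then have "B \<subseteq> {0}" using complex_vector.span_superset[of B] B(3) by auto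
    moreover have "0 \<notin> B" using B(2) complex_vector.dependent_zero by blast
    ultimately show "B = {}" by auto
  next
    assume "B = {}"
    then show "gspace T \<mu> = {0}" using B(3) by (simp add: complex_vector.span_empty)
  qed
  then show ?thesis using B eigenval_iff_gspace[OF T] by auto
qed

lemma has_mult_0:
  assumes T: "clinear T" and "\<not> eigenval T \<mu>"
  shows "has_mult T \<mu> 0"
proof -
  have "complex_vector.span {} = gspace T \<mu>"
    using assms eigenval_iff_gspace[OF T] by (simp add: complex_vector.span_empty)
  moreover have "complex_vector.independent {}" by (rule complex_vector.independent_empty)
  ultimately show ?thesis unfolding has_mult_def by (intro exI[of _ "{}"]) auto
qed

section \<open>Passing to the quotient by an eigenvector\<close>

locale deflation =
  fixes T :: "'a::complex_normed_vector \<Rightarrow> 'a" and v :: 'a and lam :: complex and \<psi> :: "'a \<Rightarrow> complex"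
  assumes T: "clinear T" and Tv: "T v = lam *\<^sub>C v"
    and \<psi>_add: "\<And>x y. \<psi> (x + y) = \<psi> x + \<psi> y" and \<psi>_scale: "\<And>c x. \<psi> (c *\<^sub>C x) = c * \<psi> x"
    and \<psi>v: "\<psi> v = 1"
begin

definition proj :: "'a \<Rightarrow> 'a" where
  "proj x = x - \<psi> x *\<^sub>C v"

text \<open>A model of the map that \<open>T\<close> induces on the quotient by the line of
  \<open>v\<close>: the quotient is identified with the kernel of \<open>\<psi>\<close> through
  \<open>proj\<close>.\<close>

definition deflated :: "'a \<Rightarrow> 'a" where
  "deflated x = T x - \<psi> (T x) *\<^sub>C v"

lemma \<psi>_diff: "\<psi> (x - y) = \<psi> x - \<psi> y"
  using \<psi>_add[of "x - y" y] by simp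

lemma \<psi>_0: "\<psi> 0 = 0"
  using \<psi>_diff[of 0 0] by simp

lemma clinear_proj: "clinear proj"
  by (rule clinearI)
     (simp_all add: proj_def \<psi>_add \<psi>_scale scaleC_add_left complex_vector.scale_right_diff_distrib scaleC_scaleC)

lemma proj_v: "proj v = 0"
  by (simp add: proj_def \<psi>v scaleC_one)

lemma \<psi>_proj: "\<psi> (proj x) = 0"
  by (simp add: proj_def \<psi>_diff \<psi>_scale \<psi>v)

lemma deflated_eq_proj: "deflated x = proj (T x)"
  by (simp add: deflated_def proj_def)

text \<open>The intertwining relation behind everything that follows. It holds because
  \<open>T\<close> maps the line of \<open>v\<close>, which \<open>proj\<close> annihilates, into
  itself.\<close>

lemma deflated_proj: "deflated (proj x) = proj (T x)"
proof -
  have "T (proj x) = T x - (\<psi> x * lam) *\<^sub>C v"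
    by (simp add: proj_def clinear_diff[OF T] clinear_scale[OF T] Tv scaleC_scaleC)
  then show ?thesis
    by (simp add: deflated_eq_proj clinear_diff[OF clinear_proj] clinear_scale[OF clinear_proj] proj_v)
qed

lemma proj_funpow:
  "proj (((\<lambda>y. T y - \<mu> *\<^sub>C y) ^^ k) x) = ((\<lambda>y. deflated y - \<mu> *\<^sub>C y) ^^ k) (proj x)"
proof (induction k)
  case (Suc k)
  let ?y = "((\<lambda>y. T y - \<mu> *\<^sub>C y) ^^ k) x"
  have "proj (T ?y - \<mu> *\<^sub>C ?y) = deflated (proj ?y) - \<mu> *\<^sub>C proj ?y"
    by (simp only: clinear_diff[OF clinear_proj] clinear_scale[OF clinear_proj] deflated_proj)
  then show ?case unfolding Suc.IH by simp
qed simp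

lemma proj_gspace: "x \<in> gspace T \<mu> \<Longrightarrow> proj x \<in> gspace deflated \<mu>"
proof -
  assume "x \<in> gspace T \<mu>"
  then obtain k where "((\<lambda>y. T y - \<mu> *\<^sub>C y) ^^ k) x = 0" by (auto simp: gspace_def)
  then have "((\<lambda>y. deflated y - \<mu> *\<^sub>C y) ^^ k) (proj x) = 0"
    using proj_funpow[of k \<mu> x] clinear_0[OF clinear_proj] by simp
  then show ?thesis unfolding gspace_def by blast
qed

text \<open>The range of \<open>deflated\<close> lies in the kernel of \<open>\<psi>\<close>, so
  \<open>\<psi>\<close> sees the shifted map as multiplication by \<open>- \<mu>\<close>, which is
  not nilpotent.\<close>

lemma gspace_deflated_\<psi>:
  assumes "y \<in> gspace deflated \<mu>" "\<mu> \<noteq> 0"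
  shows "\<psi> y = 0"
proof -
  have "\<psi> (((\<lambda>y. deflated y - \<mu> *\<^sub>C y) ^^ k) y) = (- \<mu>) ^ k * \<psi> y" for k
    by (induction k) (simp_all add: \<psi>_diff \<psi>_scale deflated_eq_proj \<psi>_proj)
  moreover obtain k where "((\<lambda>y. deflated y - \<mu> *\<^sub>C y) ^^ k) y = 0"
    using assms by (auto simp: gspace_def)
  ultimately have "(- \<mu>) ^ k * \<psi> y = 0" by (metis \<psi>_0)
  then show ?thesis using assms(2) by simp
qed

lemma gspace_deflated_proj:
  assumes "y \<in> gspace deflated \<mu>" "\<mu> \<noteq> 0"
  shows "proj y = y"
  using gspace_deflated_\<psi>[OF assms] by (simp add: proj_def)

lemma gspace_deflated_funpow:
  assumes "y \<in> gspace deflated \<mu>" "\<mu> \<noteq> 0"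
  obtains k c where "((\<lambda>y. T y - \<mu> *\<^sub>C y) ^^ k) y = c *\<^sub>C v"
proof -
  obtain k where "((\<lambda>y. deflated y - \<mu> *\<^sub>C y) ^^ k) y = 0"
    using assms by (auto simp: gspace_def)
  then have "proj (((\<lambda>y. T y - \<mu> *\<^sub>C y) ^^ k) y) = 0"
    using gspace_deflated_proj[OF assms] by (simp add: proj_funpow)
  then show ?thesis using that by (simp add: proj_def)
qed

lemma funpow_v: "((\<lambda>y. T y - \<mu> *\<^sub>C y) ^^ k) (c *\<^sub>C v) = (c * (lam - \<mu>) ^ k) *\<^sub>C v"
proof (induction k)
  case (Suc k)
  let ?a = "c * (lam - \<mu>) ^ k"
  have "T (?a *\<^sub>C v) - \<mu> *\<^sub>C ?a *\<^sub>C v = (?a * lam - \<mu> * ?a) *\<^sub>C v"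
    by (simp only: clinear_scale[OF T] Tv scaleC_scaleC complex_vector.scale_left_diff_distrib)
  also have "?a * lam - \<mu> * ?a = c * (lam - \<mu>) ^ Suc k" by (simp add: algebra_simps)
  finally show ?case using Suc by simp
qed simp

lemma v_nonzero: "v \<noteq> 0"
  using \<psi>v \<psi>_0 by auto

text \<open>The generalized eigenspace of \<open>T\<close> is an extension of that of
  \<open>deflated\<close> by the line of \<open>v\<close>, so a basis is completed by
  \<open>v\<close>. The implication runs from the deflated map to \<open>T\<close> because
  finiteness of multiplicities is later obtained by induction in this direction.\<close>

lemma has_mult_deflated_same:
  assumes "has_mult deflated lam n" "lam \<noteq> 0"
  shows "has_mult T lam (Suc n)"
proof -
  obtain B where B: "finite B" "complex_vector.independent B"
    "complex_vector.span B = gspace deflated lam" "card B = n"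
    using assms(1) by (auto simp: has_mult_def)
  let ?S = "\<lambda>y. T y - lam *\<^sub>C y"
  have "v \<notin> complex_vector.span B"
    using gspace_deflated_\<psi>[of v lam] B(3) assms(2) \<psi>v by auto
  then have indep: "complex_vector.independent (insert v B)" "v \<notin> B"
    using B(2) complex_vector.span_base by (auto simp: complex_vector.independent_insert)
  have v: "v \<in> gspace T lam"
  proof -
    have "(?S ^^ 1) v = 0" using Tv by simp
    then show ?thesis unfolding gspace_def by blast
  qed
  have sub: "gspace deflated lam \<subseteq> gspace T lam"
  proof
    fix y assume "y \<in> gspace deflated lam"
    then obtain k c where "(?S ^^ k) y = c *\<^sub>C v"
      using gspace_deflated_funpow assms(2) by blast
    then have "(?S ^^ Suc k) y = 0"
      using Tv by (simp add: clinear_scale[OF T] scaleC_scaleC mult.commute)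
    then show "y \<in> gspace T lam" unfolding gspace_def by blast
  qed
  have "complex_vector.span (insert v B) = gspace T lam"
  proof
    show "complex_vector.span (insert v B) \<subseteq> gspace T lam"
      using complex_vector.span_superset[of B] B(3) sub v
      by (intro complex_vector.span_minimal subspace_gspace T) auto
    show "gspace T lam \<subseteq> complex_vector.span (insert v B)"
    proof
      fix x assume "x \<in> gspace T lam"
      then have "proj x \<in> complex_vector.span B" using proj_gspace B(3) by blast
      then show "x \<in> complex_vector.span (insert v B)"
        unfolding proj_def complex_vector.span_insert by blast
    qed
  qed
  then show ?thesis
    unfolding has_mult_def using B indep by (intro exI[of _ "insert v B"]) auto
qed

text \<open>For \<open>\<mu>\<close> different from \<open>lam\<close> the shifted map is invertible
  on the line of \<open>v\<close>, so dividing out this line loses nothing: \<open>proj\<close>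
  restricts to an isomorphism of the generalized eigenspaces.\<close>

lemma has_mult_deflated_other:
  assumes "has_mult T \<mu> n" "\<mu> \<noteq> 0" "\<mu> \<noteq> lam"
  shows "has_mult deflated \<mu> n"
proof -
  obtain B where B: "finite B" "complex_vector.independent B"
    "complex_vector.span B = gspace T \<mu>" "card B = n"
    using assms(1) by (auto simp: has_mult_def)
  let ?S = "\<lambda>y. T y - \<mu> *\<^sub>C y"
  have inj: "inj_on proj (complex_vector.span B)"
  proof (subst complex_vector_pair.linear_inj_on_iff_eq_0[OF clinear_proj complex_vector.subspace_span], intro ballI impI)
    fix x assume "x \<in> complex_vector.span B" "proj x = 0"
    then obtain k where k: "(?S ^^ k) x = 0" and x: "x = \<psi> x *\<^sub>C v"
      using B(3) by (auto simp: gspace_def proj_def)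
    have "(?S ^^ k) x = (\<psi> x * (lam - \<mu>) ^ k) *\<^sub>C v"
      using funpow_v[where c = "\<psi> x"] x by metis
    then have "\<psi> x = 0" using k v_nonzero assms(3) by (auto simp: complex_vector.scale_eq_0_iff)
    then show "x = 0" using x by simp
  qed
  have "proj ` gspace T \<mu> = gspace deflated \<mu>"
  proof
    show "gspace deflated \<mu> \<subseteq> proj ` gspace T \<mu>"
    proof
      fix y assume y: "y \<in> gspace deflated \<mu>"
      then obtain k c where k: "(?S ^^ k) y = c *\<^sub>C v"
        using gspace_deflated_funpow assms(2) by blast
      \<comment> \<open>On the line of \<open>v\<close> the power acts as the nonzero scalar
        \<open>(lam - \<mu>) ^ k\<close>, so this multiple of \<open>v\<close> cancels the remainder
        \<open>c *\<^sub>C v\<close>.\<close>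
      define x where "x = y - (c / (lam - \<mu>) ^ k) *\<^sub>C v"
      have "(?S ^^ k) x = 0"
        using assms(3) unfolding x_def clinear_diff[OF clinear_funpow[OF clinear_shift[OF T]]] k funpow_v
        by simp
      then have "x \<in> gspace T \<mu>" unfolding gspace_def by blast
      moreover have "proj x = y"
        using gspace_deflated_proj[OF y assms(2)]
        by (simp add: x_def clinear_diff[OF clinear_proj] clinear_scale[OF clinear_proj] proj_v)
      ultimately show "y \<in> proj ` gspace T \<mu>" by blast
    qed
  qed (use proj_gspace in blast)
  then have "complex_vector.span (proj ` B) = gspace deflated \<mu>"
    by (simp add: complex_vector_pair.linear_span_image[OF clinear_proj] B(3))
  moreover have "complex_vector.independent (proj ` B)"
    by (rule complex_vector_pair.linear_independent_injective_image[OF clinear_proj B(2) inj])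
  moreover have "card (proj ` B) = n"
    using B(4) inj complex_vector.span_superset[of B] by (simp add: card_image inj_on_subset)
  ultimately show ?thesis using B(1) unfolding has_mult_def by blast
qed

text \<open>Works with eigenvectors alone, so that distinct eigenvalues can be removed one after
  another without reference to multiplicities.\<close>

lemma eigenval_deflated_other:
  assumes "eigenval T \<mu>" "\<mu> \<noteq> lam"
  shows "eigenval deflated \<mu>"
proof -
  obtain x where x: "x \<noteq> 0" "T x = \<mu> *\<^sub>C x" using assms by (auto simp: eigenval_def)
  have "deflated (proj x) = \<mu> *\<^sub>C proj x"
    by (simp add: deflated_proj x clinear_scale[OF clinear_proj])
  moreover have "proj x \<noteq> 0"
  proof
    assume "proj x = 0"
    then have xv: "x = \<psi> x *\<^sub>C v" by (simp add: proj_def)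
    have "T (\<psi> x *\<^sub>C v) = lam *\<^sub>C (\<psi> x *\<^sub>C v)"
      by (simp add: clinear_scale[OF T] Tv scaleC_scaleC mult.commute)
    then have "\<mu> *\<^sub>C x = lam *\<^sub>C x" using x(2) xv by metis
    then show False using x(1) assms(2) by (simp add: complex_vector.scale_right_imp_eq)
  qed
  ultimately show ?thesis unfolding eigenval_def by blast
qed

end

section \<open>Deflation and the regularized determinant\<close>

text \<open>As \<open>M'\<close> annihilates \<open>a\<close>, the product of
  \<open>1 - w M'\<close> with the rank-one factor \<open>1 - w a b\<close> is
  \<open>1 - w M\<close>. The determinant of the rank-one factor is \<open>1 - w lam\<close>, where
  \<open>lam\<close> is its trace, and the traces add up to the remaining exponential.\<close>

lemma D2_deflation:
  assumes \<alpha>: "square_summable \<alpha>" and \<beta>: "square_summable \<beta>" and \<beta>': "square_summable \<beta>'"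
    and M: "dominated \<alpha> \<beta> M" and M': "dominated \<alpha> \<beta>' M'"
    and eq: "\<And>i j. M' i j = M i j - a i * b j"
    and a: "square_summable (\<lambda>i. cmod (a i))" and b: "square_summable (\<lambda>i. cmod (b i))"
    and null: "\<And>i. (\<lambda>k. M' i k * a k) sums 0" and trace: "(\<lambda>k. b k * a k) sums lam"
  shows "D2 (\<lambda>i j. w * M i j) = (1 - w * lam) * exp (w * lam) * D2 (\<lambda>i j. w * M' i j)"
proof -
  \<comment> \<open>Truncation destroys the relation \<open>M' a = 0\<close>; \<open>e N\<close> is
    the defect. It equals minus the tail of the series, hence is bounded by the tail
    \<open>\<tau> N\<close> times \<open>\<alpha>\<close>.\<close>
  define e where "e N i = (\<Sum>k<N. M' i k * a k)" for N i
  define s where "s N = (\<Sum>k<N. b k * a k)" for N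
  define \<tau> where "\<tau> N = (\<Sum>k. \<beta>' (k + N) * cmod (a (k + N)))" for N
  have sm: "summable (\<lambda>k. \<beta>' k * cmod (a k))" by (rule square_summable_product[OF \<beta>' a])
  have \<tau>0: "\<tau> \<longlonglongrightarrow> 0" unfolding \<tau>_def by (rule suminf_exist_split2[OF sm])
  have \<alpha>0: "\<alpha> i \<ge> 0" for i using \<alpha> by (simp add: square_summable_def)
  have eb: "cmod (e N i) \<le> \<tau> N * \<alpha> i" for N i
  proof -
    have "summable (\<lambda>k. M' i k * a k)" "(\<Sum>k. M' i k * a k) = 0"
      using null[of i] by (auto simp: sums_iff)
    then have ei: "e N i = - (\<Sum>k. M' i (k + N) * a (k + N))"
      using suminf_split_initial_segment[of "\<lambda>k. M' i k * a k" N] by (simp add: e_def add_eq_0_iff)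
    have le: "norm (M' i (k + N) * a (k + N)) \<le> \<alpha> i * (\<beta>' (k + N) * cmod (a (k + N)))" for k
      using M' by (auto simp: dominated_def norm_mult mult.assoc[symmetric] intro!: mult_right_mono)
    have sm2: "summable (\<lambda>k. \<alpha> i * (\<beta>' (k + N) * cmod (a (k + N))))"
      using summable_ignore_initial_segment[OF sm, of N] by (rule summable_mult)
    have "norm (\<Sum>k. M' i (k + N) * a (k + N)) \<le> (\<Sum>k. \<alpha> i * (\<beta>' (k + N) * cmod (a (k + N))))"
      by (rule norm_suminf_le[OF le sm2])
    also have "\<dots> = \<alpha> i * \<tau> N"
      unfolding \<tau>_def by (rule suminf_mult) (rule summable_ignore_initial_segment[OF sm])
    finally show ?thesis by (simp add: ei mult.commute[of "\<tau> N"])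
  qed
  have \<tau>nn: "\<tau> N \<ge> 0" for N
    unfolding \<tau>_def using \<beta>' summable_ignore_initial_segment[OF sm, of N]
    by (intro suminf_nonneg) (auto simp: square_summable_def)
  have e0: "(\<lambda>N. vnorm N (e N)) \<longlonglongrightarrow> 0"
  proof (rule Lim_null_comparison)
    show "\<forall>\<^sub>F N in sequentially. norm (vnorm N (e N)) \<le> \<tau> N * sqrt (\<Sum>i. (\<alpha> i)\<^sup>2)"
    proof (rule always_eventually, rule allI)
      fix N
      have "vnorm N (e N) \<le> L2_set (\<lambda>i. \<tau> N * \<alpha> i) {..<N}"
        unfolding vnorm_def by (rule L2_set_mono) (use eb in auto)
      also have "\<dots> = \<tau> N * L2_set \<alpha> {..<N}"
        by (rule L2_set_right_distrib[symmetric]) (rule \<tau>nn)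
      also have "\<dots> \<le> \<tau> N * sqrt (\<Sum>i. (\<alpha> i)\<^sup>2)"
        unfolding L2_set_def using \<tau>nn by (intro mult_left_mono real_sqrt_le_mono square_summable_partial \<alpha>) auto
      finally show "norm (vnorm N (e N)) \<le> \<tau> N * sqrt (\<Sum>i. (\<alpha> i)\<^sup>2)"
        using vnorm_nonneg by simp
    qed
    show "(\<lambda>N. \<tau> N * sqrt (\<Sum>i. (\<alpha> i)\<^sup>2)) \<longlonglongrightarrow> 0" using \<tau>0 by (rule tendsto_mult_left_zero)
  qed
  have bb: "vnorm N b \<le> sqrt (\<Sum>i. (cmod (b i))\<^sup>2)" for N
    unfolding vnorm_def L2_set_def by (intro real_sqrt_le_mono square_summable_partial b)
  have eb0: "(\<lambda>N. vnorm N (e N) * vnorm N b) \<longlonglongrightarrow> 0"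
  proof (rule Lim_null_comparison)
    show "\<forall>\<^sub>F N in sequentially. norm (vnorm N (e N) * vnorm N b) \<le> vnorm N (e N) * sqrt (\<Sum>i. (cmod (b i))\<^sup>2)"
      using bb by (auto simp: abs_mult vnorm_nonneg intro!: always_eventually mult_left_mono)
    show "(\<lambda>N. vnorm N (e N) * sqrt (\<Sum>i. (cmod (b i))\<^sup>2)) \<longlonglongrightarrow> 0" using e0 by (rule tendsto_mult_left_zero)
  qed
  \<comment> \<open>Exact for every finite size: the defect enters as a rank-one perturbation of
    \<open>w M\<close> and as its trace in the exponential, and both disappear in the limit.\<close>
  have id: "d2 N (\<lambda>i j. w * M' i j) * (1 - w * s N) * exp (w * s N)
      = d2 N (\<lambda>i j. w * M i j - w\<^sup>2 * (e N i * b j)) * exp (w\<^sup>2 * (\<Sum>k<N. e N k * b k))" for N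
  proof -
    have "dtm N (\<lambda>i j. idm i j - (w * M i j - w\<^sup>2 * (e N i * b j)))
        = dtm N (\<lambda>i j. \<Sum>k<N. (idm i k - w * M' i k) * (idm k j - (w * a k) * b j))"
    proof (rule dtm_cong)
      fix i j assume ij: "i < N" "j < N"
      have "(\<Sum>k<N. (idm i k - w * M' i k) * (idm k j - (w * a k) * b j))
          = (\<Sum>k<N. (if k = i then idm i j - w * a i * b j else 0) - (if k = j then w * M' i j else 0)
              + w\<^sup>2 * (M' i k * a k * b j))"
        by (intro sum.cong) (auto simp: idm_def power2_eq_square algebra_simps)
      also have "\<dots> = idm i j - w * a i * b j - w * M' i j + w\<^sup>2 * (e N i * b j)"
        using ij by (simp add: sum.distrib sum_subtractf e_def sum_distrib_left sum_distrib_right)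
      also have "\<dots> = idm i j - (w * M i j - w\<^sup>2 * (e N i * b j))"
        by (simp add: eq algebra_simps)
      finally show "idm i j - (w * M i j - w\<^sup>2 * (e N i * b j))
          = (\<Sum>k<N. (idm i k - w * M' i k) * (idm k j - (w * a k) * b j))" by simp
    qed
    also have "\<dots> = dtm N (\<lambda>i j. idm i j - w * M' i j) * dtm N (\<lambda>i j. idm i j - (w * a i) * b j)"
      by (rule dtm_mult)
    also have "dtm N (\<lambda>i j. idm i j - (w * a i) * b j) = 1 - w * s N"
      unfolding dtm_rank_one by (simp add: s_def sum_distrib_left mult_ac)
    finally have det: "dtm N (\<lambda>i j. idm i j - (w * M i j - w\<^sup>2 * (e N i * b j)))
        = dtm N (\<lambda>i j. idm i j - w * M' i j) * (1 - w * s N)" .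
    have "(\<Sum>k<N. w * M' k k) + w * s N
        = (\<Sum>k<N. w * M k k - w\<^sup>2 * (e N k * b k)) + w\<^sup>2 * (\<Sum>k<N. e N k * b k)"
      by (simp add: s_def sum_distrib_left sum.distrib[symmetric] eq algebra_simps)
    then have "exp (\<Sum>k<N. w * M' k k) * exp (w * s N)
        = exp (\<Sum>k<N. w * M k k - w\<^sup>2 * (e N k * b k)) * exp (w\<^sup>2 * (\<Sum>k<N. e N k * b k))"
      by (simp only: exp_add[symmetric])
    moreover have "p * x * q * y = p * q * u * v" if "x * y = u * v" for p q u v x y :: complex
      using that by (metis mult.assoc mult.commute)
    ultimately show ?thesis unfolding d2_def det by blast
  qed
  have wM: "dominated (\<lambda>i. cmod w * \<alpha> i) \<beta> (\<lambda>i j. w * M i j)"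
      "dominated (\<lambda>i. cmod w * \<alpha> i) \<beta>' (\<lambda>i j. w * M' i j)"
    using \<alpha> \<beta> \<beta>' by (auto intro!: dominated_scale M M' simp: square_summable_def)
  have w\<alpha>: "square_summable (\<lambda>i. cmod w * \<alpha> i)" by (rule square_summable_scale[OF \<alpha>]) simp
  have "s \<longlonglongrightarrow> lam" using trace by (simp add: sums_def s_def[abs_def])
  then have "(\<lambda>N. d2 N (\<lambda>i j. w * M' i j) * (1 - w * s N) * exp (w * s N))
      \<longlonglongrightarrow> D2 (\<lambda>i j. w * M' i j) * (1 - w * lam) * exp (w * lam)"
    by (intro tendsto_intros D2_tendsto[OF w\<alpha> \<beta>' wM(2)])
  moreover have "(\<lambda>N. d2 N (\<lambda>i j. w * M i j - w\<^sup>2 * (e N i * b j)) * exp (w\<^sup>2 * (\<Sum>k<N. e N k * b k)))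
      \<longlonglongrightarrow> D2 (\<lambda>i j. w * M i j) * exp (w\<^sup>2 * 0)"
  proof (intro tendsto_intros D2_tendsto_perturbed[OF w\<alpha> \<beta> wM(1)])
    have "fro N (\<lambda>i j. w * M i j - w\<^sup>2 * (e N i * b j) - w * M i j)
        = cmod (w\<^sup>2) * (vnorm N (e N) * vnorm N b)" for N
      using fro_scale[of N "- (w\<^sup>2)" "\<lambda>i j. e N i * b j"] by (simp add: fro_rank_one)
    then show "(\<lambda>N. fro N (\<lambda>i j. w * M i j - w\<^sup>2 * (e N i * b j) - w * M i j)) \<longlonglongrightarrow> 0"
      using tendsto_mult_right_zero[OF eb0, of "cmod (w\<^sup>2)"] by simp
    show "(\<lambda>N. \<Sum>k<N. e N k * b k) \<longlonglongrightarrow> 0"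
      by (rule Lim_null_comparison[OF _ eb0]) (simp add: vnorm_cauchy_schwarz)
  qed
  ultimately have "D2 (\<lambda>i j. w * M' i j) * (1 - w * lam) * exp (w * lam) = D2 (\<lambda>i j. w * M i j) * exp (w\<^sup>2 * 0)"
    unfolding id by (rule LIMSEQ_unique)
  then show ?thesis by (simp add: mult_ac)
qed

lemma series_cauchy_schwarz:
  fixes x y :: "nat \<Rightarrow> complex"
  assumes "square_summable (\<lambda>i. cmod (x i))" "square_summable (\<lambda>i. cmod (y i))"
    and "(\<lambda>i. x i * y i) sums s"
  shows "(cmod s)\<^sup>2 \<le> (\<Sum>i. (cmod (x i))\<^sup>2) * (\<Sum>i. (cmod (y i))\<^sup>2)"
proof (rule LIMSEQ_le)
  show "(\<lambda>N. (cmod (\<Sum>i<N. x i * y i))\<^sup>2) \<longlonglongrightarrow> (cmod s)\<^sup>2"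
    using assms(3) unfolding sums_def by (intro tendsto_intros)
  show "(\<lambda>N. (\<Sum>i<N. (cmod (x i))\<^sup>2) * (\<Sum>i<N. (cmod (y i))\<^sup>2))
      \<longlonglongrightarrow> (\<Sum>i. (cmod (x i))\<^sup>2) * (\<Sum>i. (cmod (y i))\<^sup>2)"
    using assms(1,2) by (intro tendsto_intros summable_LIMSEQ) (auto simp: square_summable_def)
  show "\<exists>N. \<forall>n\<ge>N. (cmod (\<Sum>i<n. x i * y i))\<^sup>2 \<le> (\<Sum>i<n. (cmod (x i))\<^sup>2) * (\<Sum>i<n. (cmod (y i))\<^sup>2)"
    using power_mono[OF vnorm_cauchy_schwarz, where n = 2]
    by (auto simp: power_mult_distrib vnorm_sq)
qed

definition seq_compact_map :: "('a::complex_banach \<Rightarrow> 'a) \<Rightarrow> bool" where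
  "seq_compact_map T \<longleftrightarrow> (\<forall>y :: nat \<Rightarrow> 'a. bounded (range y) \<longrightarrow>
     (\<exists>r l. strict_mono r \<and> (\<lambda>n. T (y (r n))) \<longlonglongrightarrow> l))"

section \<open>Operators with a common sequence of functionals\<close>

locale functional_sequence =
  fixes \<phi> :: "nat \<Rightarrow> 'a::complex_banach \<Rightarrow>\<^sub>L complex"
  assumes complex_linear_\<phi>: "\<And>n. complex_linear (\<phi> n)"
    and square_summable_\<phi>: "square_summable (\<lambda>n. norm (\<phi> n))"
begin

definition nuc :: "(nat \<Rightarrow> 'a) \<Rightarrow> 'a \<Rightarrow> 'a" where
  "nuc f x = (\<Sum>k. \<phi> k x *\<^sub>C f k)"

definition mat :: "(nat \<Rightarrow> 'a) \<Rightarrow> nat \<Rightarrow> nat \<Rightarrow> complex" where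
  "mat f j k = \<phi> j (f k)"

text \<open>The inner product of l^2 pulled back along the map \<open>x\<close> to
  \<open>\<phi> j x\<close>. It is degenerate in general, as the functionals need not separate
  points.\<close>

definition inn :: "'a \<Rightarrow> 'a \<Rightarrow> complex" where
  "inn x y = (\<Sum>j. cnj (\<phi> j x) * \<phi> j y)"

definition nrm :: "'a \<Rightarrow> real" where
  "nrm x = (\<Sum>j. (cmod (\<phi> j x))\<^sup>2)"

text \<open>The squared Hilbert-Schmidt norm of \<open>mat f\<close>, summed column by
  column.\<close>

definition hs :: "(nat \<Rightarrow> 'a) \<Rightarrow> real" where
  "hs f = (\<Sum>k. nrm (f k))"

definition vectors :: "(nat \<Rightarrow> 'a) set" where
  "vectors = {f. square_summable (\<lambda>k. norm (f k))}"

definition S :: real where "S = (\<Sum>j. (norm (\<phi> j))\<^sup>2)"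

lemma S_nonneg: "S \<ge> 0"
  unfolding S_def using square_summable_\<phi> by (intro suminf_nonneg) (auto simp: square_summable_def)

lemma \<phi>_scale: "\<phi> k (c *\<^sub>C x) = c * \<phi> k x"
  using complex_linear_\<phi>[of k] by (simp add: complex_linear_def scaleC_complex_def)

lemma \<phi>_add: "\<phi> k (x + y) = \<phi> k x + \<phi> k y"
  by (rule blinfun.add_right)

lemma \<phi>_diff: "\<phi> k (x - y) = \<phi> k x - \<phi> k y"
  by (rule blinfun.diff_right)

lemma \<phi>_le: "cmod (\<phi> k x) \<le> norm (\<phi> k) * norm x"
  by (rule norm_blinfun)

lemma square_summable_\<phi>_apply: "square_summable (\<lambda>k. cmod (\<phi> k x))"
  by (rule square_summable_mono[OF square_summable_scale[OF square_summable_\<phi>, of "norm x"]])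
     (use \<phi>_le in \<open>auto simp: mult.commute\<close>)

lemma summable_\<phi>_sq: "summable (\<lambda>k. (cmod (\<phi> k x))\<^sup>2)"
  using square_summable_\<phi>_apply by (simp add: square_summable_def)

lemma nrm_le: "nrm x \<le> S * (norm x)\<^sup>2"
proof -
  have sm: "summable (\<lambda>j. (norm (\<phi> j))\<^sup>2)" using square_summable_\<phi> by (simp add: square_summable_def)
  have "nrm x \<le> (\<Sum>j. (norm (\<phi> j))\<^sup>2 * (norm x)\<^sup>2)"
    unfolding nrm_def
    by (intro suminf_le summable_\<phi>_sq summable_mult2 sm)
       (auto simp: power_mult_distrib[symmetric] \<phi>_le intro!: power_mono)
  also have "\<dots> = S * (norm x)\<^sup>2"
    unfolding S_def by (rule suminf_mult2[symmetric, OF sm])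
  finally show ?thesis .
qed

lemma nrm_nonneg: "nrm x \<ge> 0"
  unfolding nrm_def by (intro suminf_nonneg summable_\<phi>_sq) auto

lemma summable_inn: "summable (\<lambda>j. cnj (\<phi> j x) * \<phi> j y)"
  by (rule summable_norm_cancel)
     (use square_summable_product[OF square_summable_\<phi>_apply square_summable_\<phi>_apply] in \<open>simp add: norm_mult\<close>)

lemma inn_add: "inn x (y + z) = inn x y + inn x z"
  unfolding inn_def by (simp add: \<phi>_add distrib_left suminf_add[OF summable_inn summable_inn])

lemma inn_scale: "inn x (c *\<^sub>C y) = c * inn x y"
  unfolding inn_def suminf_mult[OF summable_inn, symmetric] by (simp add: \<phi>_scale mult_ac)

lemma inn_self: "inn x x = of_real (nrm x)"
  unfolding inn_def nrm_def suminf_of_real[OF summable_\<phi>_sq]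
  by (simp add: complex_norm_square mult.commute del: of_real_power)

lemma inn_sq: "(cmod (inn x y))\<^sup>2 \<le> nrm x * nrm y"
  using series_cauchy_schwarz[of "\<lambda>j. cnj (\<phi> j x)" "\<lambda>j. \<phi> j y" "inn x y"] square_summable_\<phi>_apply
    summable_sums[OF summable_inn]
  by (simp add: inn_def nrm_def)

lemma inn_le: "cmod (inn x y) \<le> S * norm x * norm y"
proof (rule power2_le_imp_le)
  have "(cmod (inn x y))\<^sup>2 \<le> nrm x * nrm y" by (rule inn_sq)
  also have "\<dots> \<le> (S * (norm x)\<^sup>2) * (S * (norm y)\<^sup>2)"
    by (intro mult_mono nrm_le nrm_nonneg) (simp add: S_nonneg)
  also have "\<dots> = (S * norm x * norm y)\<^sup>2" by (simp add: power2_eq_square)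
  finally show "(cmod (inn x y))\<^sup>2 \<le> (S * norm x * norm y)\<^sup>2" .
qed (simp add: S_nonneg)

lemma nrm_diff_scale:
  "nrm (x - t *\<^sub>C v) = nrm x - 2 * Re (cnj t * inn v x) + (cmod t)\<^sup>2 * nrm v"
proof -
  have "(cmod (\<phi> j (x - t *\<^sub>C v)))\<^sup>2
      = (cmod (\<phi> j x))\<^sup>2 - 2 * Re (cnj t * (cnj (\<phi> j v) * \<phi> j x)) + (cmod t)\<^sup>2 * (cmod (\<phi> j v))\<^sup>2" for j
    by (simp only: cmod_power2 \<phi>_diff \<phi>_scale) (simp add: power2_eq_square algebra_simps)
  moreover have "(\<lambda>j. (cmod (\<phi> j x))\<^sup>2 - 2 * Re (cnj t * (cnj (\<phi> j v) * \<phi> j x)) + (cmod t)\<^sup>2 * (cmod (\<phi> j v))\<^sup>2)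
      sums (nrm x - 2 * Re (cnj t * inn v x) + (cmod t)\<^sup>2 * nrm v)"
    unfolding nrm_def inn_def
    by (intro sums_add sums_diff sums_mult sums_Re summable_sums[OF summable_\<phi>_sq] summable_sums[OF summable_inn])
  ultimately show ?thesis unfolding nrm_def by (simp add: sums_iff)
qed

lemma vectors_D: "f \<in> vectors \<Longrightarrow> square_summable (\<lambda>k. norm (f k))"
  by (simp add: vectors_def)

lemma dominated_mat: "dominated (\<lambda>j. norm (\<phi> j)) (\<lambda>k. norm (f k)) (mat f)"
  by (simp add: dominated_def mat_def \<phi>_le)

lemma mat_column: "(\<Sum>i<N. (cmod (mat f i j))\<^sup>2) \<le> nrm (f j)"
  unfolding nrm_def mat_def by (intro sum_le_suminf summable_\<phi>_sq) auto

lemma summable_nrm: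
  assumes "f \<in> vectors"
  shows "summable (\<lambda>k. nrm (f k))"
proof (rule summable_comparison_test'[where g = "\<lambda>k. S * (norm (f k))\<^sup>2"])
  show "summable (\<lambda>k. S * (norm (f k))\<^sup>2)"
    using assms by (intro summable_mult) (simp add: vectors_def square_summable_def)
qed (simp add: nrm_nonneg nrm_le)

lemma summable_norm_nuc:
  assumes "f \<in> vectors"
  shows "summable (\<lambda>k. norm (\<phi> k) * norm (f k))"
  by (rule square_summable_product[OF square_summable_\<phi> vectors_D[OF assms]])

lemma norm_nuc_term: "norm (\<phi> k x *\<^sub>C f k) \<le> norm (\<phi> k) * norm (f k) * norm x"
  using mult_right_mono[OF \<phi>_le[of k x] norm_ge_zero[of "f k"]] by (simp add: norm_scaleC mult_ac)

lemma nuc_sums: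
  assumes "f \<in> vectors"
  shows "(\<lambda>k. \<phi> k x *\<^sub>C f k) sums nuc f x"
proof -
  have "summable (\<lambda>k. \<phi> k x *\<^sub>C f k)"
    by (rule summable_comparison_test'[where g = "\<lambda>k. norm (\<phi> k) * norm (f k) * norm x"])
       (auto intro: summable_mult2 summable_norm_nuc[OF assms] norm_nuc_term)
  then show ?thesis unfolding nuc_def by (rule summable_sums)
qed

lemma clinear_nuc:
  assumes "f \<in> vectors"
  shows "clinear (nuc f)"
proof (rule clinearI)
  fix x y c
  show "nuc f (x + y) = nuc f x + nuc f y"
    by (rule sums_unique2[OF nuc_sums[OF assms]])
       (use sums_add[OF nuc_sums[OF assms, of x] nuc_sums[OF assms, of y]]
         in \<open>simp add: \<phi>_add scaleC_add_left\<close>)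
  show "nuc f (c *\<^sub>C x) = c *\<^sub>C nuc f x"
    by (rule sums_unique2[OF nuc_sums[OF assms]])
       (use bounded_linear.sums[OF bounded_linear_scaleC nuc_sums[OF assms, of x], of c]
         in \<open>simp add: \<phi>_scale scaleC_scaleC\<close>)
qed

lemma bounded_linear_nuc:
  assumes "f \<in> vectors"
  shows "bounded_linear (nuc f)"
proof (rule bounded_linear_intro)
  fix x y r
  show "nuc f (x + y) = nuc f x + nuc f y" by (rule clinear_add[OF clinear_nuc[OF assms]])
  show "nuc f (r *\<^sub>R x) = r *\<^sub>R nuc f x"
    by (simp add: scaleR_eq_scaleC clinear_scale[OF clinear_nuc[OF assms]])
  show "norm (nuc f x) \<le> norm x * (\<Sum>k. norm (\<phi> k) * norm (f k))"
  proof -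
    have "norm (nuc f x) \<le> (\<Sum>k. norm (\<phi> k) * norm (f k) * norm x)"
      unfolding nuc_def
      by (rule norm_suminf_le[OF norm_nuc_term]) (intro summable_mult2 summable_norm_nuc assms)
    also have "\<dots> = (\<Sum>k. norm (\<phi> k) * norm (f k)) * norm x"
      by (rule suminf_mult2[symmetric, OF summable_norm_nuc[OF assms]])
    finally show ?thesis by (simp add: mult.commute)
  qed
qed

lemma \<phi>_nuc_sums:
  assumes "f \<in> vectors"
  shows "(\<lambda>k. mat f j k * \<phi> k x) sums \<phi> j (nuc f x)"
  using bounded_linear.sums[OF blinfun.bounded_linear_right nuc_sums[OF assms], of "\<phi> j" x]
  by (simp add: \<phi>_scale mat_def mult.commute)

end

context functional_sequence
begin

section \<open>Orthogonal deflation of the vectors\<close>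

definition coord :: "'a \<Rightarrow> 'a \<Rightarrow> complex" where
  "coord v x = inn v x / of_real (nrm v)"

definition defl :: "'a \<Rightarrow> (nat \<Rightarrow> 'a) \<Rightarrow> nat \<Rightarrow> 'a" where
  "defl v f k = f k - coord v (f k) *\<^sub>C v"

definition admissible :: "(nat \<Rightarrow> 'a) \<Rightarrow> bool" where
  "admissible f \<longleftrightarrow> f \<in> vectors \<and> seq_compact_map (nuc f)"

lemma coord_add: "coord v (x + y) = coord v x + coord v y"
  by (simp add: coord_def inn_add add_divide_distrib)

lemma coord_scale: "coord v (c *\<^sub>C x) = c * coord v x"
  by (simp add: coord_def inn_scale)

lemma coord_le: "cmod (coord v x) \<le> norm x * (S * norm v / nrm v)"
  using divide_right_mono[OF inn_le[of v x] nrm_nonneg[of v]] nrm_nonneg[of v]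
  by (simp add: coord_def norm_divide mult_ac)

lemma bounded_linear_scaleC_left: "bounded_linear (\<lambda>c. c *\<^sub>C (v :: 'a))"
  by (rule bounded_linear_intro[where K = "norm v"])
     (simp_all add: scaleC_add_left norm_scaleC scaleR_eq_scaleC scaleC_scaleC scaleC_complex_def)

lemma bounded_linear_coord: "bounded_linear (coord v)"
  by (rule bounded_linear_intro[OF coord_add _ coord_le])
     (simp add: scaleR_eq_scaleC coord_scale scaleC_complex_def)

lemma defl_vectors:
  assumes "f \<in> vectors"
  shows "defl v f \<in> vectors"
proof -
  let ?c = "1 + S * norm v / nrm v * norm v"
  have c: "?c \<ge> 0" by (simp add: S_nonneg nrm_nonneg)
  have "norm (defl v f k) \<le> ?c * norm (f k)" for k
  proof -
    have "norm (defl v f k) \<le> norm (f k) + cmod (coord v (f k)) * norm v"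
      unfolding defl_def by (rule order_trans[OF norm_triangle_ineq4]) (simp add: norm_scaleC)
    also have "\<dots> \<le> norm (f k) + norm (f k) * (S * norm v / nrm v) * norm v"
      by (intro add_left_mono mult_right_mono coord_le) simp
    finally show ?thesis by (simp add: algebra_simps)
  qed
  then show ?thesis
    using square_summable_mono[OF square_summable_scale[OF vectors_D[OF assms] c]]
    by (simp add: vectors_def)
qed

context
  fixes f v lam
  assumes f: "f \<in> vectors" and v: "v \<noteq> 0" and fv: "nuc f v = lam *\<^sub>C v" and lam: "lam \<noteq> 0"
begin

text \<open>The seminorm vanishes only where all functionals do, and there \<open>nuc f\<close> is
  zero; an eigenvector for a nonzero eigenvalue therefore has positive seminorm, and orthogonal
  projection along it is possible.\<close>

lemma nrm_eigenvector: "nrm v > 0"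
proof -
  have "nrm v \<noteq> 0"
  proof
    assume "nrm v = 0"
    then have "\<phi> k v = 0" for k
      using suminf_eq_zero_iff[OF summable_\<phi>_sq, of v] by (simp add: nrm_def)
    then have "nuc f v = 0" by (simp add: nuc_def)
    then show False using fv v lam by (simp add: complex_vector.scale_eq_0_iff)
  qed
  then show ?thesis using nrm_nonneg[of v] by simp
qed

lemma coord_eigenvector: "coord v v = 1"
  using nrm_eigenvector by (simp add: coord_def inn_self)

lemma deflation_nuc: "deflation (nuc f) v lam (coord v)"
  by unfold_locales
     (auto simp: fv coord_add coord_scale coord_eigenvector clinear_add[OF clinear_nuc[OF f]]
       clinear_scale[OF clinear_nuc[OF f]])

interpretation deflation "nuc f" v lam "coord v" by (rule deflation_nuc)

lemma nuc_defl: "nuc (defl v f) = deflated"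
proof
  fix x
  have "(\<lambda>k. coord v (\<phi> k x *\<^sub>C f k)) sums coord v (nuc f x)"
    by (rule bounded_linear.sums[OF bounded_linear_coord nuc_sums[OF f]])
  then have "(\<lambda>k. coord v (\<phi> k x *\<^sub>C f k) *\<^sub>C v) sums (coord v (nuc f x) *\<^sub>C v)"
    by (rule bounded_linear.sums[OF bounded_linear_scaleC_left])
  from sums_diff[OF nuc_sums[OF f] this]
  have "(\<lambda>k. \<phi> k x *\<^sub>C defl v f k) sums deflated x"
    by (simp add: deflated_def defl_def coord_scale complex_vector.scale_right_diff_distrib scaleC_scaleC)
  then show "nuc (defl v f) x = deflated x" by (simp add: nuc_def sums_iff)
qed

lemma nrm_defl: "nrm (defl v f k) = nrm (f k) - nrm v * (cmod (coord v (f k)))\<^sup>2"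
proof -
  let ?t = "coord v (f k)"
  have "inn v (f k) = of_real (nrm v) * ?t" using nrm_eigenvector by (simp add: coord_def)
  then have "cnj ?t * inn v (f k) = of_real (nrm v * (cmod ?t)\<^sup>2)"
    by (simp add: complex_norm_square mult_ac del: of_real_power)
  then show ?thesis unfolding defl_def nrm_diff_scale by simp
qed

lemma nrm_defl_le: "nrm (defl v f k) \<le> nrm (f k)"
  by (simp add: nrm_defl nrm_nonneg)

lemma square_summable_coord: "square_summable (\<lambda>k. cmod (coord v (f k)))"
proof (rule square_summable_mono[OF square_summable_scale[OF vectors_D[OF f], of "S * norm v / nrm v"]])
  show "cmod (coord v (f k)) \<le> S * norm v / nrm v * norm (f k)" for k
    by (subst mult.commute) (rule coord_le)
qed (auto simp: S_nonneg nrm_nonneg)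

lemma coord_sums: "(\<lambda>k. coord v (f k) * \<phi> k v) sums lam"
  using bounded_linear.sums[OF bounded_linear_coord[of v] nuc_sums[OF f, of v]]
  by (simp add: coord_scale fv coord_eigenvector mult.commute)

text \<open>By Pythagoras the loss is the squared Hilbert-Schmidt norm of the rank-one matrix that
  is split off. Its trace is \<open>lam\<close>, so Cauchy-Schwarz bounds the loss from
  below.\<close>

lemma hs_defl: "hs (defl v f) + (cmod lam)\<^sup>2 \<le> hs f"
proof -
  have sm: "summable (\<lambda>k. (cmod (coord v (f k)))\<^sup>2)"
    using square_summable_coord by (simp add: square_summable_def)
  have "(cmod lam)\<^sup>2 \<le> (\<Sum>k. (cmod (coord v (f k)))\<^sup>2) * nrm v"
    unfolding nrm_def by (rule series_cauchy_schwarz[OF square_summable_coord square_summable_\<phi>_apply coord_sums])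
  moreover have "hs (defl v f) = hs f - nrm v * (\<Sum>k. (cmod (coord v (f k)))\<^sup>2)"
    unfolding hs_def nrm_defl
    by (simp add: suminf_diff[OF summable_nrm[OF f] summable_mult[OF sm], symmetric] suminf_mult[OF sm])
  ultimately show ?thesis by (simp add: mult.commute)
qed

text \<open>Both special hypotheses of \<open>D2_deflation\<close> come from the eigenvector
  equation: the deflated map annihilates \<open>v\<close>, and applying \<open>coord v\<close> to
  the equation yields the trace \<open>lam\<close>.\<close>

lemma D2_defl:
  "D2 (\<lambda>i j. w * mat f i j) = (1 - w * lam) * exp (w * lam) * D2 (\<lambda>i j. w * mat (defl v f) i j)"
proof (rule D2_deflation[OF square_summable_\<phi> vectors_D[OF f] vectors_D[OF defl_vectors[OF f, of v]]
      dominated_mat dominated_mat])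
  show "mat (defl v f) i j = mat f i j - \<phi> i v * coord v (f j)" for i j
    by (simp add: mat_def defl_def \<phi>_diff \<phi>_scale mult.commute)
  have "nuc (defl v f) v = 0"
    by (simp add: nuc_defl deflated_def fv coord_scale coord_eigenvector)
  then show "(\<lambda>k. mat (defl v f) i k * \<phi> k v) sums 0" for i
    using \<phi>_nuc_sums[OF defl_vectors[OF f], of v i v] by (simp add: blinfun.zero_right)
qed (rule square_summable_\<phi>_apply square_summable_coord coord_sums)+

lemma seq_compact_defl:
  assumes "seq_compact_map (nuc f)"
  shows "seq_compact_map (nuc (defl v f))"
  unfolding seq_compact_map_def
proof (intro allI impI)
  fix y :: "nat \<Rightarrow> 'a" assume "bounded (range y)"
  then obtain r l where r: "strict_mono r" "(\<lambda>n. nuc f (y (r n))) \<longlonglongrightarrow> l"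
    using assms unfolding seq_compact_map_def by blast
  have "(\<lambda>n. nuc f (y (r n)) - coord v (nuc f (y (r n))) *\<^sub>C v) \<longlonglongrightarrow> l - coord v l *\<^sub>C v"
    by (intro tendsto_diff r bounded_linear.tendsto[OF bounded_linear_scaleC_left] bounded_linear.tendsto[OF bounded_linear_coord])
  then have "(\<lambda>n. nuc (defl v f) (y (r n))) \<longlonglongrightarrow> l - coord v l *\<^sub>C v"
    by (simp add: nuc_defl deflated_def)
  with r(1) show "\<exists>r l. strict_mono r \<and> (\<lambda>n. nuc (defl v f) (y (r n))) \<longlonglongrightarrow> l" by blast
qed

end

lemma deflation_step:
  assumes f: "admissible f" and ev: "eigenval (nuc f) lam" and lam: "lam \<noteq> 0"
  obtains f' where "admissible f'" "hs f' + (cmod lam)\<^sup>2 \<le> hs f" "\<forall>k. nrm (f' k) \<le> nrm (f k)"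
    "\<forall>w. D2 (\<lambda>i j. w * mat f i j) = (1 - w * lam) * exp (w * lam) * D2 (\<lambda>i j. w * mat f' i j)"
    "\<forall>n. has_mult (nuc f') lam n \<longrightarrow> has_mult (nuc f) lam (Suc n)"
    "\<forall>\<mu> n. has_mult (nuc f) \<mu> n \<longrightarrow> \<mu> \<noteq> 0 \<longrightarrow> \<mu> \<noteq> lam \<longrightarrow> has_mult (nuc f') \<mu> n"
    "\<forall>\<mu>. eigenval (nuc f) \<mu> \<longrightarrow> \<mu> \<noteq> lam \<longrightarrow> eigenval (nuc f') \<mu>"
proof -
  obtain v where v: "v \<noteq> 0" "nuc f v = lam *\<^sub>C v" using ev by (auto simp: eigenval_def)
  have fv: "f \<in> vectors" and cf: "seq_compact_map (nuc f)" using f by (auto simp: admissible_def)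
  interpret deflation "nuc f" v lam "coord v" by (rule deflation_nuc[OF fv v lam])
  note nd = nuc_defl[OF fv v lam]
  show ?thesis
  proof (rule that[of "defl v f"]; (intro allI impI)?)
    show "admissible (defl v f)"
      using defl_vectors[OF fv] seq_compact_defl[OF fv v lam cf] by (simp add: admissible_def)
    show "hs (defl v f) + (cmod lam)\<^sup>2 \<le> hs f" by (rule hs_defl[OF fv v lam])
    show "nrm (defl v f k) \<le> nrm (f k)" for k by (rule nrm_defl_le[OF fv v lam])
    show "D2 (\<lambda>i j. w * mat f i j) = (1 - w * lam) * exp (w * lam) * D2 (\<lambda>i j. w * mat (defl v f) i j)" for w
      by (rule D2_defl[OF fv v lam])
    show "has_mult (nuc f) lam (Suc n)" if "has_mult (nuc (defl v f)) lam n" for n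
      using has_mult_deflated_same that lam by (simp add: nd)
    show "has_mult (nuc (defl v f)) \<mu> n" if "has_mult (nuc f) \<mu> n" "\<mu> \<noteq> 0" "\<mu> \<noteq> lam" for \<mu> n
      using has_mult_deflated_other that by (simp add: nd)
    show "eigenval (nuc (defl v f)) \<mu>" if "eigenval (nuc f) \<mu>" "\<mu> \<noteq> lam" for \<mu>
      using eigenval_deflated_other that by (simp add: nd)
  qed
qed

section \<open>Finite multiplicities and countably many eigenvalues\<close>

lemma hs_nonneg:
  assumes "admissible f"
  shows "hs f \<ge> 0"
  unfolding hs_def using assms
  by (intro suminf_nonneg summable_nrm nrm_nonneg) (simp add: admissible_def)

lemma admissible_clinear: "admissible f \<Longrightarrow> clinear (nuc f)"
  by (simp add: admissible_def clinear_nuc)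

text \<open>Every deflation at \<open>\<mu>\<close> consumes a fixed positive amount of the
  nonnegative quantity \<open>hs\<close>, so after finitely many steps \<open>\<mu>\<close> is no
  longer an eigenvalue. Going back, each step adds one dimension.\<close>

lemma finite_multiplicity:
  assumes "admissible f" "\<mu> \<noteq> 0"
  shows "\<exists>n. has_mult (nuc f) \<mu> n"
proof -
  have "hs f < real m * (cmod \<mu>)\<^sup>2 \<Longrightarrow> admissible f \<Longrightarrow> \<exists>n. has_mult (nuc f) \<mu> n" for m f
  proof (induction m arbitrary: f)
    case 0
    then show ?case using hs_nonneg[of f] by simp
  next
    case (Suc m)
    show ?case
    proof (cases "eigenval (nuc f) \<mu>")
      case True
      then obtain f' where f': "admissible f'" "hs f' + (cmod \<mu>)\<^sup>2 \<le> hs f"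
        "\<And>n. has_mult (nuc f') \<mu> n \<Longrightarrow> has_mult (nuc f) \<mu> (Suc n)"
        using deflation_step[OF Suc.prems(2) True assms(2)] by metis
      have "hs f' < real m * (cmod \<mu>)\<^sup>2" using f'(2) Suc.prems(1) by (simp add: algebra_simps)
      then show ?thesis using Suc.IH f' by blast
    next
      case False
      then show ?thesis using has_mult_0 admissible_clinear[OF Suc.prems(2)] by blast
    qed
  qed
  moreover obtain m where "hs f < real m * (cmod \<mu>)\<^sup>2"
    using reals_Archimedean3[of "(cmod \<mu>)\<^sup>2"] assms(2) by auto
  ultimately show ?thesis using assms by blast
qed

text \<open>A Schur inequality for distinct eigenvalues: removing one leaves the others eigenvalues
  and reduces \<open>hs\<close> by its squared modulus. It leaves only finitely many eigenvalues
  outside any disc about 0, which gives countability.\<close>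

lemma eigenvalue_sum_le_hs:
  assumes "finite Z" "admissible f" "\<And>\<mu>. \<mu> \<in> Z \<Longrightarrow> \<mu> \<noteq> 0 \<and> eigenval (nuc f) \<mu>"
  shows "(\<Sum>\<mu>\<in>Z. (cmod \<mu>)\<^sup>2) \<le> hs f"
  using assms
proof (induction Z arbitrary: f rule: finite_induct)
  case empty
  then show ?case by (simp add: hs_nonneg)
next
  case (insert lam Z)
  then obtain f' where f': "admissible f'" "hs f' + (cmod lam)\<^sup>2 \<le> hs f"
      "\<And>\<mu>. eigenval (nuc f) \<mu> \<Longrightarrow> \<mu> \<noteq> lam \<Longrightarrow> eigenval (nuc f') \<mu>"
    using deflation_step[of f lam] by (metis insertI1)
  have "(\<Sum>\<mu>\<in>Z. (cmod \<mu>)\<^sup>2) \<le> hs f'"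
    by (rule insert.IH[OF f'(1)]) (use insert f'(3) in blast)
  then show ?case using f'(2) insert by simp
qed

lemma countable_eigenvalues:
  assumes f: "admissible f"
  shows "countable {\<mu>. \<mu> \<noteq> 0 \<and> eigenval (nuc f) \<mu>}"
proof -
  define E where "E n = {\<mu>. eigenval (nuc f) \<mu> \<and> 1 / real (Suc n) \<le> cmod \<mu>}" for n
  have fin: "finite (E n)" for n
  proof (rule ccontr)
    assume inf: "infinite (E n)"
    obtain m where m: "hs f < real m * (1 / real (Suc n))\<^sup>2"
      using reals_Archimedean3[of "(1 / real (Suc n))\<^sup>2"] by auto
    obtain Z where Z: "finite Z" "card Z = m" "Z \<subseteq> E n"
      using infinite_arbitrarily_large[OF inf] by blast
    have "real m * (1 / real (Suc n))\<^sup>2 = (\<Sum>\<mu>\<in>Z. (1 / real (Suc n))\<^sup>2)" using Z by simp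
    also have "\<dots> \<le> (\<Sum>\<mu>\<in>Z. (cmod \<mu>)\<^sup>2)"
      using Z(3) by (intro sum_mono power_mono) (auto simp: E_def)
    also have "\<dots> \<le> hs f"
    proof (rule eigenvalue_sum_le_hs[OF Z(1) f])
      fix \<mu> assume "\<mu> \<in> Z"
      then have *: "eigenval (nuc f) \<mu>" "1 / real (Suc n) \<le> cmod \<mu>" using Z(3) by (auto simp: E_def)
      have "0 < 1 / real (Suc n)" by simp
      with *(2) have "0 < cmod \<mu>" by linarith
      then show "\<mu> \<noteq> 0 \<and> eigenval (nuc f) \<mu>" using *(1) by simp
    qed
    finally show False using m by simp
  qed
  have "{\<mu>. \<mu> \<noteq> 0 \<and> eigenval (nuc f) \<mu>} \<subseteq> (\<Union>n. E n)"
  proof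
    fix \<mu> assume \<mu>: "\<mu> \<in> {\<mu>. \<mu> \<noteq> 0 \<and> eigenval (nuc f) \<mu>}"
    then obtain n where "inverse (real (Suc n)) < cmod \<mu>"
      using reals_Archimedean[of "cmod \<mu>"] by auto
    then show "\<mu> \<in> (\<Union>n. E n)" using \<mu> by (auto simp: E_def inverse_eq_divide intro!: exI[of _ n])
  qed
  moreover have "countable (\<Union>n. E n)" by (auto intro: countable_finite fin)
  ultimately show ?thesis by (rule countable_subset)
qed

text \<open>If the determinant vanishes, the truncations of \<open>1 - w * mat f\<close> have unit vectors that are
  almost in their kernels. Their images in the Banach space are almost eigenvectors of \<open>nuc f\<close>, and by
  compactness a subsequence converges to an eigenvector.\<close>

lemma D2_eq_0_imp_eigenval:
  assumes f: "admissible f" and zero: "D2 (\<lambda>i j. w * mat f i j) = 0"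
  shows "w \<noteq> 0 \<and> eigenval (nuc f) (1 / w)"
proof -
  have fv: "f \<in> vectors" and cpt: "seq_compact_map (nuc f)" using f by (auto simp: admissible_def)
  have w: "w \<noteq> 0" using zero D2_zero by auto
  let ?\<alpha> = "\<lambda>j. cmod w * norm (\<phi> j)" and ?\<beta> = "\<lambda>k. norm (f k)"
  let ?A = "\<lambda>i j. w * mat f i j"
  have \<alpha>: "square_summable ?\<alpha>" by (rule square_summable_scale[OF square_summable_\<phi>]) simp
  note \<beta> = vectors_D[OF fv]
  have dom: "dominated ?\<alpha> ?\<beta> ?A" by (rule dominated_scale[OF dominated_mat]) auto
  define a where "a = dom_const ?\<alpha> ?\<beta>"
  have "\<exists>N x. N \<ge> n \<and> vnorm N x = 1 \<and> vnorm N (\<lambda>i. x i - mvec N ?A x i) < 1 / Suc n" for n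
  proof -
    let ?c = "1 / real (Suc n)"
    have "(\<lambda>N. cmod (d2 N ?A) * exp (a\<^sup>2 / (2 * ?c\<^sup>2) + a\<^sup>2 / ?c)) \<longlonglongrightarrow> cmod 0 * exp (a\<^sup>2 / (2 * ?c\<^sup>2) + a\<^sup>2 / ?c)"
      using D2_tendsto[OF \<alpha> \<beta> dom] zero by (intro tendsto_intros) simp
    then have "\<forall>\<^sub>F N in sequentially. cmod (d2 N ?A) * exp (a\<^sup>2 / (2 * ?c\<^sup>2) + a\<^sup>2 / ?c) < 1"
      by (rule order_tendstoD) simp
    then have "\<forall>\<^sub>F N in sequentially. cmod (d2 N ?A) * exp (a\<^sup>2 / (2 * ?c\<^sup>2) + a\<^sup>2 / ?c) < 1 \<and> n \<le> N"
      using eventually_ge_at_top[of n] by eventually_elim simp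
    then obtain N where N: "cmod (d2 N ?A) * exp (a\<^sup>2 / (2 * ?c\<^sup>2) + a\<^sup>2 / ?c) < 1" "n \<le> N"
      using eventually_happens'[OF sequentially_bot] by blast
    have "fro N ?A \<le> a" unfolding a_def by (rule dominated_fro[OF \<alpha> \<beta> dom])
    from almost_null_vector[OF this _ N(1)] N(2) show ?thesis by (metis of_nat_0_less_iff zero_less_Suc zero_less_divide_1_iff)
  qed
  then obtain N x where N: "\<And>n. N n \<ge> n" and x1: "\<And>n. vnorm (N n) (x n) = 1"
    and xs: "\<And>n. vnorm (N n) (\<lambda>i. x n i - mvec (N n) ?A (x n) i) < 1 / Suc n"
    by metis
  define y where "y n = (\<Sum>k<N n. x n k *\<^sub>C f k)" for n
  \<comment> \<open>The residual in coordinates: \<open>x n\<close> is nearly \<open>w\<close> times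
    the image of \<open>y n\<close> under the functionals.\<close>
  define r where "r n i = x n i - w * \<phi> i (y n)" for n i
  have phi_y: "\<phi> j (y n) = (\<Sum>k<N n. mat f j k * x n k)" for j n
    by (simp add: y_def blinfun.sum_right \<phi>_scale mat_def mult.commute)
  have r_eq: "r n = (\<lambda>i. x n i - mvec (N n) ?A (x n) i)" for n
    by (simp add: fun_eq_iff r_def mvec_def phi_y sum_distrib_left mult.assoc)
  have r_small: "vnorm (N n) (r n) < 1 / Suc n" for n using xs by (simp add: r_eq)
  define b where "b = sqrt (\<Sum>k. (norm (f k))\<^sup>2)"
  have b0: "b \<ge> 0" using \<beta> by (auto simp: b_def square_summable_def intro!: suminf_nonneg)
  have comb: "norm (\<Sum>k<m. u k *\<^sub>C f k) \<le> vnorm m u * b" for m u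
  proof -
    have "norm (\<Sum>k<m. u k *\<^sub>C f k) \<le> (\<Sum>k<m. \<bar>cmod (u k)\<bar> * \<bar>norm (f k)\<bar>)"
      by (rule order_trans[OF norm_sum]) (simp add: norm_scaleC)
    also have "\<dots> \<le> vnorm m u * L2_set (\<lambda>k. norm (f k)) {..<m}"
      unfolding vnorm_def by (rule L2_set_mult_ineq)
    also have "\<dots> \<le> vnorm m u * b"
      unfolding b_def L2_set_def
      by (intro mult_left_mono real_sqrt_le_mono square_summable_partial \<beta> vnorm_nonneg)
    finally show ?thesis .
  qed
  have y_le: "norm (y n) \<le> b" for n using comb[where m = "N n" and u = "x n"] by (simp add: y_def x1)
  \<comment> \<open>Keeps the limit from being zero: a unit vector minus a residual of norm at most
    1/2 is controlled by the norm of \<open>y n\<close>. The residual is that small from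
    \<open>n = 1\<close> on.\<close>
  have y_ge: "1 / 2 \<le> cmod w * sqrt S * norm (y n)" if "n \<ge> 1" for n
  proof -
    have "1 = vnorm (N n) (\<lambda>i. r n i + w * \<phi> i (y n))" using x1[of n] by (simp add: r_def)
    also have "\<dots> \<le> vnorm (N n) (r n) + cmod w * vnorm (N n) (\<lambda>i. \<phi> i (y n))"
      by (rule order_trans[OF vnorm_triangle]) (simp only: vnorm_scale order_refl)
    also have "vnorm (N n) (r n) \<le> 1 / 2"
      using r_small[of n] that le_less_trans[of "vnorm (N n) (r n)"]
      by (smt (verit, best) frac_le of_nat_1 of_nat_Suc of_nat_mono)
    also have "vnorm (N n) (\<lambda>i. \<phi> i (y n)) \<le> sqrt (nrm (y n))"
      unfolding vnorm_def L2_set_def nrm_def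
      by (intro real_sqrt_le_mono sum_le_suminf summable_\<phi>_sq) auto
    also have "sqrt (nrm (y n)) \<le> sqrt (S * (norm (y n))\<^sup>2)"
      by (rule real_sqrt_le_mono[OF nrm_le])
    also have "\<dots> = sqrt S * norm (y n)" by (simp add: real_sqrt_mult)
    finally show ?thesis by (simp add: mult_left_mono mult.assoc)
  qed
  define \<tau> where "\<tau> m = (\<Sum>k. norm (\<phi> (k + m)) * norm (f (k + m)))" for m
  have \<tau>0: "\<tau> \<longlonglongrightarrow> 0"
    unfolding \<tau>_def by (rule suminf_exist_split2[OF summable_norm_nuc[OF fv]])
  \<comment> \<open>Two sources of error: below \<open>N n\<close> the coefficients of
    \<open>nuc f (y n)\<close> are those of \<open>y n\<close> divided by \<open>w\<close>, up to
    the residual; beyond \<open>N n\<close> the tail of the nuclear series remains.\<close>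
  have err: "norm (nuc f (y n) - (1 / w) *\<^sub>C y n) \<le> cmod (1 / w) * (1 / Suc n) * b + \<tau> (N n) * b" for n
  proof -
    let ?t = "\<lambda>k. \<phi> k (y n) *\<^sub>C f k"
    have "nuc f (y n) = (\<Sum>k. ?t (k + N n)) + (\<Sum>k<N n. ?t k)"
      unfolding nuc_def by (rule suminf_split_initial_segment[OF sums_summable[OF nuc_sums[OF fv]]])
    moreover have "(\<Sum>k<N n. ?t k) - (1 / w) *\<^sub>C y n = (- (1 / w)) *\<^sub>C (\<Sum>k<N n. r n k *\<^sub>C f k)"
    proof -
      have "?t k - (1 / w) *\<^sub>C (x n k *\<^sub>C f k) = (- (1 / w)) *\<^sub>C (r n k *\<^sub>C f k)" for k
      proof -
        have "?t k - (1 / w) *\<^sub>C (x n k *\<^sub>C f k) = (\<phi> k (y n) - (1 / w) * x n k) *\<^sub>C f k"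
          by (simp only: scaleC_scaleC complex_vector.scale_left_diff_distrib)
        also have "\<phi> k (y n) - (1 / w) * x n k = - (1 / w) * r n k"
          using w by (simp add: r_def field_simps)
        finally show ?thesis by (simp only: scaleC_scaleC)
      qed
      then show ?thesis
        by (simp only: y_def complex_vector.scale_sum_right sum_subtractf[symmetric])
    qed
    ultimately have split: "nuc f (y n) - (1 / w) *\<^sub>C y n
        = (- (1 / w)) *\<^sub>C (\<Sum>k<N n. r n k *\<^sub>C f k) + (\<Sum>k. ?t (k + N n))"
      by (simp add: algebra_simps)
    have n1: "norm ((- (1 / w)) *\<^sub>C (\<Sum>k<N n. r n k *\<^sub>C f k)) \<le> cmod (1 / w) * (1 / Suc n) * b"
    proof -
      have "norm (\<Sum>k<N n. r n k *\<^sub>C f k) \<le> 1 / Suc n * b"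
        by (rule order_trans[OF comb]) (intro mult_right_mono b0 less_imp_le r_small)
      then have "cmod (1 / w) * norm (\<Sum>k<N n. r n k *\<^sub>C f k) \<le> cmod (1 / w) * (1 / Suc n * b)"
        by (rule mult_left_mono) simp
      then show ?thesis by (simp add: norm_scaleC mult.assoc)
    qed
    have n2: "norm (\<Sum>k. ?t (k + N n)) \<le> \<tau> (N n) * b"
    proof -
      have sm: "summable (\<lambda>k. norm (\<phi> (k + N n)) * norm (f (k + N n)))"
        by (rule summable_ignore_initial_segment[OF summable_norm_nuc[OF fv]])
      have "norm (\<Sum>k. ?t (k + N n)) \<le> (\<Sum>k. norm (\<phi> (k + N n)) * norm (f (k + N n)) * norm (y n))"
        by (rule norm_suminf_le[OF norm_nuc_term]) (rule summable_mult2[OF sm])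
      also have "\<dots> = \<tau> (N n) * norm (y n)"
        unfolding \<tau>_def by (rule suminf_mult2[symmetric, OF sm])
      also have "\<dots> \<le> \<tau> (N n) * b"
        using sm by (intro mult_left_mono y_le) (auto simp: \<tau>_def intro!: suminf_nonneg)
      finally show ?thesis .
    qed
    show ?thesis unfolding split by (rule norm_triangle_mono[OF n1 n2])
  qed
  have "filterlim N at_top sequentially"
    by (rule filterlim_at_top_mono[OF filterlim_ident]) (simp add: N)
  then have \<tau>N: "(\<lambda>n. \<tau> (N n)) \<longlonglongrightarrow> 0" by (rule filterlim_compose[OF \<tau>0])
  have err0: "(\<lambda>n. nuc f (y n) - (1 / w) *\<^sub>C y n) \<longlonglongrightarrow> 0"
  proof (rule Lim_null_comparison[OF always_eventually])
    show "\<forall>n. norm (nuc f (y n) - (1 / w) *\<^sub>C y n) \<le> cmod (1 / w) * (1 / Suc n) * b + \<tau> (N n) * b"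
      using err by blast
    have "(\<lambda>n. cmod (1 / w) * (1 / Suc n) * b + \<tau> (N n) * b) \<longlonglongrightarrow> cmod (1 / w) * 0 * b + 0 * b"
      by (intro tendsto_intros \<tau>N LIMSEQ_Suc lim_1_over_n)
    then show "(\<lambda>n. cmod (1 / w) * (1 / Suc n) * b + \<tau> (N n) * b) \<longlonglongrightarrow> 0" by simp
  qed
  have "bounded (range y)" using y_le by (auto simp: bounded_iff)
  then obtain \<rho> l where \<rho>: "strict_mono \<rho>" "(\<lambda>n. nuc f (y (\<rho> n))) \<longlonglongrightarrow> l"
    using cpt unfolding seq_compact_map_def by blast
  have "(\<lambda>n. nuc f (y (\<rho> n)) - (1 / w) *\<^sub>C y (\<rho> n)) \<longlonglongrightarrow> 0"
    using LIMSEQ_subseq_LIMSEQ[OF err0 \<rho>(1)] by (simp add: o_def)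
  from tendsto_diff[OF \<rho>(2) this]
  have lim1: "(\<lambda>n. (1 / w) *\<^sub>C y (\<rho> n)) \<longlonglongrightarrow> l" by simp
  from bounded_linear.tendsto[OF bounded_linear_scaleC this, of w]
  have y_lim: "(\<lambda>n. y (\<rho> n)) \<longlonglongrightarrow> w *\<^sub>C l" using w by (simp add: scaleC_scaleC scaleC_one)
  have "(\<lambda>n. nuc f (y (\<rho> n))) \<longlonglongrightarrow> nuc f (w *\<^sub>C l)"
    by (rule bounded_linear.tendsto[OF bounded_linear_nuc[OF fv] y_lim])
  then have "nuc f (w *\<^sub>C l) = l" using \<rho>(2) LIMSEQ_unique by blast
  then have "nuc f (w *\<^sub>C l) = (1 / w) *\<^sub>C (w *\<^sub>C l)" using w by (simp add: scaleC_scaleC scaleC_one)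
  moreover have "w *\<^sub>C l \<noteq> 0"
  proof
    assume wl: "w *\<^sub>C l = 0"
    have "(\<lambda>n. cmod w * sqrt S * norm (y (\<rho> n))) \<longlonglongrightarrow> cmod w * sqrt S * norm (0::'a)"
      by (intro tendsto_intros y_lim[unfolded wl])
    moreover have "1 / 2 \<le> cmod w * sqrt S * norm (y (\<rho> n))" if "n \<ge> 1" for n
      using y_ge[of "\<rho> n"] seq_suble[OF \<rho>(1), of n] that by simp
    ultimately have "1 / 2 \<le> cmod w * sqrt S * norm (0::'a)"
      by (intro LIMSEQ_le_const) blast+
    then show False by simp
  qed
  ultimately show ?thesis using w unfolding eigenval_def by blast
qed

end

section \<open>The nuclear determinant as a regularized determinant\<close>

text \<open>Each value is split into as many labelled copies as its multiplicity, and the countable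
  set of copies is coded by natural numbers. Indices that code nothing receive the value 0, which
  lies outside \<open>E\<close>.\<close>

lemma exists_enumeration:
  fixes E :: "complex set" and m :: "complex \<Rightarrow> nat"
  assumes "countable E" "0 \<notin> E" and pos: "\<And>\<mu>. \<mu> \<in> E \<Longrightarrow> m \<mu> > 0"
  obtains l :: "nat \<Rightarrow> complex" where "range l - {0} = E"
    "\<forall>\<mu>\<in>E. finite {n. l n = \<mu>} \<and> card {n. l n = \<mu>} = m \<mu>"
proof -
  define P where "P = Sigma E (\<lambda>\<mu>. {..<m \<mu>})"
  have P: "countable P" unfolding P_def using assms(1) by (intro countable_SIGMA) auto
  define l where "l n = (if n \<in> to_nat_on P ` P then fst (from_nat_into P n) else 0)" for n
  have inj: "inj_on (to_nat_on P) P" by (rule inj_on_to_nat_on[OF P])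
  have l_eq: "l (to_nat_on P p) = fst p" if "p \<in> P" for p
    using that P by (simp add: l_def)
  have set: "{n. l n = \<mu>} = to_nat_on P ` ({\<mu>} \<times> {..<m \<mu>})" if "\<mu> \<in> E" for \<mu>
  proof
    show "to_nat_on P ` ({\<mu>} \<times> {..<m \<mu>}) \<subseteq> {n. l n = \<mu>}"
      using l_eq that by (auto simp: P_def)
    show "{n. l n = \<mu>} \<subseteq> to_nat_on P ` ({\<mu>} \<times> {..<m \<mu>})"
    proof
      fix n assume n: "n \<in> {n. l n = \<mu>}"
      have "\<mu> \<noteq> 0" using that assms(2) by auto
      then have "n \<in> to_nat_on P ` P" using n by (auto simp: l_def split: if_splits)
      then obtain p where "p \<in> P" "n = to_nat_on P p" by blast
      then show "n \<in> to_nat_on P ` ({\<mu>} \<times> {..<m \<mu>})" using l_eq n by (force simp: P_def)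
    qed
  qed
  show ?thesis
  proof (rule that; (intro ballI)?)
    show "finite {n. l n = \<mu>} \<and> card {n. l n = \<mu>} = m \<mu>" if "\<mu> \<in> E" for \<mu>
    proof -
      have "inj_on (to_nat_on P) ({\<mu>} \<times> {..<m \<mu>})"
        by (rule inj_on_subset[OF inj]) (use that in \<open>auto simp: P_def\<close>)
      then show ?thesis by (simp add: set[OF that] card_image card_cartesian_product)
    qed
    show "range l - {0} = E"
    proof
      show "range l - {0} \<subseteq> E"
      proof
        fix \<mu> assume "\<mu> \<in> range l - {0}"
        then obtain n where n: "\<mu> = l n" "l n \<noteq> 0" by auto
        then obtain p where "p \<in> P" "n = to_nat_on P p" by (auto simp: l_def split: if_splits)
        then show "\<mu> \<in> E" using n l_eq by (auto simp: P_def)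
      qed
      show "E \<subseteq> range l - {0}"
      proof
        fix \<mu> assume \<mu>: "\<mu> \<in> E"
        then have "(\<mu>, 0) \<in> P" using pos by (simp add: P_def)
        then have "l (to_nat_on P (\<mu>, 0)) = \<mu>" using l_eq by simp
        then show "\<mu> \<in> range l - {0}" using \<mu> assms(2) by (metis Diff_iff rangeI singletonD)
      qed
    qed
  qed
qed

text \<open>The linear terms of \<open>1 - z\<close> and \<open>exp z\<close> cancel. With
  \<open>r\<close> the second order remainder of the exponential, the constant is 2 times 3 from
  \<open>(1 - z) * r\<close> plus 1 from the square of \<open>z\<close>.\<close>

lemma elementary_factor_bound:
  assumes "cmod z \<le> 1"
  shows "cmod ((1 - z) * exp z - 1) \<le> 7 * (cmod z)\<^sup>2"
proof -
  define r where "r = exp z - (1 + z)"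
  have "cmod (exp z - (\<Sum>k\<le>1. z ^ k / fact k)) \<le> exp \<bar>Re z\<bar> * (cmod z) ^ Suc 1 / fact 1"
    by (rule Taylor_exp)
  moreover have "exp \<bar>Re z\<bar> \<le> 3"
  proof -
    have "exp \<bar>Re z\<bar> \<le> exp (1::real)" using abs_Re_le_cmod[of z] assms by simp
    then show ?thesis using exp_le by linarith
  qed
  then have "exp \<bar>Re z\<bar> * (cmod z)\<^sup>2 \<le> 3 * (cmod z)\<^sup>2" by (rule mult_right_mono) simp
  ultimately have r: "cmod r \<le> 3 * (cmod z)\<^sup>2" by (simp add: r_def power2_eq_square)
  have "cmod (1 - z) \<le> 2" using norm_triangle_ineq4[of 1 z] assms by simp
  then have "cmod ((1 - z) * r) \<le> 2 * (3 * (cmod z)\<^sup>2)"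
    unfolding norm_mult using r by (intro mult_mono) auto
  moreover have "(1 - z) * exp z - 1 = (1 - z) * r - z\<^sup>2"
    by (simp add: r_def power2_eq_square algebra_simps)
  ultimately show ?thesis
    using norm_triangle_ineq4[of "(1 - z) * r" "z\<^sup>2"] by (simp add: norm_power)
qed

section \<open>Exhausting an enumeration of the eigenvalues\<close>

context functional_sequence
begin

text \<open>The invariant that carries the induction is the last clause: after \<open>N\<close>
  steps the multiplicities left are counted by the occurrences from index \<open>N\<close> on. It
  guarantees that the next nonzero entry is still an eigenvalue, whatever the order of the
  enumeration.\<close>

lemma deflation_sequence:
  fixes l :: "nat \<Rightarrow> complex" and N :: nat
  assumes f: "admissible f"
    and l: "\<And>\<mu>. \<mu> \<noteq> 0 \<Longrightarrow> finite {n. l n = \<mu>} \<and> has_mult (nuc f) \<mu> (card {n. l n = \<mu>})"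
  shows "\<exists>g. admissible g \<and> hs g + (\<Sum>n<N. (cmod (l n))\<^sup>2) \<le> hs f \<and> (\<forall>k. nrm (g k) \<le> nrm (f k)) \<and>
    D2 (mat f) = (\<Prod>n<N. (1 - l n) * exp (l n)) * D2 (mat g) \<and>
    (\<forall>\<mu>. \<mu> \<noteq> 0 \<longrightarrow> has_mult (nuc g) \<mu> (card {n. N \<le> n \<and> l n = \<mu>}))"
proof (induction N)
  case 0
  then show ?case using f l by (intro exI[of _ f]) auto
next
  case (Suc N)
  then obtain g where g: "admissible g" "hs g + (\<Sum>n<N. (cmod (l n))\<^sup>2) \<le> hs f"
    "\<And>k. nrm (g k) \<le> nrm (f k)" "D2 (mat f) = (\<Prod>n<N. (1 - l n) * exp (l n)) * D2 (mat g)"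
    and gm: "\<And>\<mu>. \<mu> \<noteq> 0 \<Longrightarrow> has_mult (nuc g) \<mu> (card {n. N \<le> n \<and> l n = \<mu>})"
    by blast
  have other: "{n. Suc N \<le> n \<and> l n = \<mu>} = {n. N \<le> n \<and> l n = \<mu>}" if "\<mu> \<noteq> l N" for \<mu>
    using that by (auto simp: Suc_le_eq order_le_less)
  show ?case
  proof (cases "l N = 0")
    \<comment> \<open>A zero entry contributes the factor 1 and no deflation takes place.\<close>
    case True
    then show ?thesis using g gm other by (intro exI[of _ g]) auto
  next
    case False
    have split: "{n. N \<le> n \<and> l n = l N} = insert N {n. Suc N \<le> n \<and> l n = l N}"
      by (auto simp: Suc_le_eq order_le_less)
    have "finite {n. Suc N \<le> n \<and> l n = l N}"
      by (rule finite_subset[of _ "{n. l n = l N}"]) (use l[OF False] in auto)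
    then have card: "card {n. N \<le> n \<and> l n = l N} = Suc (card {n. Suc N \<le> n \<and> l n = l N})"
      unfolding split by simp
    \<comment> \<open>The index \<open>N\<close> itself is counted, so the remaining multiplicity of
      \<open>l N\<close> is positive.\<close>
    have ev: "eigenval (nuc g) (l N)"
      using has_mult_0_iff[OF admissible_clinear[OF g(1)] gm[OF False]] card by simp
    obtain h where h: "admissible h" "hs h + (cmod (l N))\<^sup>2 \<le> hs g" "\<forall>k. nrm (h k) \<le> nrm (g k)"
      "\<forall>w. D2 (\<lambda>i j. w * mat g i j) = (1 - w * l N) * exp (w * l N) * D2 (\<lambda>i j. w * mat h i j)"
      "\<forall>n. has_mult (nuc h) (l N) n \<longrightarrow> has_mult (nuc g) (l N) (Suc n)"
      "\<forall>\<mu> n. has_mult (nuc g) \<mu> n \<longrightarrow> \<mu> \<noteq> 0 \<longrightarrow> \<mu> \<noteq> l N \<longrightarrow> has_mult (nuc h) \<mu> n"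
      by (rule deflation_step[OF g(1) ev False])
    note h = h(1,2) h(3-6)[rule_format]
    have "has_mult (nuc h) \<mu> (card {n. Suc N \<le> n \<and> l n = \<mu>})" if \<mu>: "\<mu> \<noteq> 0" for \<mu>
    proof (cases "\<mu> = l N")
      case True
      \<comment> \<open>The deflation step relates multiplicities only from \<open>h\<close> to
        \<open>g\<close>. Finiteness for \<open>h\<close> together with uniqueness for
        \<open>g\<close> inverts this relation.\<close>
      obtain m where m: "has_mult (nuc h) (l N) m" using finite_multiplicity[OF h(1) False] by blast
      have "Suc m = card {n. N \<le> n \<and> l n = l N}"
        by (rule has_mult_unique[OF h(5)[OF m] gm[OF False]])
      then show ?thesis using m True card by simp
    next
      case False
      then show ?thesis using h(6)[OF gm[OF \<mu>] \<mu>] other by simp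
    qed
    moreover have "D2 (mat f) = (\<Prod>n<Suc N. (1 - l n) * exp (l n)) * D2 (mat h)"
      using g(4) h(4)[of 1] by (simp add: mult.assoc)
    moreover have "hs h + (\<Sum>n<Suc N. (cmod (l n))\<^sup>2) \<le> hs f" using g(2) h(2) by simp
    moreover have "nrm (h k) \<le> nrm (f k)" for k using g(3) h(3) order_trans by blast
    ultimately show ?thesis using h(1) by blast
  qed
qed

lemma prodinf_eigenvalues:
  fixes l :: "nat \<Rightarrow> complex"
  assumes f: "admissible f"
    and l: "\<And>\<mu>. \<mu> \<noteq> 0 \<Longrightarrow> finite {n. l n = \<mu>} \<and> has_mult (nuc f) \<mu> (card {n. l n = \<mu>})"
  shows "(\<Prod>n. (1 - l n) * exp (l n)) = D2 (mat f)"
proof -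
  define Q where "Q N g \<longleftrightarrow> admissible g \<and> hs g + (\<Sum>n<N. (cmod (l n))\<^sup>2) \<le> hs f \<and>
    (\<forall>k. nrm (g k) \<le> nrm (f k)) \<and> D2 (mat f) = (\<Prod>n<N. (1 - l n) * exp (l n)) * D2 (mat g) \<and>
    (\<forall>\<mu>. \<mu> \<noteq> 0 \<longrightarrow> has_mult (nuc g) \<mu> (card {n. N \<le> n \<and> l n = \<mu>}))" for N g
  have "\<forall>N. \<exists>g. Q N g"
    unfolding Q_def by (intro allI deflation_sequence[OF f l])
  then obtain g where "\<And>N. Q N (g N)" by metis
  then have g: "\<And>N. admissible (g N)" "\<And>N. hs (g N) + (\<Sum>n<N. (cmod (l n))\<^sup>2) \<le> hs f"
    "\<And>N k. nrm (g N k) \<le> nrm (f k)" "\<And>N. D2 (mat f) = (\<Prod>n<N. (1 - l n) * exp (l n)) * D2 (mat (g N))"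
    "\<And>N \<mu>. \<mu> \<noteq> 0 \<Longrightarrow> has_mult (nuc (g N)) \<mu> (card {n. N \<le> n \<and> l n = \<mu>})"
    by (simp_all add: Q_def)
  have sm: "summable (\<lambda>n. (cmod (l n))\<^sup>2)"
  proof (rule summableI_nonneg_bounded[where x = "hs f"])
    show "(\<Sum>n<N. (cmod (l n))\<^sup>2) \<le> hs f" for N
      using g(2)[of N] hs_nonneg[OF g(1)[of N]] by linarith
  qed simp
  have l0: "\<forall>\<^sub>F n in sequentially. cmod (l n) < e" if "e > 0" for e
  proof -
    have "\<forall>\<^sub>F n in sequentially. (cmod (l n))\<^sup>2 < e\<^sup>2"
      by (rule order_tendstoD[OF summable_LIMSEQ_zero[OF sm]]) (use that in simp)
    then show ?thesis
      by eventually_elim (use that in \<open>simp add: power2_less_imp_less\<close>)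
  qed
  have gv: "g N \<in> vectors" for N using g(1) by (simp add: admissible_def)
  have "(\<lambda>N. D2 (mat (g N))) \<longlonglongrightarrow> 1"
  proof (rule D2_tendsto_1[OF square_summable_\<phi> vectors_D[OF gv] dominated_mat])
    show "(\<Sum>i<N. (cmod (mat (g n) i j))\<^sup>2) \<le> nrm (f j)" for n N j
      using mat_column[of "g n" j N] g(3)[of n j] by linarith
    show "summable (\<lambda>j. nrm (f j))" using f by (intro summable_nrm) (simp add: admissible_def)
    fix R :: real
    show "\<forall>\<^sub>F n in sequentially. \<forall>w. cmod w < R \<longrightarrow> D2 (\<lambda>i j. w * mat (g n) i j) \<noteq> 0"
    proof (cases "R > 0")
      case True
      then obtain M where M: "\<And>n. n \<ge> M \<Longrightarrow> cmod (l n) < 1 / R"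
        using l0[of "1 / R"] by (auto simp: eventually_sequentially)
      \<comment> \<open>A zero \<open>w\<close> would make \<open>1 / w\<close> an eigenvalue left
        after \<open>n\<close> steps, hence a value of \<open>l\<close> at some index from
        \<open>n\<close> on; such values have modulus below \<open>1 / R\<close>.\<close>
      have "D2 (\<lambda>i j. w * mat (g n) i j) \<noteq> 0" if n: "n \<ge> M" and w: "cmod w < R" for n w
      proof
        assume "D2 (\<lambda>i j. w * mat (g n) i j) = 0"
        then have ev: "w \<noteq> 0" "eigenval (nuc (g n)) (1 / w)"
          using D2_eq_0_imp_eigenval[OF g(1)] by auto
        then have "card {k. n \<le> k \<and> l k = 1 / w} \<noteq> 0"
          using has_mult_0_iff[OF admissible_clinear[OF g(1)[of n]] g(5)[of "1 / w" n]] by simp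
        then have "{k. n \<le> k \<and> l k = 1 / w} \<noteq> {}" by (metis card.empty)
        then obtain k where k: "n \<le> k" "l k = 1 / w" by blast
        then have "1 / cmod w < 1 / R" using M[of k] n by (simp add: norm_divide)
        then show False using ev(1) w True by (simp add: field_simps)
      qed
      then show ?thesis unfolding eventually_sequentially by blast
    next
      case False
      then have "\<not> cmod w < R" for w using norm_ge_zero[of w] by linarith
      then show ?thesis by simp
    qed
  qed
  then have "(\<lambda>N. D2 (mat f) / D2 (mat (g N))) \<longlonglongrightarrow> D2 (mat f) / 1"
    by (intro tendsto_intros) auto
  moreover have "\<forall>\<^sub>F N in sequentially. D2 (mat f) / D2 (mat (g N)) = (\<Prod>n<N. (1 - l n) * exp (l n))"
  proof -
    have "\<forall>\<^sub>F N in sequentially. D2 (mat (g N)) \<noteq> 0"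
      using tendsto_imp_eventually_ne[OF \<open>(\<lambda>N. D2 (mat (g N))) \<longlonglongrightarrow> 1\<close>, of 0] by simp
    then show ?thesis by eventually_elim (use g(4) in \<open>simp add: divide_eq_eq\<close>)
  qed
  ultimately have lim: "(\<lambda>N. \<Prod>n<N. (1 - l n) * exp (l n)) \<longlonglongrightarrow> D2 (mat f)"
    by (auto intro: Lim_transform_eventually)
  \<comment> \<open>A limit of the partial products does not by itself yield a convergent product,
    since they might tend to 0 with no factor zero. Absolute convergence rules this out and
    identifies the infinite product with the limit.\<close>
  have "summable (\<lambda>n. cmod ((1 - l n) * exp (l n) - 1))"
  proof (rule summable_comparison_test_ev)
    show "\<forall>\<^sub>F n in sequentially. norm (cmod ((1 - l n) * exp (l n) - 1)) \<le> 7 * (cmod (l n))\<^sup>2"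
    proof -
      have "\<forall>\<^sub>F n in sequentially. cmod (l n) < 1" by (rule l0) simp
      then show ?thesis by eventually_elim (simp add: elementary_factor_bound)
    qed
    show "summable (\<lambda>n. 7 * (cmod (l n))\<^sup>2)" using sm by (rule summable_mult)
  qed
  then have "convergent_prod (\<lambda>n. (1 - l n) * exp (l n))"
    by (intro abs_convergent_prod_imp_convergent_prod) (simp add: abs_convergent_prod_conv_summable)
  then have "(\<lambda>N. \<Prod>n\<le>N. (1 - l n) * exp (l n)) \<longlonglongrightarrow> (\<Prod>n. (1 - l n) * exp (l n))"
    by (rule convergent_prod_LIMSEQ)
  moreover have "(\<lambda>N. \<Prod>n\<le>N. (1 - l n) * exp (l n)) \<longlonglongrightarrow> D2 (mat f)"
    using LIMSEQ_Suc[OF lim] by (simp only: lessThan_Suc_atMost)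
  ultimately show ?thesis by (rule LIMSEQ_unique)
qed

lemma nuclear_det_eq_D2:
  assumes f: "f \<in> vectors" and K: "\<And>x. (\<lambda>k. \<phi> k x *\<^sub>C f k) sums blinfun_apply K x"
    and cpt: "compact_operator K"
  shows "nuclear_det K = D2 (mat f)"
proof -
  have nucK: "nuc f = blinfun_apply K"
    using K by (intro ext) (simp add: nuc_def sums_iff)
  have "seq_compact_map (blinfun_apply K)"
    unfolding seq_compact_map_def
  proof (intro allI impI)
    fix y :: "nat \<Rightarrow> 'a" assume "bounded (range y)"
    then obtain B where B: "B > 0" "\<And>n. norm (y n) \<le> B" by (auto simp: bounded_pos)
    define z where "z n = (1 / B) *\<^sub>R y n" for n
    have "z n \<in> cball 0 1" for n using B(1) B(2)[of n] by (simp add: z_def field_simps)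
    then have "blinfun_apply K (z n) \<in> closure (blinfun_apply K ` cball 0 1)" for n
      using closure_subset by blast
    moreover have "seq_compact (closure (blinfun_apply K ` cball 0 1))"
      using cpt by (simp add: compact_operator_def compact_eq_seq_compact_metric)
    ultimately obtain l r where r: "strict_mono r" "((\<lambda>n. blinfun_apply K (z n)) \<circ> r) \<longlonglongrightarrow> l"
      using seq_compactE[of "closure (blinfun_apply K ` cball 0 1)" "\<lambda>n. blinfun_apply K (z n)"] by metis
    from r(2) have "(\<lambda>n. B *\<^sub>R blinfun_apply K (z (r n))) \<longlonglongrightarrow> B *\<^sub>R l"
      by (intro tendsto_intros) (simp add: o_def)
    then have "(\<lambda>n. blinfun_apply K (y (r n))) \<longlonglongrightarrow> B *\<^sub>R l"
      using B(1) by (simp add: z_def blinfun.scaleR_right)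
    with r(1) show "\<exists>r l. strict_mono r \<and> (\<lambda>n. blinfun_apply K (y (r n))) \<longlonglongrightarrow> l" by blast
  qed
  then have adm: "admissible f" using f by (simp add: admissible_def nucK)
  have ge: "generalized_eigenspace K \<mu> = gspace (nuc f) \<mu>" for \<mu>
    by (simp add: generalized_eigenspace_def gspace_def nucK)
  have ev: "is_eigenvalue K \<mu> = eigenval (nuc f) \<mu>" for \<mu>
    by (simp add: is_eigenvalue_def eigenval_def nucK)
  have am: "has_mult (nuc f) \<mu> (algebraic_multiplicity K \<mu>)" if "\<mu> \<noteq> 0" for \<mu>
    using finite_multiplicity[OF adm that] has_mult_dim
    by (metis algebraic_multiplicity_def ge)
  have am0: "algebraic_multiplicity K \<mu> = 0 \<longleftrightarrow> \<not> eigenval (nuc f) \<mu>" if "\<mu> \<noteq> 0" for \<mu>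
    by (rule has_mult_0_iff[OF admissible_clinear[OF adm] am[OF that]])
  have pos: "algebraic_multiplicity K \<mu> > 0" if "\<mu> \<in> {\<mu>. \<mu> \<noteq> 0 \<and> eigenval (nuc f) \<mu>}" for \<mu>
    using am0[of \<mu>] that by auto
  have zero: "0 \<notin> {\<mu>. \<mu> \<noteq> 0 \<and> eigenval (nuc f) \<mu>}" by simp
  obtain l0 :: "nat \<Rightarrow> complex" where l0: "range l0 - {0} = {\<mu>. \<mu> \<noteq> 0 \<and> eigenval (nuc f) \<mu>}"
    "\<forall>\<mu>\<in>{\<mu>. \<mu> \<noteq> 0 \<and> eigenval (nuc f) \<mu>}.
       finite {n. l0 n = \<mu>} \<and> card {n. l0 n = \<mu>} = algebraic_multiplicity K \<mu>"
    by (rule exists_enumeration[OF countable_eigenvalues[OF adm] zero pos])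
  from l0 have "enumerates_eigenvalues K l0"
    unfolding enumerates_eigenvalues_def ev by simp
  \<comment> \<open>The determinant refers to an arbitrary choice of enumeration. Existence was
    settled with \<open>l0\<close>; from here on only the defining property of the chosen one is
    available.\<close>
  define l where "l = (SOME l. enumerates_eigenvalues K l)"
  have en: "enumerates_eigenvalues K l"
    unfolding l_def by (rule someI[of "enumerates_eigenvalues K"]) fact
  have "finite {n. l n = \<mu>} \<and> has_mult (nuc f) \<mu> (card {n. l n = \<mu>})" if \<mu>: "\<mu> \<noteq> 0" for \<mu>
  proof (cases "eigenval (nuc f) \<mu>")
    case True
    then show ?thesis using en am[OF \<mu>] \<mu> unfolding enumerates_eigenvalues_def ev by simp
  next
    case False
    then have "\<mu> \<notin> range l" using en \<mu> unfolding enumerates_eigenvalues_def ev by blast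
    then have "{n. l n = \<mu>} = {}" by auto
    moreover have "has_mult (nuc f) \<mu> 0" by (rule has_mult_0[OF admissible_clinear[OF adm] False])
    ultimately show ?thesis by simp
  qed
  from prodinf_eigenvalues[OF adm this] show ?thesis
    by (simp add: nuclear_det_def l_def)
qed

end

section \<open>Holomorphy\<close>

lemma nuclear_representation_exists:
  assumes "nuclear_operator K" "e > 0"
  obtains \<phi> f where "nuclear_representation K \<phi> f" "(\<Sum>n. norm (\<phi> n) * norm (f n)) < nuclear_norm K + e"
proof -
  let ?X = "{(\<Sum>n. norm (\<phi> n) * norm (f n)) | \<phi> f. nuclear_representation K \<phi> f}"
  have "?X \<noteq> {}" using assms(1) by (auto simp: nuclear_operator_def)
  moreover have "Inf ?X < nuclear_norm K + e" using assms(2) by (simp add: nuclear_norm_def)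
  ultimately have "\<exists>s\<in>?X. s < nuclear_norm K + e" by (rule cInf_lessD)
  then show ?thesis using that by blast
qed

text \<open>The coefficients of the power series are represented with weights \<open>r ^ n\<close>; each rank-one term is
  then balanced so that both factors have norm \<open>sqrt (r ^ n * norm \<phi> * norm f)\<close> at radius \<open>r\<close>.\<close>

lemma nuclear_analytic_local_representation:
  fixes K :: "complex \<Rightarrow> 'a::complex_banach \<Rightarrow>\<^sub>L 'a"
  assumes K: "nuclear_analytic_on K \<Omega>" and "open \<Omega>" and z0: "z0 \<in> \<Omega>"
  obtains r \<phi> and f :: "nat \<Rightarrow> 'a" and \<beta> d where "r > 0" "ball z0 r \<subseteq> \<Omega>" "functional_sequence \<phi>" "square_summable \<beta>"
    "\<forall>z\<in>ball z0 r. \<forall>i. norm ((z - z0) ^ d i *\<^sub>C f i) \<le> \<beta> i"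
    "\<forall>z\<in>ball z0 r. \<forall>x. (\<lambda>i. blinfun_apply (\<phi> i) x *\<^sub>C (z - z0) ^ d i *\<^sub>C f i) sums blinfun_apply (K z) x"
proof -
  have "\<exists>R>0. \<exists>C. (\<forall>n. nuclear_operator (C n)) \<and> (\<forall>z\<in>\<Omega>. cmod (z - z0) < R \<longrightarrow>
      (\<lambda>n. (z - z0) ^ n *\<^sub>C C n) sums K z \<and> summable (\<lambda>n. cmod (z - z0) ^ n * nuclear_norm (C n)))"
    using K unfolding nuclear_analytic_on_def by (elim conjE ballE[of _ _ z0]) (use z0 in simp_all)
  then obtain R C where "R > 0" and "\<forall>n. nuclear_operator (C n)"
    and RC: "\<forall>z\<in>\<Omega>. cmod (z - z0) < R \<longrightarrow>
      (\<lambda>n. (z - z0) ^ n *\<^sub>C C n) sums K z \<and> summable (\<lambda>n. cmod (z - z0) ^ n * nuclear_norm (C n))"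
    by (elim exE conjE)
  then have C: "nuclear_operator (C n)" for n by simp
  have ser: "(\<lambda>n. (z - z0) ^ n *\<^sub>C C n) sums K z" if "z \<in> \<Omega>" "cmod (z - z0) < R" for z
    using RC that by simp
  have smC: "summable (\<lambda>n. cmod (z - z0) ^ n * nuclear_norm (C n))" if "z \<in> \<Omega>" "cmod (z - z0) < R" for z
    using RC that by simp
  obtain \<rho> where \<rho>: "\<rho> > 0" "ball z0 \<rho> \<subseteq> \<Omega>" using \<open>open \<Omega>\<close> z0 by (meson openE)
  \<comment> \<open>Staying strictly inside both radii makes the series of nuclear norms converge at
    distance \<open>r\<close> itself, and that convergence supplies the dominating sums.\<close>
  define r where "r = min R \<rho> / 2"
  have r: "r > 0" "r < R" "r < \<rho>" using \<rho> \<open>R > 0\<close> by (auto simp: r_def)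
  have rball: "ball z0 r \<subseteq> \<Omega>" using \<rho>(2) r by (meson less_imp_le subset_ball subset_trans)
  \<comment> \<open>The slack over the infimum is chosen so that its weighted contribution
    \<open>r ^ n * \<epsilon> n\<close> is \<open>(1 / 2) ^ n\<close>, which is summable.\<close>
  define \<epsilon> where "\<epsilon> n = (1 / (2 * r)) ^ n" for n
  have \<epsilon>: "\<epsilon> n > 0" for n using r by (simp add: \<epsilon>_def)
  have "\<forall>n. \<exists>p. nuclear_representation (C n) (fst p) (snd p) \<and>
      (\<Sum>j. norm (fst p j) * norm (snd p j)) < nuclear_norm (C n) + \<epsilon> n"
    using nuclear_representation_exists[OF C \<epsilon>] by (metis fst_conv snd_conv)
  then obtain p where p: "\<And>n. nuclear_representation (C n) (fst (p n)) (snd (p n))"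
    "\<And>n. (\<Sum>j. norm (fst (p n) j) * norm (snd (p n) j)) < nuclear_norm (C n) + \<epsilon> n"
    by metis
  define \<Phi> where "\<Phi> n j = fst (p n) j" for n j
  define G where "G n j = snd (p n) j" for n j
  have rep: "complex_linear (\<Phi> n j)" "(\<lambda>j. blinfun_apply (\<Phi> n j) x *\<^sub>C G n j) sums blinfun_apply (C n) x"
    "summable (\<lambda>j. norm (\<Phi> n j) * norm (G n j))" for n j x
    using p(1)[of n] by (auto simp: nuclear_representation_def \<Phi>_def G_def)
  define s where "s q = r ^ fst q * (norm (\<Phi> (fst q) (snd q)) * norm (G (fst q) (snd q)))" for q
  have s0: "s q \<ge> 0" for q using r by (simp add: s_def)
  have s_summable: "s summable_on UNIV"
  proof -
    define t where "t n = (\<Sum>j. norm (\<Phi> n j) * norm (G n j))" for n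
    have t0: "t n \<ge> 0" for n unfolding t_def by (intro suminf_nonneg rep) auto
    have inner: "((\<lambda>j. s (n, j)) has_sum r ^ n * t n) UNIV" for n
      unfolding s_def fst_conv snd_conv t_def
      by (rule norm_summable_imp_has_sum)
         (use r in \<open>auto simp: abs_mult intro!: summable_mult rep sums_mult summable_sums\<close>)
    have "summable (\<lambda>n. r ^ n * t n)"
    proof (rule summable_comparison_test'[where g = "\<lambda>n. r ^ n * nuclear_norm (C n) + (1 / 2) ^ n"])
      have "z0 + of_real r \<in> \<Omega>" using \<rho>(2) r by (auto simp: dist_norm)
      then have "summable (\<lambda>n. r ^ n * nuclear_norm (C n))"
        using smC[of "z0 + of_real r"] r by simp
      then show "summable (\<lambda>n. r ^ n * nuclear_norm (C n) + (1 / 2) ^ n)"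
        by (intro summable_add summable_geometric) auto
      fix n
      have "r ^ n * t n \<le> r ^ n * (nuclear_norm (C n) + \<epsilon> n)"
        using p(2)[of n] r by (intro mult_left_mono) (auto simp: t_def \<Phi>_def G_def)
      also have "\<dots> = r ^ n * nuclear_norm (C n) + (1 / 2) ^ n"
        using r by (simp add: \<epsilon>_def distrib_left power_mult_distrib[symmetric])
      finally show "norm (r ^ n * t n) \<le> r ^ n * nuclear_norm (C n) + (1 / 2) ^ n"
        using r t0 by (simp add: abs_mult)
    qed
    then have "(\<lambda>n. r ^ n * t n) summable_on UNIV"
      by (rule summable_nonneg_imp_summable_on) (use r t0 in simp)
    then have "s summable_on Sigma UNIV (\<lambda>_. UNIV)"
      by (rule summable_on_SigmaI[OF inner]) (use s0 in auto)
    then show ?thesis by simp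
  qed
  define N where "N i = fst (prod_decode i)" for i
  define J where "J i = snd (prod_decode i)" for i
  \<comment> \<open>Terms with a zero factor cannot be balanced; both factors are replaced by 0,
    which leaves the rank-one term unchanged.\<close>
  define tr where "tr i = (\<Phi> (N i) (J i) = 0 \<or> G (N i) (J i) = 0)" for i
  \<comment> \<open>The scaling that equalizes the factors: moved from the vector to the functional,
    it gives both \<open>\<phi> i\<close> and the weighted vector the square
    \<open>s (prod_decode i)\<close>.\<close>
  define c where "c i = sqrt (r ^ N i * norm (G (N i) (J i)) / norm (\<Phi> (N i) (J i)))" for i
  define \<phi> where "\<phi> i = (if tr i then 0 else c i *\<^sub>R \<Phi> (N i) (J i))" for i
  define f where "f i = (if tr i then 0 else (1 / c i) *\<^sub>R G (N i) (J i))" for i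
  define \<beta> where "\<beta> i = r ^ N i * norm (f i)" for i
  have c0: "c i > 0" if "\<not> tr i" for i using that r by (simp add: c_def tr_def)
  have \<phi>sq: "(norm (\<phi> i))\<^sup>2 = s (prod_decode i)" for i
  proof (cases "tr i")
    case False
    then have "(norm (\<phi> i))\<^sup>2 = (c i)\<^sup>2 * (norm (\<Phi> (N i) (J i)))\<^sup>2"
      by (simp add: \<phi>_def power_mult_distrib)
    also have "(c i)\<^sup>2 = r ^ N i * norm (G (N i) (J i)) / norm (\<Phi> (N i) (J i))"
      using r by (simp add: c_def)
    finally show ?thesis using False by (simp add: s_def N_def J_def tr_def power2_eq_square)
  qed (auto simp: \<phi>_def s_def tr_def N_def J_def)
  have \<beta>sq: "(\<beta> i)\<^sup>2 = s (prod_decode i)" for i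
  proof (cases "tr i")
    case False
    then have "(\<beta> i)\<^sup>2 = (r ^ N i)\<^sup>2 * (norm (G (N i) (J i)))\<^sup>2 / (c i)\<^sup>2"
      by (simp add: \<beta>_def f_def power_mult_distrib power_divide)
    also have "(c i)\<^sup>2 = r ^ N i * norm (G (N i) (J i)) / norm (\<Phi> (N i) (J i))"
      using r by (simp add: c_def)
    finally show ?thesis using False r by (simp add: s_def N_def J_def tr_def power2_eq_square)
  qed (auto simp: \<beta>_def f_def s_def tr_def N_def J_def)
  have "(\<lambda>i. s (prod_decode i)) summable_on UNIV"
    using s_summable summable_on_reindex_bij_betw[OF bij_prod_decode, of s] by simp
  then have ssum: "summable (\<lambda>i. s (prod_decode i))" by (rule summable_on_imp_summable)
  have fs: "functional_sequence \<phi>"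
  proof
    fix i
    have "blinfun_apply (\<Phi> (N i) (J i)) (a *\<^sub>C x) = a *\<^sub>C blinfun_apply (\<Phi> (N i) (J i)) x" for a x
      using rep(1) by (simp add: complex_linear_def)
    then show "complex_linear (\<phi> i)"
      by (simp add: complex_linear_def \<phi>_def blinfun.scaleR_left scaleC_complex_def)
  qed (use ssum in \<open>simp add: square_summable_def \<phi>sq\<close>)
  have b: "square_summable \<beta>"
    using ssum r by (simp add: square_summable_def \<beta>sq) (simp add: \<beta>_def)
  have summand: "blinfun_apply (\<phi> i) x *\<^sub>C a *\<^sub>C f i = blinfun_apply (\<Phi> (N i) (J i)) x *\<^sub>C a *\<^sub>C G (N i) (J i)" for i x a
  proof (cases "tr i")
    case False
    then show ?thesis
      using c0[OF False]
      by (simp only: \<phi>_def f_def if_False False blinfun.scaleR_left)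
         (simp add: scaleR_eq_scaleC scaleC_scaleC scaleC_complex_def)
  qed (auto simp: \<phi>_def f_def tr_def)
  show ?thesis
  proof (rule that[OF r(1) rball fs b]; intro ballI allI)
    fix z i assume z: "z \<in> ball z0 r"
    have "cmod (z - z0) ^ N i \<le> r ^ N i"
      using z by (intro power_mono) (auto simp: dist_norm norm_minus_commute)
    then show "norm ((z - z0) ^ N i *\<^sub>C f i) \<le> \<beta> i"
      by (simp add: norm_scaleC norm_power \<beta>_def mult_right_mono)
  next
    fix z x assume z: "z \<in> ball z0 r"
    then have zr: "cmod (z - z0) < r" by (simp add: dist_norm norm_minus_commute)
    define u where "u q = blinfun_apply (\<Phi> (fst q) (snd q)) x *\<^sub>C (z - z0) ^ fst q *\<^sub>C G (fst q) (snd q)" for q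
    have u_le: "norm (u q) \<le> norm (s q * norm x)" for q
    proof -
      have "norm (u q) = cmod (blinfun_apply (\<Phi> (fst q) (snd q)) x) * (cmod (z - z0) ^ fst q * norm (G (fst q) (snd q)))"
        by (simp add: u_def norm_scaleC norm_power norm_mult)
      also have "\<dots> \<le> (norm (\<Phi> (fst q) (snd q)) * norm x) * (r ^ fst q * norm (G (fst q) (snd q)))"
        using zr r by (intro mult_mono norm_blinfun power_mono) auto
      also have "\<dots> = s q * norm x" by (simp add: s_def)
      finally show ?thesis using s0[of q] by simp
    qed
    have "(\<lambda>q. norm (s q * norm x)) summable_on UNIV"
      using s_summable s0 by (simp add: abs_mult summable_on_cmult_left)
    then have "(\<lambda>q. norm (u q)) summable_on UNIV"
      by (rule Infinite_Sum.abs_summable_on_comparison_test) (rule u_le)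
    then have "u summable_on UNIV" by (rule Infinite_Sum.abs_summable_summable)
    \<comment> \<open>The unconditional double sum \<open>T\<close> is evaluated twice: as an
      iterated sum it is the power series at \<open>x\<close>, and along the pairing function it is
      the single series of rank-one terms.\<close>
    then obtain T where T: "(u has_sum T) UNIV" by (auto simp: summable_on_def)
    have "((\<lambda>j. u (n, j)) has_sum (z - z0) ^ n *\<^sub>C blinfun_apply (C n) x) UNIV" for n
    proof (rule norm_summable_imp_has_sum)
      have "norm (u (n, j)) \<le> norm (\<Phi> n j) * norm (G n j) * (r ^ n * norm x)" for j
        using u_le[of "(n, j)"] s0[of "(n, j)"] by (simp add: s_def mult_ac)
      then show "summable (\<lambda>j. norm (u (n, j)))"
        by (intro summable_comparison_test'[OF summable_mult2[OF rep(3)], where N = 0]) simp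
      show "(\<lambda>j. u (n, j)) sums ((z - z0) ^ n *\<^sub>C blinfun_apply (C n) x)"
        using bounded_linear.sums[OF bounded_linear_scaleC rep(2)[of n x], of "(z - z0) ^ n"]
        by (simp add: u_def scaleC_scaleC mult.commute)
    qed
    then have "((\<lambda>n. (z - z0) ^ n *\<^sub>C blinfun_apply (C n) x) has_sum T) UNIV"
      using has_sum_SigmaD[where f = u and S = T and A = UNIV and B = "\<lambda>_. UNIV"] T by simp
    then have "(\<lambda>n. (z - z0) ^ n *\<^sub>C blinfun_apply (C n) x) sums T" by (rule has_sum_imp_sums)
    moreover have "(\<lambda>n. (z - z0) ^ n *\<^sub>C blinfun_apply (C n) x) sums blinfun_apply (K z) x"
      using bounded_linear.sums[OF blinfun.bounded_linear_left ser[of z]] z rball zr r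
      by (auto simp: blinfun_apply_scaleC)
    ultimately have "T = blinfun_apply (K z) x" by (rule sums_unique2)
    moreover have "((\<lambda>i. u (prod_decode i)) has_sum T) UNIV"
      using T has_sum_reindex_bij_betw[OF bij_prod_decode, of u T] by simp
    then have "(\<lambda>i. u (prod_decode i)) sums T" by (rule has_sum_imp_sums)
    ultimately show "(\<lambda>i. blinfun_apply (\<phi> i) x *\<^sub>C (z - z0) ^ N i *\<^sub>C f i) sums blinfun_apply (K z) x"
      unfolding summand by (simp add: u_def N_def J_def)
  qed
qed

theorem theorem3p6:
  fixes \<Omega> :: "complex set" and K :: "complex \<Rightarrow> 'a::complex_banach \<Rightarrow>\<^sub>L 'a"
  assumes "open \<Omega>" and "connected \<Omega>" and "\<Omega> \<noteq> {}"
    and "nuclear_analytic_on K \<Omega>"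
  shows "(\<lambda>z. nuclear_det (K z)) holomorphic_on \<Omega>"
proof (rule holomorphic_onI)
  fix z0 assume z0: "z0 \<in> \<Omega>"
  obtain r \<phi> and f :: "nat \<Rightarrow> 'a" and \<beta> d where r: "r > 0" "ball z0 r \<subseteq> \<Omega>"
    and fs: "functional_sequence \<phi>" and \<beta>: "square_summable \<beta>"
    and le: "\<forall>z\<in>ball z0 r. \<forall>i. norm ((z - z0) ^ d i *\<^sub>C f i) \<le> \<beta> i"
    and K: "\<forall>z\<in>ball z0 r. \<forall>x.
      (\<lambda>i. blinfun_apply (\<phi> i) x *\<^sub>C (z - z0) ^ d i *\<^sub>C f i) sums blinfun_apply (K z) x"
    by (rule nuclear_analytic_local_representation[OF assms(4,1) z0])
  note le = le[rule_format] and K = K[rule_format]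
  interpret functional_sequence \<phi> by (rule fs)
  \<comment> \<open>All dependence on \<open>z\<close> sits in the vectors. The functionals stay
    fixed on the ball, so one interpretation of the locale covers every \<open>z\<close>, and each
    matrix entry is a monomial in \<open>z - z0\<close>.\<close>
  define F where "F z i = (z - z0) ^ d i *\<^sub>C f i" for z i
  have "(\<lambda>z. D2 (mat (F z))) holomorphic_on ball z0 r"
  proof (rule D2_holomorphic[OF square_summable_\<phi> \<beta> open_ball])
    show "dominated (\<lambda>n. norm (\<phi> n)) \<beta> (mat (F z))" if "z \<in> ball z0 r" for z
      unfolding dominated_def
    proof (intro allI)
      fix i j
      have "cmod (mat (F z) i j) \<le> norm (\<phi> i) * norm (F z j)" unfolding mat_def by (rule \<phi>_le)
      also have "\<dots> \<le> norm (\<phi> i) * \<beta> j"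
        using le[OF that] by (intro mult_left_mono) (auto simp: F_def)
      finally show "cmod (mat (F z) i j) \<le> norm (\<phi> i) * \<beta> j" .
    qed
    show "(\<lambda>z. mat (F z) i j) holomorphic_on ball z0 r" for i j
      unfolding mat_def F_def \<phi>_scale by (intro holomorphic_intros)
  qed
  moreover have "D2 (mat (F z)) = nuclear_det (K z)" if z: "z \<in> ball z0 r" for z
  proof (rule nuclear_det_eq_D2[symmetric])
    show "F z \<in> vectors"
      unfolding vectors_def using square_summable_mono[OF \<beta>] le[OF z] by (simp add: F_def)
    show "(\<lambda>k. blinfun_apply (\<phi> k) x *\<^sub>C F z k) sums blinfun_apply (K z) x" for x
      unfolding F_def by (rule K[OF z])
    show "compact_operator (K z)"
      using assms(4) z r(2) by (auto simp: nuclear_analytic_on_def nuclear_operator_def)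
  qed
  ultimately have "(\<lambda>z. nuclear_det (K z)) holomorphic_on ball z0 r"
    by (rule holomorphic_transform)
  then have "(\<lambda>z. nuclear_det (K z)) field_differentiable at z0"
    using r(1) by (intro holomorphic_on_imp_differentiable_at[OF _ open_ball]) auto
  then show "(\<lambda>z. nuclear_det (K z)) field_differentiable at z0 within \<Omega>"
    by (rule field_differentiable_at_within)
qed

end
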